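(* Let $X$ be a compact Kähler manifold with Kähler form $\omega$, and let $\alpha,\beta\in A^{1,1}(X)$ be $(1,1)$-forms, with $\theta,\phi\in A^{1,0}(\Theta)$ determined by $\theta\lrcorner\,\omega=\alpha$, $\phi\lrcorner\,\omega=\beta$. Then $$[\alpha,\beta]+\partial(\theta\lrcorner\,\beta+\phi\lrcorner\,\alpha)=(\#\partial\alpha)\lrcorner\,\beta+(\#\partial\beta)\lrcorner\,\alpha+\theta\lrcorner\,\partial\beta+\phi\lrcorner\,\partial\alpha,$$ where $\#:A^{2,1}\to A^{2,0}(\Theta)$ is the natural map given by $(\#\Gamma)\lrcorner\,\omega=\Gamma$.
   Context: $A^{p,q}$ denotes smooth $(p,q)$-forms on $X$, and $A^{p,0}(\Theta)$ smooth $(p,0)$-forms with values in the holomorphic tangent bundle. The interior product of $v\otimes\xi\in A^{p,0}(\Theta)$ ($v$ a vector field of type $(1,0)$, $\xi$ a $(p,0)$-form) with a form $\eta$ is $(v\otimes\xi)\lrcorner\,\eta=\xi\wedge\iota_v\eta$, extended linearly; $\lrcorner\,\omega$ gives an isomorphism $A^{p,0}(\Theta)\to A^{p,1}$. Bracket $[\ ,\ ]:A^{1,1}\times A^{1,1}\to A^{2,1}$: at a given point $P$ choose local holomorphic coordinates with $\omega=\frac i2\sum dz_i\wedge d\bar z_i+O(|z|^2)$, and write $\alpha=\frac i2\sum a_{ij}\,dz_i\wedge d\bar z_j$, $\beta=\frac i2\sum b_{ij}\,dz_i\wedge d\bar z_j$ near $P$. Then at $P$ $$[\alpha,\beta]=\frac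 i2\sum_{i,j,k,l}\Big(a_{ij}\frac{\partial b_{kl}}{\partial z_j}+b_{ij}\frac{\partial a_{kl}}{\partial z_j}\Big)d\bar z_l\wedge dz_i\wedge dz_k,$$ which is independent of the choice of such coordinates. *)

theory Defs
  imports
    "HOL-Analysis.Analysis"
    "HOL-Combinatorics.Permutations"
    "HOL-Library.Landau_Symbols"
    "HOL-Library.Function_Algebras"
begin

section \<open>Smooth and holomorphic maps\<close>

text \<open>On an open set of a finite-dimensional space, continuity of all the directional derivatives
  \<open>x \<mapsto> Df(x)v\<close> is the same as continuity of \<open>Df\<close>, so this is the usual class \<open>C\<^sup>k\<close>.\<close>

fun Ck_on :: "nat \<Rightarrow> 'a::real_normed_vector set \<Rightarrow> ('a \<Rightarrow> 'b::real_normed_vector) \<Rightarrow> bool" where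
  "Ck_on 0 S f \<longleftrightarrow> continuous_on S f"
| "Ck_on (Suc k) S f \<longleftrightarrow> (\<forall>x\<in>S. f differentiable (at x)) \<and>
     (\<forall>v. Ck_on k S (\<lambda>x. frechet_derivative f (at x) v))"

definition smooth_on :: "'a::real_normed_vector set \<Rightarrow> ('a \<Rightarrow> 'b::real_normed_vector) \<Rightarrow> bool" where
  "smooth_on S f \<longleftrightarrow> (\<forall>k. Ck_on k S f)"

definition holo_on :: "(complex ^ 'n) set \<Rightarrow> (complex ^ 'n \<Rightarrow> complex ^ 'n) \<Rightarrow> bool" where
  "holo_on S f \<longleftrightarrow> smooth_on S f \<and>
     (\<forall>x\<in>S. \<forall>c v. frechet_derivative f (at x) (c *s v) = c *s frechet_derivative f (at x) v)"

definition d_dz :: "'n \<Rightarrow> (complex ^ 'n \<Rightarrow> complex) \<Rightarrow> complex ^ 'n \<Rightarrow> complex" where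
  "d_dz k f x = (frechet_derivative f (at x) (axis k 1)
                  - \<i> * frechet_derivative f (at x) (axis k \<i>)) / 2"

definition d_dzbar :: "'n \<Rightarrow> (complex ^ 'n \<Rightarrow> complex) \<Rightarrow> complex ^ 'n \<Rightarrow> complex" where
  "d_dzbar k f x = (frechet_derivative f (at x) (axis k 1)
                  + \<i> * frechet_derivative f (at x) (axis k \<i>)) / 2"

section \<open>Exterior algebra of \<open>\<complex>\<^sup>n\<close>\<close>

text \<open>A complex-valued alternating \<open>k\<close>-form on the real vector space underlying \<open>\<complex>\<^sup>n\<close> is
  represented by its values on lists of \<open>k\<close> vectors, extended by 0 to lists of any other
  length.\<close>

type_synonym 'n altform = "(complex, 'n) vec list \<Rightarrow> complex"
type_synonym 'n valtform = "(complex, 'n) vec list \<Rightarrow> (complex, 'n) vec"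

definition one_form0 :: "'n::finite altform" where
  "one_form0 vs = (if vs = [] then 1 else 0)"

definition dz :: "'n::finite \<Rightarrow> 'n altform" where
  "dz k vs = (case vs of [v] \<Rightarrow> v $ k | _ \<Rightarrow> 0)"

definition dzbar :: "'n::finite \<Rightarrow> 'n altform" where
  "dzbar k vs = (case vs of [v] \<Rightarrow> cnj (v $ k) | _ \<Rightarrow> 0)"

text \<open>The exterior product \<open>\<xi> \<and> \<eta>\<close> of a \<open>p\<close>-form \<open>\<xi>\<close> and a \<open>q\<close>-form \<open>\<eta>\<close>, normalised so that
  \<open>(\<lambda> \<and> \<mu>)(v, w) = \<lambda>(v)\<mu>(w) - \<lambda>(w)\<mu>(v)\<close> for \<open>1\<close>-forms. Only lists of length \<open>p + q\<close> give
  a nonzero value, so \<open>length vs - p\<close> stands for \<open>q\<close>.\<close>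

definition wedge :: "nat \<Rightarrow> 'n::finite altform \<Rightarrow> 'n altform \<Rightarrow> 'n altform" where
  "wedge p \<xi> \<eta> vs =
     (\<Sum>\<sigma> | \<sigma> permutes {..<length vs}.
        of_int (sign \<sigma>) * \<xi> (take p (permute_list \<sigma> vs)) * \<eta> (drop p (permute_list \<sigma> vs)))
     / (fact p * fact (length vs - p))"

definition wedges :: "'n::finite altform list \<Rightarrow> 'n altform" where
  "wedges cs = foldr (wedge 1) cs one_form0"

text \<open>Complex linear combinations of the \<open>dz\<^sub>I \<and> dzbar\<^sub>J\<close> with \<open>|I| = p\<close> and \<open>|J| = q\<close>.\<close>

definition Lambda :: "nat \<Rightarrow> nat \<Rightarrow> ('n::finite altform) set" where
  "Lambda p q = {\<eta>. \<exists>a. \<eta> = (\<lambda>vs. \<Sum>I | length I = p. \<Sum>J | length J = q.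
                          a I J * wedges (map dz I @ map dzbar J) vs)}"

text \<open>\<open>(p,0)\<close>-forms with values in the holomorphic tangent space: \<open>\<theta>\<close> stands for
  \<open>\<Sum>\<^sub>j \<partial>/\<partial>z\<^sub>j \<otimes> \<theta>\<^sub>j\<close>, where \<open>\<theta>\<^sub>j\<close> is the \<open>j\<close>-th component of \<open>\<theta>\<close>.\<close>

definition Lambda_Theta :: "nat \<Rightarrow> ('n::finite valtform) set" where
  "Lambda_Theta p = {\<theta>. \<forall>j. (\<lambda>vs. \<theta> vs $ j) \<in> Lambda p 0}"

text \<open>Contraction with \<open>\<partial>/\<partial>z\<^sub>j = (\<partial>/\<partial>x\<^sub>j - \<i> \<partial>/\<partial>y\<^sub>j) / 2\<close>, with \<open>\<eta>\<close> extended complex linearly to the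
  complexified tangent space.\<close>

definition iota :: "'n::finite \<Rightarrow> 'n altform \<Rightarrow> 'n altform" where
  "iota j \<eta> vs = (\<eta> (axis j 1 # vs) - \<i> * \<eta> (axis j \<i> # vs)) / 2"

definition contract_pt :: "nat \<Rightarrow> 'n::finite valtform \<Rightarrow> 'n altform \<Rightarrow> 'n altform" where
  "contract_pt p \<theta> \<eta> vs = (\<Sum>j\<in>UNIV. wedge p (\<lambda>ws. \<theta> ws $ j) (iota j \<eta>) vs)"

text \<open>The matrix \<open>a\<close> with \<open>\<eta> = \<i>/2 \<Sum>\<^sub>i\<^sub>j a\<^sub>i\<^sub>j dz\<^sub>i \<and> dzbar\<^sub>j\<close>.\<close>

definition coeff11 :: "'n::finite altform \<Rightarrow> 'n \<Rightarrow> 'n \<Rightarrow> complex" where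
  "coeff11 \<eta> = (THE a. \<eta> = (\<lambda>vs. \<i> / 2 * (\<Sum>i\<in>UNIV. \<Sum>j\<in>UNIV. a i j * wedges [dz i, dzbar j] vs)))"

section \<open>Differential forms on open subsets of \<open>\<complex>\<^sup>n\<close>\<close>

definition del_loc :: "((complex, 'n::finite) vec \<Rightarrow> 'n altform) \<Rightarrow> (complex, 'n) vec \<Rightarrow> 'n altform" where
  "del_loc \<eta> x vs = (\<Sum>k\<in>UNIV. wedge 1 (dz k) (\<lambda>ws. d_dz k (\<lambda>y. \<eta> y ws) x) vs)"

definition delbar_loc :: "((complex, 'n::finite) vec \<Rightarrow> 'n altform) \<Rightarrow> (complex, 'n) vec \<Rightarrow> 'n altform" where
  "delbar_loc \<eta> x vs = (\<Sum>k\<in>UNIV. wedge 1 (dzbar k) (\<lambda>ws. d_dzbar k (\<lambda>y. \<eta> y ws) x) vs)"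

definition bracket_loc ::
  "((complex, 'n::finite) vec \<Rightarrow> 'n altform) \<Rightarrow> ((complex, 'n) vec \<Rightarrow> 'n altform) \<Rightarrow> (complex, 'n) vec \<Rightarrow> 'n altform"
  where
  "bracket_loc \<alpha> \<beta> x vs =
     (let a = (\<lambda>i j y. coeff11 (\<alpha> y) i j); b = (\<lambda>i j y. coeff11 (\<beta> y) i j) in
      \<i> / 2 * (\<Sum>i\<in>UNIV. \<Sum>j\<in>UNIV. \<Sum>k\<in>UNIV. \<Sum>l\<in>UNIV.
        (a i j x * d_dz j (b k l) x + b i j x * d_dz j (a k l) x) * wedges [dzbar l, dz i, dz k] vs))"

section \<open>Complex manifolds\<close>

type_synonym ('a, 'n) chart = "'a set \<times> ('a \<Rightarrow> (complex, 'n) vec)"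

definition chart_image :: "('a, 'n::finite) chart \<Rightarrow> (complex, 'n) vec set" where
  "chart_image c = snd c ` fst c"

definition chart_inv :: "('a, 'n::finite) chart \<Rightarrow> (complex, 'n) vec \<Rightarrow> 'a" where
  "chart_inv c = inv_into (fst c) (snd c)"

definition is_chart :: "'a topology \<Rightarrow> ('a, 'n::finite) chart \<Rightarrow> bool" where
  "is_chart X c \<longleftrightarrow> openin X (fst c) \<and> open (chart_image c) \<and>
     homeomorphic_map (subtopology X (fst c)) (top_of_set (chart_image c)) (snd c)"

definition transition :: "('a, 'n::finite) chart \<Rightarrow> ('a, 'n) chart \<Rightarrow> (complex, 'n) vec \<Rightarrow> (complex, 'n) vec" where
  "transition c c' = snd c' \<circ> chart_inv c"

definition overlap :: "('a, 'n::finite) chart \<Rightarrow> ('a, 'n) chart \<Rightarrow> (complex, 'n) vec set" where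
  "overlap c c' = snd c ` (fst c \<inter> fst c')"

definition compatible :: "('a, 'n::finite) chart \<Rightarrow> ('a, 'n) chart \<Rightarrow> bool" where
  "compatible c c' \<longleftrightarrow> holo_on (overlap c c') (transition c c') \<and> holo_on (overlap c' c) (transition c' c)"

text \<open>\<open>A\<close> is a maximal atlas, so its members are all the local holomorphic coordinate systems of \<open>X\<close>.\<close>

definition complex_manifold :: "'a topology \<Rightarrow> ('a, 'n::finite) chart set \<Rightarrow> bool" where
  "complex_manifold X A \<longleftrightarrow> Hausdorff_space X \<and> second_countable X \<and>
     (\<forall>c\<in>A. is_chart X c) \<and> (\<Union>c\<in>A. fst c) = topspace X \<and>
     (\<forall>c\<in>A. \<forall>c'\<in>A. compatible c c') \<and>
     (\<forall>c. is_chart X c \<and> (\<forall>c'\<in>A. compatible c c') \<longrightarrow> c \<in> A)"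

section \<open>Differential forms on a complex manifold\<close>

text \<open>A form is the family of its expressions \<open>\<eta> c x\<close> in the charts \<open>c\<close> of the atlas, with \<open>x\<close> in
  the image of \<open>c\<close>, related by pullback along the transition maps.\<close>

type_synonym ('a, 'n) form = "('a, 'n) chart \<Rightarrow> (complex, 'n) vec \<Rightarrow> 'n altform"
type_synonym ('a, 'n) vform = "('a, 'n) chart \<Rightarrow> (complex, 'n) vec \<Rightarrow> 'n valtform"

definition d_transition ::
  "('a, 'n::finite) chart \<Rightarrow> ('a, 'n) chart \<Rightarrow> (complex, 'n) vec \<Rightarrow> (complex, 'n) vec \<Rightarrow> (complex, 'n) vec" where
  "d_transition c c' x = frechet_derivative (transition c c') (at x)"

definition forms :: "('a, 'n::finite) chart set \<Rightarrow> nat \<Rightarrow> nat \<Rightarrow> ('a, 'n) form set" where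
  "forms A p q = {\<eta>.
     (\<forall>c\<in>A. \<forall>x\<in>chart_image c. \<eta> c x \<in> Lambda p q) \<and>
     (\<forall>c\<in>A. \<forall>vs. smooth_on (chart_image c) (\<lambda>x. \<eta> c x vs)) \<and>
     (\<forall>c\<in>A. \<forall>c'\<in>A. \<forall>x\<in>overlap c c'. \<forall>vs.
        \<eta> c x vs = \<eta> c' (transition c c' x) (map (d_transition c c' x) vs))}"

definition forms_Theta :: "('a, 'n::finite) chart set \<Rightarrow> nat \<Rightarrow> ('a, 'n) vform set" where
  "forms_Theta A p = {\<theta>.
     (\<forall>c\<in>A. \<forall>x\<in>chart_image c. \<theta> c x \<in> Lambda_Theta p) \<and>
     (\<forall>c\<in>A. \<forall>vs. smooth_on (chart_image c) (\<lambda>x. \<theta> c x vs)) \<and>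
     (\<forall>c\<in>A. \<forall>c'\<in>A. \<forall>x\<in>overlap c c'. \<forall>vs.
        d_transition c c' x (\<theta> c x vs) = \<theta> c' (transition c c' x) (map (d_transition c c' x) vs))}"

definition form_eq :: "('a, 'n::finite) chart set \<Rightarrow> ('a, 'n) form \<Rightarrow> ('a, 'n) form \<Rightarrow> bool" where
  "form_eq A \<eta> \<zeta> \<longleftrightarrow> (\<forall>c\<in>A. \<forall>x\<in>chart_image c. \<eta> c x = \<zeta> c x)"

definition del :: "('a, 'n::finite) form \<Rightarrow> ('a, 'n) form" where
  "del \<eta> c = del_loc (\<eta> c)"

definition delbar :: "('a, 'n::finite) form \<Rightarrow> ('a, 'n) form" where
  "delbar \<eta> c = delbar_loc (\<eta> c)"

definition contract :: "nat \<Rightarrow> ('a, 'n::finite) vform \<Rightarrow> ('a, 'n) form \<Rightarrow> ('a, 'n) form" where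
  "contract p \<theta> \<eta> c x = contract_pt p (\<theta> c x) (\<eta> c x)"

section \<open>Kaehler forms, the map \<open>#\<close> and the bracket\<close>

text \<open>Real, positive, and closed (with \<open>d = \<partial> + \<partial>bar\<close>); multiplication by \<open>\<i>\<close> is the complex structure.\<close>

definition kaehler_form :: "('a, 'n::finite) chart set \<Rightarrow> ('a, 'n) form \<Rightarrow> bool" where
  "kaehler_form A \<omega> \<longleftrightarrow> \<omega> \<in> forms A 1 1 \<and>
     (\<forall>c\<in>A. \<forall>x\<in>chart_image c. \<forall>vs. \<omega> c x vs \<in> \<real>) \<and>
     (\<forall>c\<in>A. \<forall>x\<in>chart_image c. \<forall>v. v \<noteq> 0 \<longrightarrow> Re (\<omega> c x [v, \<i> *s v]) > 0) \<and>
     form_eq A (del \<omega> + delbar \<omega>) 0"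

definition sharp :: "nat \<Rightarrow> ('a, 'n::finite) form \<Rightarrow> ('a, 'n) form \<Rightarrow> ('a, 'n) vform" where
  "sharp p \<omega> \<Gamma> c x = (THE \<psi>. \<psi> \<in> Lambda_Theta p \<and> contract_pt p \<psi> (\<omega> c x) = \<Gamma> c x)"

definition normal_chart_at :: "('a, 'n::finite) chart set \<Rightarrow> ('a, 'n) form \<Rightarrow> 'a \<Rightarrow> ('a, 'n) chart \<Rightarrow> bool" where
  "normal_chart_at A \<omega> P c \<longleftrightarrow> c \<in> A \<and> P \<in> fst c \<and> snd c P = 0 \<and>
     (\<forall>vs. (\<lambda>z. \<omega> c z vs - \<i> / 2 * (\<Sum>i\<in>UNIV. wedges [dz i, dzbar i] vs))
             \<in> O[nhds 0](\<lambda>z. of_real ((norm z)\<^sup>2)))"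

text \<open>The value at a point \<open>P\<close> is given by the local formula in some normal chart at \<open>P\<close>, and
  carried over to the chart \<open>c\<close> by pullback.\<close>

definition bracket ::
  "('a, 'n::finite) chart set \<Rightarrow> ('a, 'n) form \<Rightarrow> ('a, 'n) form \<Rightarrow> ('a, 'n) form \<Rightarrow> ('a, 'n) form" where
  "bracket A \<omega> \<alpha> \<beta> c x vs =
     (let n = (SOME n. normal_chart_at A \<omega> (chart_inv c x) n)
      in bracket_loc (\<alpha> n) (\<beta> n) 0 (map (d_transition c n x) vs))"

end

theory Submission
  imports Defs
begin

text \<open>Both sides are evaluated at one point \<open>P\<close>, in the normal chart \<open>n\<close> through which the bracket at \<open>P\<close> is
  defined. All other terms may be computed there too, because they are natural under holomorphic changes
  of coordinates: contraction is (\<open>contract_pt_pullback\<close>), \<open>\<partial>\<close> is (\<open>del_loc_pullback\<close>: the second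
  derivatives of the transition map enter symmetrically and cancel in the alternating sum), and \<open>#\<close> is
  because \<open>(#\<Gamma>) \<lrcorner> \<omega> = \<Gamma>\<close> determines \<open>#\<Gamma>\<close> by positivity of \<open>\<omega>\<close> (\<open>contract2_inj\<close>).

  In the chart \<open>n\<close> write \<open>\<omega> = \<i>/2 \<Sum> g\<^sub>i\<^sub>j dz\<^sub>i \<and> dzbar\<^sub>j\<close> and \<open>\<theta> = \<Sum> t\<^sub>i\<^sub>j dz\<^sub>i \<otimes> \<partial>/\<partial>z\<^sub>j\<close>. Then \<open>\<theta> \<lrcorner> \<omega> = \<alpha>\<close>
  says \<open>a = t g\<close> for the matrix \<open>a\<close> of \<open>\<alpha>\<close>, and as \<open>g\<close> is the identity up to second order, \<open>t\<close> and \<open>a\<close>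
  have the same value and the same first derivatives at the origin. So all terms are expressions in the
  first-order jets of the matrices \<open>a\<close> and \<open>b\<close> of \<open>\<alpha>\<close> and \<open>\<beta>\<close>. The product rule splits \<open>\<partial>(\<theta> \<lrcorner> \<beta>)\<close> into
  the terms \<open>(\<partial>\<^sub>k a\<^sub>i\<^sub>j) b\<^sub>j\<^sub>l\<close>, which make up \<open>(#\<partial>\<alpha>) \<lrcorner> \<beta>\<close>, and \<open>a\<^sub>i\<^sub>j \<partial>\<^sub>k b\<^sub>j\<^sub>l\<close>; the contraction
  \<open>\<theta> \<lrcorner> \<partial>\<beta>\<close> has the coefficients \<open>a\<^sub>i\<^sub>j (\<partial>\<^sub>j b\<^sub>k\<^sub>l - \<partial>\<^sub>k b\<^sub>j\<^sub>l)\<close> at \<open>dz\<^sub>i \<and> dz\<^sub>k \<and> dzbar\<^sub>l\<close>, so its first part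
  is half of the bracket and its second part is the remaining half of \<open>\<partial>(\<theta> \<lrcorner> \<beta>)\<close> because
  \<open>dz\<^sub>i \<and> dz\<^sub>k = - dz\<^sub>k \<and> dz\<^sub>i\<close> (\<open>coefficient_identity\<close>).

  The bracket is defined by choosing some normal chart, so one has to exist
  (\<open>normal_chart_exists\<close>). Positivity of \<open>\<omega>\<close> gives a unitary frame \<open>L\<close> at \<open>P\<close>
  by the Gram-Schmidt process, and closedness makes \<open>\<partial>\<^sub>k h\<^sub>i\<^sub>j\<close> symmetric in \<open>i\<close> and \<open>k\<close>, for the matrix
  \<open>h\<close> of \<open>\<omega>\<close> in any chart. This symmetry is what is needed for a map \<open>z \<mapsto> L z + T(z, z)/2\<close> to absorb the
  first derivatives of \<open>h\<close>. The inverse function theorem inverts it locally, its inverse is smooth by Cramer's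
  rule and a bootstrap in the order of differentiability, and maximality of the atlas turns it into a chart.\<close>

section \<open>Forms of low degree in coordinates\<close>

text \<open>The sums \<open>sesq\<close>, \<open>bilin\<close> and \<open>tri21\<close> are the multilinear forms of which forms of
  type \<open>(1,1)\<close>, \<open>(2,0)\<close> and \<open>(2,1)\<close> are the alternations. Their linearity or antilinearity in each
  argument is what separates types later on.\<close>

definition sesq :: "('n::finite \<Rightarrow> 'n \<Rightarrow> complex) \<Rightarrow> complex ^ 'n \<Rightarrow> complex ^ 'n \<Rightarrow> complex" where
  "sesq h v w = (\<Sum>i\<in>UNIV. \<Sum>j\<in>UNIV. h i j * v $ i * cnj (w $ j))"

definition bilin :: "('n::finite \<Rightarrow> 'n \<Rightarrow> complex) \<Rightarrow> complex ^ 'n \<Rightarrow> complex ^ 'n \<Rightarrow> complex" where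
  "bilin s v w = (\<Sum>i\<in>UNIV. \<Sum>j\<in>UNIV. s i j * v $ i * w $ j)"

definition tri21 :: "('n::finite \<Rightarrow> 'n \<Rightarrow> 'n \<Rightarrow> complex) \<Rightarrow>
    complex ^ 'n \<Rightarrow> complex ^ 'n \<Rightarrow> complex ^ 'n \<Rightarrow> complex" where
  "tri21 C u v w = (\<Sum>i\<in>UNIV. \<Sum>k\<in>UNIV. \<Sum>l\<in>UNIV. C i k l * u $ i * v $ k * cnj (w $ l))"

text \<open>The forms \<open>\<Sum> t\<^sub>i dz\<^sub>i\<close>, \<open>\<i>/2 \<Sum> h\<^sub>i\<^sub>j dz\<^sub>i \<and> dzbar\<^sub>j\<close>, \<open>\<Sum> s\<^sub>i\<^sub>j dz\<^sub>i \<and> dz\<^sub>j\<close> and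
  \<open>\<i>/2 \<Sum> C\<^sub>i\<^sub>k\<^sub>l dz\<^sub>i \<and> dz\<^sub>k \<and> dzbar\<^sub>l\<close>, by their values: every term of the theorem is one of the last
  kind, and the factor \<open>\<i>/2\<close> is the one in the definition of the bracket. The arrays \<open>s\<close> and
  \<open>C\<close> enter only through their antisymmetric part in the indices of the \<open>dz\<close>.\<close>

definition form10 :: "('n::finite \<Rightarrow> complex) \<Rightarrow> 'n altform" where
  "form10 t vs = (case vs of [v] \<Rightarrow> \<Sum>i\<in>UNIV. t i * v $ i | _ \<Rightarrow> 0)"

definition form11 :: "('n::finite \<Rightarrow> 'n \<Rightarrow> complex) \<Rightarrow> 'n altform" where
  "form11 h vs = (case vs of [v, w] \<Rightarrow> \<i> / 2 * (sesq h v w - sesq h w v) | _ \<Rightarrow> 0)"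

definition form20 :: "('n::finite \<Rightarrow> 'n \<Rightarrow> complex) \<Rightarrow> 'n altform" where
  "form20 s vs = (case vs of [v, w] \<Rightarrow> bilin s v w - bilin s w v | _ \<Rightarrow> 0)"

definition form21 :: "('n::finite \<Rightarrow> 'n \<Rightarrow> 'n \<Rightarrow> complex) \<Rightarrow> 'n altform" where
  "form21 C vs = (case vs of [u, v, w] \<Rightarrow>
     \<i> / 2 * (tri21 C u v w - tri21 C v u w - tri21 C u w v + tri21 C w u v + tri21 C v w u - tri21 C w v u) | _ \<Rightarrow> 0)"

lemma sesq_linear [simp]:
  "sesq h (u + v) w = sesq h u w + sesq h v w" "sesq h (c *s v) w = c * sesq h v w"
  "sesq h (r *\<^sub>R v) w = r *\<^sub>R sesq h v w"
  "sesq h w (u + v) = sesq h w u + sesq h w v" "sesq h w (c *s v) = cnj c * sesq h w v"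
  "sesq h w (r *\<^sub>R v) = r *\<^sub>R sesq h w v"
  by (simp_all add: sesq_def algebra_simps sum.distrib sum_distrib_left)
    (simp_all add: scaleR_sum_right scaleR_conv_of_real sum_distrib_left mult_ac)

lemma tri21_linear [simp]:
  "tri21 C (u + u') v w = tri21 C u v w + tri21 C u' v w" "tri21 C (r *\<^sub>R u) v w = r *\<^sub>R tri21 C u v w"
  "tri21 C u (v + v') w = tri21 C u v w + tri21 C u v' w" "tri21 C u (r *\<^sub>R v) w = r *\<^sub>R tri21 C u v w"
  "tri21 C u v (w + w') = tri21 C u v w + tri21 C u v w'" "tri21 C u v (r *\<^sub>R w) = r *\<^sub>R tri21 C u v w"
  "tri21 C (c *s u) v w = c * tri21 C u v w" "tri21 C u (c *s v) w = c * tri21 C u v w"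
  "tri21 C u v (c *s w) = cnj c * tri21 C u v w"
  by (simp_all add: tri21_def algebra_simps sum.distrib sum_distrib_left)
    (simp_all add: scaleR_sum_right scaleR_conv_of_real sum_distrib_left mult_ac)

lemma axis_mult: "axis k (c::complex) = c *s axis k 1"
  by (simp add: vec_eq_iff axis_def)

lemma sesq_axis:
  "sesq h (axis i 1) w = (\<Sum>j\<in>UNIV. h i j * cnj (w $ j))" "sesq h (axis i 1) (axis j 1) = h i j"
proof -
  have "(\<Sum>j\<in>UNIV. h k j * axis i 1 $ k * cnj (w $ j)) = (if k = i then \<Sum>j\<in>UNIV. h i j * cnj (w $ j) else 0)"
    for k w by (cases "k = i") (simp_all add: axis_def)
  then have *: "sesq h (axis i 1) w = (\<Sum>j\<in>UNIV. h i j * cnj (w $ j))" for w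
    by (simp add: sesq_def)
  show "sesq h (axis i 1) w = (\<Sum>j\<in>UNIV. h i j * cnj (w $ j))" by (rule *)
  have "h i k * cnj (axis j 1 $ k) = (if k = j then h i j else 0)" for k
    by (simp add: axis_def)
  then show "sesq h (axis i 1) (axis j 1) = h i j" unfolding * by simp
qed

lemma tri21_axis:
  "tri21 C (axis j 1) v w = sesq (\<lambda>k l. C j k l) v w"
  "tri21 C v (axis j 1) w = sesq (\<lambda>k l. C k j l) v w"
proof -
  have "(\<Sum>k\<in>UNIV. \<Sum>l\<in>UNIV. C i k l * axis j 1 $ i * v $ k * cnj (w $ l))
     = (if i = j then sesq (\<lambda>k l. C j k l) v w else 0)" for i
    by (cases "i = j") (simp_all add: axis_def sesq_def)
  then show "tri21 C (axis j 1) v w = sesq (\<lambda>k l. C j k l) v w" by (simp add: tri21_def)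
  have "(\<Sum>l\<in>UNIV. C i k l * v $ i * axis j 1 $ k * cnj (w $ l))
     = (if k = j then \<Sum>l\<in>UNIV. C i j l * v $ i * cnj (w $ l) else 0)" for i k
    by (cases "k = j") (simp_all add: axis_def)
  then show "tri21 C v (axis j 1) w = sesq (\<lambda>k l. C k j l) v w" by (simp add: tri21_def sesq_def)
qed

text \<open>In the combination \<open>(\<partial>/\<partial>x\<^sub>j - \<i> \<partial>/\<partial>y\<^sub>j)/2\<close> the contributions in which the first vector
  enters antilinearly cancel; only the slot of \<open>dz\<close> remains.\<close>

lemma iota_form11:
  "iota j (form11 h) = (\<lambda>vs. case vs of [w] \<Rightarrow> \<i> / 2 * (\<Sum>l\<in>UNIV. h j l * cnj (w $ l)) | _ \<Rightarrow> 0)"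
  by (rule ext) (simp add: iota_def form11_def axis_mult [of j \<i>] sesq_axis algebra_simps split: list.split)

lemma iota_form21: "iota j (form21 C) = form11 (\<lambda>k l. C j k l - C k j l)"
proof (rule ext)
  fix vs
  have d: "sesq (\<lambda>k l. C j k l - C k j l) v w = sesq (\<lambda>k l. C j k l) v w - sesq (\<lambda>k l. C k j l) v w" for v w
    by (simp add: sesq_def algebra_simps sum_subtractf)
  show "iota j (form21 C) vs = form11 (\<lambda>k l. C j k l - C k j l) vs"
    by (simp add: iota_def form21_def form11_def axis_mult [of j \<i>] tri21_axis d algebra_simps split: list.split)
qed

section \<open>Wedge products in low degree\<close>

lemma permute_list_2: "permute_list \<sigma> [v, w] = [[v, w] ! \<sigma> 0, [v, w] ! \<sigma> 1]"
  by (simp add: permute_list_def upt_rec)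

lemma permute_list_3: "permute_list \<sigma> [u, v, w] = [[u, v, w] ! \<sigma> 0, [u, v, w] ! \<sigma> 1, [u, v, w] ! \<sigma> 2]"
  by (simp add: permute_list_def upt_rec numeral_2_eq_2)

lemma lessThan_2: "{..<2::nat} = {0, 1}" by auto
lemma lessThan_3: "{..<3::nat} = {0, 1, 2}" by auto

lemma wedge_1: "wedge p \<xi> \<eta> [v] = \<xi> (take p [v]) * \<eta> (drop p [v]) / (fact p * fact (1 - p))"
  by (simp add: wedge_def lessThan_Suc permutes_sing permute_list_def sign_id)

lemma wedge_2: "wedge p \<xi> \<eta> [v, w] =
   (\<xi> (take p [v, w]) * \<eta> (drop p [v, w]) - \<xi> (take p [w, v]) * \<eta> (drop p [w, v])) / (fact p * fact (2 - p))"
proof -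
  have f: "finite {1::nat}" "0 \<notin> {1::nat}" by auto
  have l: "length [v, w] = 2" by simp
  show ?thesis
    unfolding wedge_def l lessThan_2 sum_over_permutations_insert [OF f] permutes_sing permute_list_2
    by (simp add: sign_swap_id sign_id transpose_def)
qed

lemma wedge_3: "wedge p \<xi> \<eta> [u, v, w] =
   (\<xi> (take p [u, v, w]) * \<eta> (drop p [u, v, w]) - \<xi> (take p [u, w, v]) * \<eta> (drop p [u, w, v])
    - \<xi> (take p [v, u, w]) * \<eta> (drop p [v, u, w]) + \<xi> (take p [v, w, u]) * \<eta> (drop p [v, w, u])
    + \<xi> (take p [w, u, v]) * \<eta> (drop p [w, u, v]) - \<xi> (take p [w, v, u]) * \<eta> (drop p [w, v, u]))
    / (fact p * fact (3 - p))"
proof -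
  have f: "finite {1::nat, 2}" "0 \<notin> {1::nat, 2}" "finite {2::nat}" "1 \<notin> {2::nat}" by auto
  have l: "length [u, v, w] = 3" by simp
  show ?thesis
    unfolding wedge_def l lessThan_3 sum_over_permutations_insert [OF f(1,2)]
      sum_over_permutations_insert [OF f(3,4)] permutes_sing permute_list_3
    by (simp add: sign_swap_id sign_id sign_compose permutation_swap_id transpose_def)
qed

text \<open>Reduces an identity between wedge products to lists of the one relevant length, where the
  sum over permutations is written out below.\<close>

lemma wedge_eq_0:
  assumes "\<And>ws. length ws \<noteq> p \<Longrightarrow> \<xi> ws = 0" "\<And>ws. length ws \<noteq> q \<Longrightarrow> \<eta> ws = 0" "length vs \<noteq> p + q"
  shows "wedge p \<xi> \<eta> vs = 0"
proof -
  have "of_int (sign \<sigma>) * \<xi> (take p (permute_list \<sigma> vs)) * \<eta> (drop p (permute_list \<sigma> vs)) = 0" for \<sigma>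
  proof (cases "length vs < p")
    case True
    then show ?thesis using assms(1) [of "take p (permute_list \<sigma> vs)"] by simp
  next
    case False
    then show ?thesis using assms(2) [of "drop p (permute_list \<sigma> vs)"] assms(3) by simp
  qed
  then show ?thesis unfolding wedge_def by (subst sum.neutral) auto
qed

lemma form_eq_0_length:
  "length ws \<noteq> 1 \<Longrightarrow> form10 t ws = 0" "length ws \<noteq> 2 \<Longrightarrow> form11 h ws = 0"
  "length ws \<noteq> 2 \<Longrightarrow> form20 s ws = 0" "length ws \<noteq> 3 \<Longrightarrow> form21 C ws = 0"
  "length ws \<noteq> 1 \<Longrightarrow> dz k ws = 0" "length ws \<noteq> 1 \<Longrightarrow> dzbar k ws = 0"
  "length ws \<noteq> 1 \<Longrightarrow> iota j (form11 h) ws = 0"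
  by (auto simp: form10_def form11_def form20_def form21_def dz_def dzbar_def iota_form11 split: list.splits)

lemma sesq_tensor: "(\<Sum>i\<in>UNIV. t i * v $ i) * (\<Sum>l\<in>UNIV. g l * cnj (w $ l)) = sesq (\<lambda>i l. t i * g l) v w"
  unfolding sesq_def sum_product by (intro sum.cong refl) (simp add: mult_ac)

lemma wedge_form10_iota11: "wedge 1 (form10 t) (iota j (form11 h)) = form11 (\<lambda>i l. t i * h j l)"
proof (rule ext)
  fix vs
  show "wedge 1 (form10 t) (iota j (form11 h)) vs = form11 (\<lambda>i l. t i * h j l) vs"
  proof (cases "length vs = 2")
    case True
    then obtain v w where [simp]: "vs = [v, w]" by (auto simp: numeral_2_eq_2 length_Suc_conv)
    show ?thesis
      by (simp add: wedge_2 iota_form11 form10_def form11_def algebra_simps flip: sesq_tensor)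
  next
    case False
    then have "wedge 1 (form10 t) (iota j (form11 h)) vs = 0"
      by (intro wedge_eq_0 [where q = 1] form_eq_0_length) auto
    with False show ?thesis by (simp add: form_eq_0_length)
  qed
qed

lemma tri21_tensor_sesq: "(\<Sum>i\<in>UNIV. t i * u $ i) * sesq h v w = tri21 (\<lambda>i k l. t i * h k l) u v w"
proof -
  have "t i * u $ i * sesq h v w = (\<Sum>k\<in>UNIV. \<Sum>l\<in>UNIV. t i * h k l * u $ i * v $ k * cnj (w $ l))" for i
    by (simp add: sesq_def sum_distrib_left mult_ac)
  then show ?thesis by (simp add: sum_distrib_right tri21_def)
qed

lemma wedge_form10_form11: "wedge 1 (form10 t) (form11 h) = form21 (\<lambda>i k l. t i * h k l)"
proof (rule ext)
  fix vs
  show "wedge 1 (form10 t) (form11 h) vs = form21 (\<lambda>i k l. t i * h k l) vs"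
  proof (cases "length vs = 3")
    case True
    then obtain u v w where [simp]: "vs = [u, v, w]" by (auto simp: numeral_3_eq_3 length_Suc_conv)
    show ?thesis
      by (simp add: wedge_3 form10_def form11_def form21_def field_simps flip: tri21_tensor_sesq)
  next
    case False
    then have "wedge 1 (form10 t) (form11 h) vs = 0"
      by (intro wedge_eq_0 [where q = 2] form_eq_0_length) auto
    with False show ?thesis by (simp add: form_eq_0_length)
  qed
qed


lemma tri21_tensor_bilin:
  "bilin s u v * (\<Sum>l\<in>UNIV. g l * cnj (w $ l)) = tri21 (\<lambda>k i l. s k i * g l) u v w"
proof -
  have "s k i * u $ k * v $ i * (\<Sum>l\<in>UNIV. g l * cnj (w $ l))
     = (\<Sum>l\<in>UNIV. s k i * g l * u $ k * v $ i * cnj (w $ l))" for k i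
    by (simp add: sum_distrib_left mult_ac)
  then show ?thesis by (simp add: sum_distrib_right tri21_def bilin_def)
qed

lemma wedge_form20_iota11: "wedge 2 (form20 s) (iota j (form11 h)) = form21 (\<lambda>k i l. s k i * h j l)"
proof (rule ext)
  fix vs
  show "wedge 2 (form20 s) (iota j (form11 h)) vs = form21 (\<lambda>k i l. s k i * h j l) vs"
  proof (cases "length vs = 3")
    case True
    then obtain u v w where [simp]: "vs = [u, v, w]" by (auto simp: numeral_3_eq_3 length_Suc_conv)
    show ?thesis
      by (simp add: wedge_3 numeral_2_eq_2)
        (simp add: form20_def iota_form11 form21_def flip: tri21_tensor_bilin, simp add: field_simps)
  next
    case False
    then have "wedge 2 (form20 s) (iota j (form11 h)) vs = 0"
      by (intro wedge_eq_0 [where q = 1] form_eq_0_length) auto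
    with False show ?thesis by (simp add: form_eq_0_length)
  qed
qed

lemma form11_sum: "(\<Sum>m\<in>S. form11 (h m) vs) = form11 (\<lambda>i j. \<Sum>m\<in>S. h m i j) vs"
proof -
  have "sesq (\<lambda>i j. \<Sum>m\<in>S. h m i j) v w = (\<Sum>m\<in>S. sesq (h m) v w)" for v w
    unfolding sesq_def sum_distrib_right by (simp add: sum.swap [where A = S])
  then show ?thesis
    by (auto simp: form11_def sum_distrib_left sum_subtractf algebra_simps split: list.split)
qed

lemma form11_add: "form11 g vs + form11 h vs = form11 (\<lambda>i j. g i j + h i j) vs"
  by (auto simp: form11_def sesq_def algebra_simps sum.distrib split: list.split)

lemma tri21_sum: "tri21 (\<lambda>i k l. \<Sum>m\<in>S. C m i k l) u v w = (\<Sum>m\<in>S. tri21 (C m) u v w)"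
  unfolding tri21_def sum_distrib_right by (simp add: sum.swap [where A = S])

lemma form21_sum: "(\<Sum>m\<in>S. form21 (C m) vs) = form21 (\<lambda>i k l. \<Sum>m\<in>S. C m i k l) vs"
  by (auto simp: form21_def tri21_sum sum_distrib_left sum_subtractf sum.distrib algebra_simps split: list.split)

lemma form21_add: "form21 C vs + form21 C' vs = form21 (\<lambda>i k l. C i k l + C' i k l) vs"
  using form21_sum [of "\<lambda>b. if b then C else C'" vs "UNIV::bool set"] by (simp add: UNIV_bool add.commute)

text \<open>Antisymmetry of \<open>dz\<^sub>i \<and> dz\<^sub>k\<close>: the one relation that makes the final identity
  more than an identity of arrays.\<close>

lemma form21_swap: "form21 (\<lambda>i k l. C k i l) vs = - form21 C vs"
proof -
  have "tri21 (\<lambda>i k l. C k i l) u v w = tri21 C v u w" for u v w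
    unfolding tri21_def by (subst sum.swap) (simp add: mult_ac)
  then show ?thesis by (auto simp: form21_def algebra_simps split: list.split)
qed

text \<open>Contracting with \<open>\<theta>\<close> multiplies coefficient matrices; in particular \<open>\<theta> \<lrcorner> \<omega> = \<alpha>\<close> becomes
  the matrix equation \<open>t g = a\<close>.\<close>

lemma contract_form11:
  assumes "\<And>j vs. \<theta> vs $ j = form10 (\<lambda>i. t i j) vs"
  shows "contract_pt 1 \<theta> (form11 h) = form11 (\<lambda>i l. \<Sum>j\<in>UNIV. t i j * h j l)"
proof
  fix vs
  have "(\<lambda>ws. \<theta> ws $ j) = form10 (\<lambda>i. t i j)" for j using assms by auto
  then show "contract_pt 1 \<theta> (form11 h) vs = form11 (\<lambda>i l. \<Sum>j\<in>UNIV. t i j * h j l) vs"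
    by (simp only: contract_pt_def wedge_form10_iota11 form11_sum)
qed

lemma contract_form21:
  assumes "\<And>j vs. \<theta> vs $ j = form10 (\<lambda>i. t i j) vs"
  shows "contract_pt 1 \<theta> (form21 C) = form21 (\<lambda>i k l. \<Sum>j\<in>UNIV. t i j * (C j k l - C k j l))"
proof
  fix vs
  have "(\<lambda>ws. \<theta> ws $ j) = form10 (\<lambda>i. t i j)" for j using assms by auto
  then show "contract_pt 1 \<theta> (form21 C) vs = form21 (\<lambda>i k l. \<Sum>j\<in>UNIV. t i j * (C j k l - C k j l)) vs"
    by (simp only: contract_pt_def iota_form21 wedge_form10_form11 form21_sum)
qed

lemma contract2_form11:
  assumes "\<And>j vs. \<psi> vs $ j = form20 (\<lambda>k i. s k i j) vs"
  shows "contract_pt 2 \<psi> (form11 h) = form21 (\<lambda>k i l. \<Sum>j\<in>UNIV. s k i j * h j l)"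
proof
  fix vs
  have "(\<lambda>ws. \<psi> ws $ j) = form20 (\<lambda>k i. s k i j)" for j using assms by auto
  then show "contract_pt 2 \<psi> (form11 h) vs = form21 (\<lambda>k i l. \<Sum>j\<in>UNIV. s k i j * h j l) vs"
    by (simp only: contract_pt_def wedge_form20_iota11 form21_sum)
qed

section \<open>Monomials and the spaces of forms of type \<open>(p, q)\<close>\<close>

lemma wedge1_one_form0:
  assumes "\<And>ws. length ws \<noteq> 1 \<Longrightarrow> \<xi> ws = 0"
  shows "wedge 1 \<xi> one_form0 = \<xi>"
proof
  fix vs
  show "wedge 1 \<xi> one_form0 vs = \<xi> vs"
  proof (cases "length vs = 1")
    case True
    then obtain v where "vs = [v]" by (auto simp: length_Suc_conv)
    then show ?thesis by (simp add: wedge_1 one_form0_def)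
  next
    case False
    then have "wedge 1 \<xi> one_form0 vs = 0"
      by (intro wedge_eq_0 [where q = 0] assms) (auto simp: one_form0_def)
    with False assms show ?thesis by simp
  qed
qed

lemma wedge_degree_1_1:
  assumes "\<And>ws. length ws \<noteq> 1 \<Longrightarrow> \<xi> ws = 0" "\<And>ws. length ws \<noteq> 1 \<Longrightarrow> \<eta> ws = 0"
  shows "wedge 1 \<xi> \<eta> vs = (case vs of [v, w] \<Rightarrow> \<xi> [v] * \<eta> [w] - \<xi> [w] * \<eta> [v] | _ \<Rightarrow> 0)"
proof (cases "length vs = 2")
  case True
  then obtain v w where "vs = [v, w]" by (auto simp: numeral_2_eq_2 length_Suc_conv)
  then show ?thesis by (simp add: wedge_2)
next
  case False
  then have "wedge 1 \<xi> \<eta> vs = 0"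
    by (intro wedge_eq_0 [where q = 1] assms) auto
  with False show ?thesis by (auto split: list.split)
qed

lemma wedge_degree_1_2:
  assumes "\<And>ws. length ws \<noteq> 1 \<Longrightarrow> \<xi> ws = 0" "\<And>ws. length ws \<noteq> 2 \<Longrightarrow> \<eta> ws = 0"
    and "\<And>v w. \<eta> [w, v] = - \<eta> [v, w]"
  shows "wedge 1 \<xi> \<eta> vs = (case vs of [u, v, w] \<Rightarrow>
    \<xi> [u] * \<eta> [v, w] - \<xi> [v] * \<eta> [u, w] + \<xi> [w] * \<eta> [u, v] | _ \<Rightarrow> 0)"
proof (cases "length vs = 3")
  case True
  then obtain u v w where "vs = [u, v, w]" by (auto simp: numeral_3_eq_3 length_Suc_conv)
  then show ?thesis
    by (simp add: wedge_3 assms(3) [of w v] assms(3) [of w u] assms(3) [of v u] field_simps)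
next
  case False
  then have "wedge 1 \<xi> \<eta> vs = 0"
    by (intro wedge_eq_0 [where q = 2] assms) auto
  with False show ?thesis by (auto split: list.split)
qed

lemma wedges_dz_dzbar: "wedges [dz i, dzbar j] vs =
    (case vs of [v, w] \<Rightarrow> v $ i * cnj (w $ j) - w $ i * cnj (v $ j) | _ \<Rightarrow> 0)"
proof -
  have 1: "wedge 1 (dzbar j) one_form0 = dzbar j" by (intro wedge1_one_form0 form_eq_0_length)
  have "wedges [dz i, dzbar j] = wedge 1 (dz i) (dzbar j)" by (simp only: wedges_def foldr.simps 1 o_def id_def)
  then show ?thesis by (simp only: wedge_degree_1_1 form_eq_0_length simp_thms) (simp add: dz_def dzbar_def split: list.split)
qed

lemma wedges_dz_dz: "wedges [dz i, dz j] vs =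
    (case vs of [v, w] \<Rightarrow> v $ i * w $ j - w $ i * v $ j | _ \<Rightarrow> 0)"
proof -
  have 1: "wedge 1 (dz j) one_form0 = dz j" by (intro wedge1_one_form0 form_eq_0_length)
  have "wedges [dz i, dz j] = wedge 1 (dz i) (dz j)" by (simp only: wedges_def foldr.simps 1 o_def id_def)
  then show ?thesis by (simp only: wedge_degree_1_1 form_eq_0_length simp_thms) (simp add: dz_def split: list.split)
qed

lemma wedges_dz: "wedges [dz i] vs = dz i vs"
proof -
  have 1: "wedge 1 (dz i) one_form0 = dz i" by (intro wedge1_one_form0 form_eq_0_length)
  show ?thesis by (simp only: wedges_def foldr.simps 1 o_def id_def)
qed

lemma wedges_dzbar_dz_dz: "wedges [dzbar l, dz i, dz k] vs =
    (case vs of [u, v, w] \<Rightarrow> cnj (u $ l) * (v $ i * w $ k - w $ i * v $ k)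
       - cnj (v $ l) * (u $ i * w $ k - w $ i * u $ k)
       + cnj (w $ l) * (u $ i * v $ k - v $ i * u $ k) | _ \<Rightarrow> 0)"
proof -
  have 1: "wedges [dzbar l, dz i, dz k] = wedge 1 (dzbar l) (wedges [dz i, dz k])"
    by (simp only: wedges_def foldr.simps o_def id_def)
  show ?thesis unfolding 1
    by (subst wedge_degree_1_2) (auto simp: dzbar_def wedges_dz_dz split: list.split)
qed

text \<open>The link between the explicit values and the monomials used to define \<open>Lambda\<close>, the
  coefficient matrix and the bracket.\<close>

lemma form11_wedges: "form11 h vs = \<i> / 2 * (\<Sum>i\<in>UNIV. \<Sum>j\<in>UNIV. h i j * wedges [dz i, dzbar j] vs)"
  by (auto simp: form11_def wedges_dz_dzbar sesq_def sum_subtractf algebra_simps split: list.split)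

lemma form20_wedges: "form20 s vs = (\<Sum>i\<in>UNIV. \<Sum>j\<in>UNIV. s i j * wedges [dz i, dz j] vs)"
  by (auto simp: form20_def wedges_dz_dz bilin_def sum_subtractf algebra_simps split: list.split)

lemma form21_wedges: "form21 C vs =
    \<i> / 2 * (\<Sum>i\<in>UNIV. \<Sum>k\<in>UNIV. \<Sum>l\<in>UNIV. C i k l * wedges [dzbar l, dz i, dz k] vs)"
  by (auto simp: form21_def wedges_dzbar_dz_dz tri21_def sum_subtractf sum.distrib algebra_simps split: list.split)

lemma sum_length_1: "(\<Sum>I | length I = 1. f I) = (\<Sum>i\<in>UNIV. f [i])"
  by (rule sum.reindex_bij_witness [of _ "\<lambda>i. [i]" hd]) (auto simp: length_Suc_conv)

lemma sum_length_2: "(\<Sum>I | length I = 2. f I) = (\<Sum>i\<in>UNIV. \<Sum>j\<in>UNIV. f [i, j])"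
  unfolding sum.cartesian_product
  by (rule sum.reindex_bij_witness [of _ "\<lambda>(i, j). [i, j]" "\<lambda>I. (I ! 0, I ! 1)"])
     (auto simp: length_Suc_conv numeral_2_eq_2)

lemma Lambda_1_1: "\<eta> \<in> Lambda 1 1 \<longleftrightarrow> (\<exists>h. \<eta> = form11 h)"
proof
  assume "\<eta> \<in> Lambda 1 1"
  then obtain a where a: "\<eta> = (\<lambda>vs. \<Sum>i\<in>UNIV. \<Sum>j\<in>UNIV. a [i] [j] * wedges [dz i, dzbar j] vs)"
    by (auto simp: Lambda_def sum_length_1 simp del: One_nat_def)
  have "\<eta> = form11 (\<lambda>i j. 2 / \<i> * a [i] [j])"
    unfolding a form11_wedges by (simp add: sum_distrib_left mult.assoc)
  then show "\<exists>h. \<eta> = form11 h" by blast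
next
  assume "\<exists>h. \<eta> = form11 h"
  then obtain h where h: "\<eta> = form11 h" by blast
  have "\<eta> = (\<lambda>vs. \<Sum>I | length I = 1. \<Sum>J | length J = 1. \<i> / 2 * h (hd I) (hd J) * wedges (map dz I @ map dzbar J) vs)"
    unfolding h sum_length_1 by (auto simp: form11_wedges sum_distrib_left mult.assoc)
  then show "\<eta> \<in> Lambda 1 1" unfolding Lambda_def
    by (intro CollectI exI [of _ "\<lambda>I J. \<i> / 2 * h (hd I) (hd J)"]) simp
qed

lemma Lambda_1_0: "\<eta> \<in> Lambda 1 0 \<Longrightarrow> \<exists>t. \<eta> = form10 t"
proof -
  assume "\<eta> \<in> Lambda 1 0"
  then obtain a where a: "\<eta> = (\<lambda>vs. \<Sum>i\<in>UNIV. a [i] [] * wedges [dz i] vs)"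
    by (auto simp: Lambda_def sum_length_1 simp del: One_nat_def)
  have "\<eta> = form10 (\<lambda>i. a [i] [])"
    unfolding a by (auto simp: wedges_dz form10_def dz_def split: list.split)
  then show "\<exists>t. \<eta> = form10 t" by blast
qed

lemma Lambda_2_0: "\<eta> \<in> Lambda 2 0 \<longleftrightarrow> (\<exists>s. \<eta> = form20 s)"
proof
  assume "\<eta> \<in> Lambda 2 0"
  then obtain a where a: "\<eta> = (\<lambda>vs. \<Sum>i\<in>UNIV. \<Sum>j\<in>UNIV. a [i, j] [] * wedges [dz i, dz j] vs)"
    by (auto simp: Lambda_def sum_length_2)
  have "\<eta> = form20 (\<lambda>i j. a [i, j] [])"
    unfolding a form20_wedges by simp
  then show "\<exists>h. \<eta> = form20 h" by blast
next
  assume "\<exists>h. \<eta> = form20 h"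
  then obtain h where h: "\<eta> = form20 h" by blast
  have "\<eta> = (\<lambda>vs. \<Sum>I | length I = 2. \<Sum>J | length J = 0. h (hd I) (last I) * wedges (map dz I @ map dzbar J) vs)"
    unfolding h sum_length_2 by (auto simp: form20_wedges)
  then show "\<eta> \<in> Lambda 2 0" unfolding Lambda_def
    by (intro CollectI exI [of _ "\<lambda>I J. h (hd I) (last I)"]) simp
qed

section \<open>Coefficients and Wirtinger derivatives\<close>

text \<open>An explicit formula for the coefficient matrix: linear in \<open>\<eta>\<close>, so that smoothness and
  derivatives of the coefficients follow from those of the form. The combination with \<open>\<i>\<close> projects to the part
  that is linear in the first vector.\<close>

definition coeffs11 :: "'n::finite altform \<Rightarrow> 'n \<Rightarrow> 'n \<Rightarrow> complex" where
  "coeffs11 \<eta> i j = - \<i> * (\<eta> [axis i 1, axis j 1] - \<i> * \<eta> [axis i \<i>, axis j 1])"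

lemma coeffs11_form11 [simp]: "coeffs11 (form11 h) = h"
  by (intro ext) (simp add: coeffs11_def form11_def axis_mult [of _ \<i>] sesq_axis(2) algebra_simps)

lemma form10_axis: "form10 t [axis i 1] = t i"
proof -
  have "t k * axis i 1 $ k = (if k = i then t i else 0)" for k by (simp add: axis_def)
  then show ?thesis by (simp add: form10_def)
qed

lemma form11_inject: "form11 g = form11 h \<Longrightarrow> g = h"
  by (drule arg_cong [where f = coeffs11]) simp

lemma coeff11_form11: "coeff11 (form11 h) = h"
  unfolding coeff11_def form11_wedges [symmetric]
proof (rule the_equality)
  fix a assume "form11 h = (\<lambda>vs. form11 a vs)"
  then show "a = h" by (metis coeffs11_form11)
qed simp

lemma frechet_derivative_cong:
  assumes "open S" "x \<in> S" "\<And>y. y \<in> S \<Longrightarrow> f y = g y"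
  shows "frechet_derivative f (at x) = frechet_derivative g (at x)"
proof -
  have "(f has_derivative f') (at x) \<longleftrightarrow> (g has_derivative f') (at x)" for f'
    using assms has_derivative_transform_within_open [of f f' x UNIV S g]
      has_derivative_transform_within_open [of g f' x UNIV S f] by auto
  then show ?thesis by (simp add: frechet_derivative_def)
qed

lemma d_dz_cong:
  assumes "open S" "x \<in> S" "\<And>y. y \<in> S \<Longrightarrow> f y = g y"
  shows "d_dz k f x = d_dz k g x"
  using frechet_derivative_cong [of S x f g] assms by (simp add: d_dz_def)

lemma d_dz_eq: "(f has_derivative f') (at x) \<Longrightarrow> d_dz k f x = (f' (axis k 1) - \<i> * f' (axis k \<i>)) / 2"
  by (simp add: d_dz_def frechet_derivative_at [symmetric])

lemma d_dzbar_eq: "(f has_derivative f') (at x) \<Longrightarrow> d_dzbar k f x = (f' (axis k 1) + \<i> * f' (axis k \<i>)) / 2"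
  by (simp add: d_dzbar_def frechet_derivative_at [symmetric])

lemma vec_axis_expansion:
  fixes u :: "complex ^ 'n::finite"
  shows "u = (\<Sum>k\<in>UNIV. Re (u $ k) *\<^sub>R axis k 1 + Im (u $ k) *\<^sub>R axis k \<i>)"
proof -
  have "(Re (u $ k) *\<^sub>R axis k 1 + Im (u $ k) *\<^sub>R axis k \<i>) $ i = (if k = i then u $ k else 0)" for i k
    by (simp add: axis_def complex_eq_iff)
  then show ?thesis by (simp add: vec_eq_iff del: vector_add_component)
qed

lemma real_linear_axis:
  fixes g :: "complex ^ 'n::finite \<Rightarrow> complex"
  assumes "linear g"
  shows "g u = (\<Sum>k\<in>UNIV. of_real (Re (u $ k)) * g (axis k 1) + of_real (Im (u $ k)) * g (axis k \<i>))"
  by (subst vec_axis_expansion [of u])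
     (simp add: linear_sum [OF assms] linear_add [OF assms] linear_scale [OF assms], simp add: scaleR_conv_of_real)

lemma d_dz_mult:
  assumes "f differentiable (at x)" "g differentiable (at x)"
  shows "d_dz k (\<lambda>y. f y * g y) x = d_dz k f x * g x + f x * d_dz k g x"
proof -
  have f: "(f has_derivative frechet_derivative f (at x)) (at x)"
    and g: "(g has_derivative frechet_derivative g (at x)) (at x)"
    using assms by (simp_all add: frechet_derivative_works)
  show ?thesis
    unfolding d_dz_eq [OF has_derivative_mult [OF f g]] d_dz_eq [OF f] d_dz_eq [OF g] by (simp add: field_simps)
qed

lemma d_dz_add:
  assumes "f differentiable (at x)" "g differentiable (at x)"
  shows "d_dz k (\<lambda>y. f y + g y) x = d_dz k f x + d_dz k g x"
proof -
  have f: "(f has_derivative frechet_derivative f (at x)) (at x)"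
    and g: "(g has_derivative frechet_derivative g (at x)) (at x)"
    using assms by (simp_all add: frechet_derivative_works)
  show ?thesis
    unfolding d_dz_eq [OF has_derivative_add [OF f g]] d_dz_eq [OF f] d_dz_eq [OF g] by (simp add: field_simps)
qed

lemma d_dz_sum:
  assumes "\<And>j. j \<in> J \<Longrightarrow> f j differentiable (at x)"
  shows "d_dz k (\<lambda>y. \<Sum>j\<in>J. f j y) x = (\<Sum>j\<in>J. d_dz k (f j) x)"
proof -
  have S: "((\<lambda>y. \<Sum>j\<in>J. f j y) has_derivative (\<lambda>u. \<Sum>j\<in>J. frechet_derivative (f j) (at x) u)) (at x)"
    by (rule has_derivative_sum) (use assms in \<open>simp add: frechet_derivative_works\<close>)
  show ?thesis
    unfolding d_dz_eq [OF S] unfolding d_dz_def by (simp add: sum_subtractf sum_divide_distrib [symmetric] sum_distrib_left)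
qed

text \<open>A real linear function is the sum of a complex linear and an antilinear one; the two
  parts are recovered from the Wirtinger coefficients.\<close>

lemma real_linear_holo_part:
  fixes g :: "complex ^ 'n::finite \<Rightarrow> complex"
  assumes "linear g"
  shows "(\<Sum>k\<in>UNIV. u $ k * ((g (axis k 1) - \<i> * g (axis k \<i>)) / 2)) = (g u - \<i> * g (\<i> *s u)) / 2"
  unfolding real_linear_axis [OF assms, of u] real_linear_axis [OF assms, of "\<i> *s u"]
    sum_distrib_left sum_subtractf [symmetric] sum_divide_distrib
  by (intro sum.cong refl) (subst complex_eq [of "u $ _"], simp add: algebra_simps)

lemma real_linear_antiholo_part:
  fixes g :: "complex ^ 'n::finite \<Rightarrow> complex"
  assumes "linear g"
  shows "(\<Sum>k\<in>UNIV. cnj (u $ k) * ((g (axis k 1) + \<i> * g (axis k \<i>)) / 2)) = (g u + \<i> * g (\<i> *s u)) / 2"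
  unfolding real_linear_axis [OF assms, of u] real_linear_axis [OF assms, of "\<i> *s u"]
    sum_distrib_left sum.distrib [symmetric] sum_divide_distrib
  by (intro sum.cong refl) (subst complex_eq [of "u $ _"], simp add: algebra_simps)

lemma sum_d_dz:
  fixes g :: "complex ^ 'n::finite \<Rightarrow> complex"
  assumes "(f has_derivative g) (at x)"
  shows "(\<Sum>k\<in>UNIV. u $ k * d_dz k f x) = (g u - \<i> * g (\<i> *s u)) / 2"
  unfolding d_dz_eq [OF assms] by (rule real_linear_holo_part [OF has_derivative_linear [OF assms]])

lemma sum_d_dzbar:
  fixes g :: "complex ^ 'n::finite \<Rightarrow> complex"
  assumes "(f has_derivative g) (at x)"
  shows "(\<Sum>k\<in>UNIV. cnj (u $ k) * d_dzbar k f x) = (g u + \<i> * g (\<i> *s u)) / 2"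
  unfolding d_dzbar_eq [OF assms] by (rule real_linear_antiholo_part [OF has_derivative_linear [OF assms]])

lemma form11_has_derivative:
  assumes "\<And>i j. ((\<lambda>y. h y i j) has_derivative h' i j) (at x)"
  shows "((\<lambda>y. form11 (h y) vs) has_derivative (\<lambda>u. form11 (\<lambda>i j. h' i j u) vs)) (at x)"
proof -
  have "((\<lambda>y. sesq (h y) v w) has_derivative (\<lambda>u. sesq (\<lambda>i j. h' i j u) v w)) (at x)" for v w
    unfolding sesq_def by (intro has_derivative_sum has_derivative_mult_left assms)
  note * = has_derivative_mult_right [OF has_derivative_diff [OF this this]]
  show ?thesis
  proof (cases "\<exists>v w. vs = [v, w]")
    case True
    then obtain v w where vs: "vs = [v, w]" by blast
    show ?thesis unfolding vs form11_def list.case by (rule *)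
  next
    case False
    then have "form11 g vs = 0" for g
      by (auto simp: form11_def split: list.split)
    then show ?thesis by simp
  qed
qed

lemma form11_linear:
  "c * (form11 g vs - \<i> * form11 h vs) = form11 (\<lambda>i j. c * (g i j - \<i> * h i j)) vs"
  by (auto simp: form11_def sesq_def algebra_simps sum_subtractf sum_distrib_left split: list.split)

lemma dz_form10: "dz (k::'n::finite) = form10 (\<lambda>i. if i = k then 1 else 0)"
proof -
  have "(if i = k then 1 else 0) * (v::(complex,'n) vec) $ i = (if i = k then v $ k else 0)" for i v by auto
  then show ?thesis by (auto simp: fun_eq_iff dz_def form10_def split: list.split)
qed

lemma d_dz_form11:
  assumes "\<And>i j. (\<lambda>y. h y i j) differentiable (at x)"
  shows "d_dz k (\<lambda>y. form11 (h y) ws) x = form11 (\<lambda>i j. d_dz k (\<lambda>y. h y i j) x) ws"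
  using form11_linear [of "1/2"]
  by (subst d_dz_eq [OF form11_has_derivative])
     (use assms in \<open>auto simp: d_dz_def frechet_derivative_works\<close>)

text \<open>With this formula \<open>\<partial>\<close> acts on coefficients only: \<open>\<partial>(\<i>/2 \<Sum> h\<^sub>i\<^sub>j dz\<^sub>i \<and> dzbar\<^sub>j)\<close> has the array
  \<open>\<partial>\<^sub>k h\<^sub>i\<^sub>j\<close>.\<close>

lemma del_loc_form11:
  assumes "open S" "x \<in> S" "\<And>y. y \<in> S \<Longrightarrow> \<eta> y = form11 (h y)" "\<And>i j. (\<lambda>y. h y i j) differentiable (at x)"
  shows "del_loc \<eta> x = form21 (\<lambda>k i j. d_dz k (\<lambda>y. h y i j) x)"
proof
  fix vs
  have "(\<lambda>ws. d_dz k (\<lambda>y. \<eta> y ws) x) = form11 (\<lambda>i j. d_dz k (\<lambda>y. h y i j) x)" for k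
    by (rule ext, subst d_dz_form11 [symmetric], rule assms, rule d_dz_cong [OF assms(1,2)]) (simp add: assms(3))
  moreover have "(\<Sum>k\<in>UNIV. (if i = k then 1 else 0) * d_dz k (\<lambda>y. h y j l) x) = d_dz i (\<lambda>y. h y j l) x" for i j l
    by (simp add: if_distrib [of "\<lambda>x. x * _"] cong: if_cong)
  ultimately show "del_loc \<eta> x vs = form21 (\<lambda>k i j. d_dz k (\<lambda>y. h y i j) x) vs"
    by (simp only: del_loc_def dz_form10 wedge_form10_form11 form21_sum)
qed

lemma bracket_loc_form11:
  assumes "open S" "x \<in> S" "\<And>y. y \<in> S \<Longrightarrow> \<alpha> y = form11 (a y)" "\<And>y. y \<in> S \<Longrightarrow> \<beta> y = form11 (b y)"
  shows "bracket_loc \<alpha> \<beta> x = form21 (\<lambda>i k l. \<Sum>j\<in>UNIV.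
     a x i j * d_dz j (\<lambda>y. b y k l) x + b x i j * d_dz j (\<lambda>y. a y k l) x)"
proof
  fix vs
  have "d_dz j (\<lambda>y. coeff11 (\<alpha> y) k l) x = d_dz j (\<lambda>y. a y k l) x"
    "d_dz j (\<lambda>y. coeff11 (\<beta> y) k l) x = d_dz j (\<lambda>y. b y k l) x" for j k l
    using assms by (auto intro!: d_dz_cong [OF assms(1,2)] simp: coeff11_form11)
  then have "bracket_loc \<alpha> \<beta> x vs = \<i> / 2 * (\<Sum>i\<in>UNIV. \<Sum>j\<in>UNIV. \<Sum>k\<in>UNIV. \<Sum>l\<in>UNIV.
        (a x i j * d_dz j (\<lambda>y. b y k l) x + b x i j * d_dz j (\<lambda>y. a y k l) x) * wedges [dzbar l, dz i, dz k] vs)"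
    by (simp only: bracket_loc_def Let_def assms coeff11_form11)
  also have "\<dots> = form21 (\<lambda>i k l. \<Sum>j\<in>UNIV.
     a x i j * d_dz j (\<lambda>y. b y k l) x + b x i j * d_dz j (\<lambda>y. a y k l) x) vs"
    unfolding form21_wedges sum_distrib_right
    by (rule arg_cong [where f = "\<lambda>x. \<i> / 2 * x"], rule sum.cong [OF refl],
        subst sum.swap, rule sum.cong [OF refl], rule sum.swap)
  finally show "bracket_loc \<alpha> \<beta> x vs = form21 (\<lambda>i k l. \<Sum>j\<in>UNIV.
     a x i j * d_dz j (\<lambda>y. b y k l) x + b x i j * d_dz j (\<lambda>y. a y k l) x) vs" .
qed

section \<open>Pullback of contractions\<close>

definition complex_linear :: "(complex ^ 'n \<Rightarrow> complex ^ 'n) \<Rightarrow> bool" where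
  "complex_linear D \<longleftrightarrow> (\<forall>u v. D (u + v) = D u + D v) \<and> (\<forall>c v. D (c *s v) = c *s D v)"

lemma complex_linear_axis:
  fixes D :: "complex ^ 'n::finite \<Rightarrow> complex ^ 'n"
  assumes "complex_linear D"
  shows "D v $ i = (\<Sum>j\<in>UNIV. D (axis j 1) $ i * v $ j)"
proof -
  have z: "D 0 = 0" using assms unfolding complex_linear_def by (metis add_cancel_right_left)
  have s: "D (\<Sum>j\<in>J. f j) = (\<Sum>j\<in>J. D (f j))" if "finite J" for f :: "'n \<Rightarrow> _" and J
    using that by (induction J) (use assms z in \<open>auto simp: complex_linear_def\<close>)
  have "D v = D (\<Sum>j\<in>UNIV. v $ j *s axis j 1)" by (simp add: basis_expansion)
  also have "\<dots> = (\<Sum>j\<in>UNIV. v $ j *s D (axis j 1))"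
    using assms by (simp add: s complex_linear_def)
  finally show ?thesis by (simp add: mult.commute)
qed

lemma wedge_map: "wedge p \<xi> \<eta> (map D vs) = wedge p (\<lambda>ws. \<xi> (map D ws)) (\<lambda>ws. \<eta> (map D ws)) vs"
  unfolding wedge_def
  by (intro arg_cong2 [where f = "(/)"] sum.cong) (auto simp: permute_list_map take_map drop_map)

lemma wedge_sum_left:
  "wedge p (\<lambda>ws. \<Sum>m\<in>M. c m * \<xi> m ws) \<eta> vs = (\<Sum>m\<in>M. c m * wedge p (\<xi> m) \<eta> vs)"
  unfolding wedge_def sum_distrib_left sum_distrib_right times_divide_eq_right sum_divide_distrib
  by (subst sum.swap) (simp add: mult_ac)

lemma wedge_sum_right:
  "wedge p \<xi> (\<lambda>ws. \<Sum>m\<in>M. c m * \<eta> m ws) vs = (\<Sum>m\<in>M. c m * wedge p \<xi> (\<eta> m) vs)"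
  unfolding wedge_def sum_distrib_left sum_distrib_right times_divide_eq_right sum_divide_distrib
  by (subst sum.swap) (simp add: mult_ac)

text \<open>Contraction is complex linear in the vector of type \<open>(1,0)\<close>, and the holomorphic
  derivative \<open>D\<close> sends \<open>\<partial>/\<partial>z\<^sub>m\<close> to \<open>\<Sum> D\<^sub>j\<^sub>m \<partial>/\<partial>z\<^sub>j\<close> without terms in \<open>\<partial>/\<partial>zbar\<^sub>j\<close>.\<close>

lemma iota_pullback:
  assumes "complex_linear D" "\<And>vs. linear (\<lambda>v. \<eta> (v # vs))"
  shows "iota m (\<lambda>vs. \<eta> (map D vs)) ws = (\<Sum>j\<in>UNIV. D (axis m 1) $ j * iota j \<eta> (map D ws))"
proof -
  have "D (axis m \<i>) = \<i> *s D (axis m 1)"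
    using assms(1) by (simp add: axis_mult [of m \<i>] complex_linear_def)
  then show ?thesis
    using real_linear_holo_part [OF assms(2), of "D (axis m 1)" "map D ws"]
    by (simp add: iota_def)
qed

text \<open>If \<open>\<theta>\<close> and \<open>\<theta>'\<close> correspond under \<open>D\<close>, the matrix of \<open>D\<close> can be moved from the vector
  part of \<open>\<theta>\<close> to the contraction.\<close>

lemma contract_pt_pullback:
  assumes D: "complex_linear D" and \<eta>: "\<And>vs. linear (\<lambda>v. \<eta> (v # vs))" and \<theta>: "\<And>vs. \<theta>' (map D vs) = D (\<theta> vs)"
  shows "contract_pt p \<theta> (\<lambda>vs. \<eta> (map D vs)) vs = contract_pt p \<theta>' \<eta> (map D vs)"
proof -
  have "contract_pt p \<theta> (\<lambda>vs. \<eta> (map D vs)) vs =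
      (\<Sum>m\<in>UNIV. \<Sum>j\<in>UNIV. D (axis m 1) $ j * wedge p (\<lambda>ws. \<theta> ws $ m) (\<lambda>ws. iota j \<eta> (map D ws)) vs)"
  proof -
    have "iota m (\<lambda>vs. \<eta> (map D vs)) = (\<lambda>ws. \<Sum>j\<in>UNIV. D (axis m 1) $ j * iota j \<eta> (map D ws))" for m
      by (rule ext) (rule iota_pullback [OF D \<eta>])
    then show ?thesis by (simp only: contract_pt_def wedge_sum_right)
  qed
  also have "\<dots> = (\<Sum>j\<in>UNIV. wedge p (\<lambda>ws. \<Sum>m\<in>UNIV. D (axis m 1) $ j * \<theta> ws $ m) (\<lambda>ws. iota j \<eta> (map D ws)) vs)"
    unfolding wedge_sum_left by (rule sum.swap)
  also have "\<dots> = contract_pt p \<theta>' \<eta> (map D vs)"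
    unfolding contract_pt_def wedge_map \<theta> complex_linear_axis [OF D, symmetric] ..
  finally show ?thesis .
qed

lemma linear_form11: "linear (\<lambda>v. form11 h (v # vs))"
proof (cases "\<exists>w. vs = [w]")
  case True
  then show ?thesis by (auto simp: form11_def intro!: linearI) (auto simp: algebra_simps)
next
  case False
  then have "form11 h (v # vs) = 0" for v by (auto simp: form11_def split: list.split)
  then show ?thesis by (simp add: linear_zero)
qed

lemma linear_form21: "linear (\<lambda>v. form21 C (v # vs))"
proof (cases "\<exists>w w'. vs = [w, w']")
  case True
  then show ?thesis by (auto simp: form21_def intro!: linearI) (auto simp: algebra_simps)
next
  case False
  then have "form21 C (v # vs) = 0" for v by (auto simp: form21_def split: list.split)
  then show ?thesis by (simp add: linear_zero)
qed

lemma sesq_has_derivative: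
  assumes F: "(F has_derivative DF) (at x)" and h: "\<And>i j. ((\<lambda>y. h y i j) has_derivative h' i j) (at (F x))"
    and f: "(f has_derivative f') (at x)" and g: "(g has_derivative g') (at x)"
  shows "((\<lambda>y. sesq (h (F y)) (f y) (g y)) has_derivative
    (\<lambda>u. sesq (\<lambda>i j. h' i j (DF u)) (f x) (g x) + sesq (h (F x)) (f' u) (g x) + sesq (h (F x)) (f x) (g' u))) (at x)"
proof -
  have 1: "((\<lambda>y. h (F y) i j) has_derivative (\<lambda>u. h' i j (DF u))) (at x)" for i j
    using has_derivative_compose [OF F h] by simp
  have 2: "((\<lambda>y. f y $ i) has_derivative (\<lambda>u. f' u $ i)) (at x)" for i
    using bounded_linear.has_derivative [OF bounded_linear_vec_nth f] by simp
  have 3: "((\<lambda>y. cnj (g y $ j)) has_derivative (\<lambda>u. cnj (g' u $ j))) (at x)" for j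
    using bounded_linear.has_derivative [OF bounded_linear_compose [OF bounded_linear_cnj bounded_linear_vec_nth] g]
    by simp
  show ?thesis unfolding sesq_def
    by (rule has_derivative_eq_rhs [OF has_derivative_sum [OF has_derivative_sum
        [OF has_derivative_mult [OF has_derivative_mult [OF 1 2] 3]]]])
       (simp add: fun_eq_iff algebra_simps sum.distrib)
qed

text \<open>The product rule for a pulled back \<open>(1,1)\<close>-form: in the applications \<open>A y\<close> is the derivative
  of the map \<open>F\<close> at \<open>y\<close> and \<open>S v u\<close> its second derivative. It is used for naturality of \<open>\<partial>\<close> and for the normal
  form of the metric.\<close>

lemma form11_pullback_has_derivative:
  assumes "(F has_derivative DF) (at x)" "\<And>i j. ((\<lambda>y. h y i j) has_derivative h' i j) (at (F x))"
    "\<And>v. ((\<lambda>y. A y v) has_derivative S v) (at x)"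
  shows "((\<lambda>y. form11 (h (F y)) [A y v, A y w]) has_derivative
    (\<lambda>u. form11 (\<lambda>i j. h' i j (DF u)) [A x v, A x w] + form11 (h (F x)) [S v u, A x w]
        + form11 (h (F x)) [A x v, S w u])) (at x)"
  unfolding form11_def list.case
  by (rule has_derivative_eq_rhs [OF has_derivative_mult_right [OF has_derivative_diff
        [OF sesq_has_derivative sesq_has_derivative]], OF assms(1,2,3,3) assms(1,2,3,3)])
     (simp add: algebra_simps)

section \<open>Symmetry of second derivatives\<close>

text \<open>Two applications of the mean value theorem; the left-hand side is symmetric in \<open>u\<close> and
  \<open>v\<close>, the right-hand side tends to a second derivative.\<close>

lemma mixed_difference:
  fixes f :: "'a::real_normed_vector \<Rightarrow> real"
  assumes f: "\<And>y. y \<in> S \<Longrightarrow> (f has_derivative (\<lambda>u. f' u y)) (at y)"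
    and f': "\<And>u y. y \<in> S \<Longrightarrow> (f' u has_derivative (\<lambda>v. f'' u v y)) (at y)"
    and S: "\<And>s r. 0 \<le> s \<Longrightarrow> s \<le> t \<Longrightarrow> 0 \<le> r \<Longrightarrow> r \<le> t \<Longrightarrow> x + s *\<^sub>R u + r *\<^sub>R v \<in> S" and t: "0 < t"
  shows "\<exists>s r. 0 \<le> s \<and> s \<le> t \<and> 0 \<le> r \<and> r \<le> t \<and>
    f (x + t *\<^sub>R u + t *\<^sub>R v) - f (x + t *\<^sub>R u) - f (x + t *\<^sub>R v) + f x = t * (t * f'' u v (x + s *\<^sub>R u + r *\<^sub>R v))"
proof -
  have lin: "f' (c *\<^sub>R u) y = c * f' u y" if "y \<in> S" for c u y
    using linear_scale [OF has_derivative_linear [OF f [OF that]]] by simp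
  have lin': "f'' u (c *\<^sub>R v) y = c * f'' u v y" if "y \<in> S" for c u v y
    using linear_scale [OF has_derivative_linear [OF f' [OF that]]] by simp
  define \<phi> where "\<phi> s = f (x + s *\<^sub>R u + t *\<^sub>R v) - f (x + s *\<^sub>R u + 0 *\<^sub>R v)" for s
  have l1: "((\<lambda>s. x + s *\<^sub>R u + r *\<^sub>R v) has_derivative (\<lambda>c. c *\<^sub>R u)) (at s)" for r s
    by (auto intro!: derivative_eq_intros)
  have l2: "((\<lambda>r. x + s *\<^sub>R u + r *\<^sub>R v) has_derivative (\<lambda>c. c *\<^sub>R v)) (at r)" for r s
    by (auto intro!: derivative_eq_intros)
  have d: "((\<lambda>s. f (x + s *\<^sub>R u + r *\<^sub>R v)) has_field_derivative f' u (x + s *\<^sub>R u + r *\<^sub>R v)) (at s)"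
    if "0 \<le> s" "s \<le> t" "0 \<le> r" "r \<le> t" for s r
  proof -
    have y: "x + s *\<^sub>R u + r *\<^sub>R v \<in> S" by (rule S [OF that])
    show ?thesis
      using has_derivative_compose [OF l1 f [OF y]] unfolding has_field_derivative_def lin [OF y]
      by (simp add: mult.commute [of _ "f' u (x + s *\<^sub>R u + r *\<^sub>R v)"])
  qed
  have d': "((\<lambda>r. f' u (x + s *\<^sub>R u + r *\<^sub>R v)) has_field_derivative f'' u v (x + s *\<^sub>R u + r *\<^sub>R v)) (at r)"
    if "0 \<le> s" "s \<le> t" "0 \<le> r" "r \<le> t" for s r
  proof -
    have y: "x + s *\<^sub>R u + r *\<^sub>R v \<in> S" by (rule S [OF that])
    show ?thesis
      using has_derivative_compose [OF l2 f' [OF y, of u]] unfolding has_field_derivative_def lin' [OF y]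
      by (simp add: mult.commute [of _ "f'' u v (x + s *\<^sub>R u + r *\<^sub>R v)"])
  qed
  have "(\<phi> has_field_derivative (f' u (x + s *\<^sub>R u + t *\<^sub>R v) - f' u (x + s *\<^sub>R u + 0 *\<^sub>R v))) (at s)"
    if "0 \<le> s" "s \<le> t" for s
    unfolding \<phi>_def using t that by (intro DERIV_diff d) auto
  from MVT2 [OF t this] obtain s where s: "0 < s" "s < t"
    "\<phi> t - \<phi> 0 = (t - 0) * (f' u (x + s *\<^sub>R u + t *\<^sub>R v) - f' u (x + s *\<^sub>R u + 0 *\<^sub>R v))" by blast
  have "((\<lambda>r. f' u (x + s *\<^sub>R u + r *\<^sub>R v)) has_field_derivative f'' u v (x + s *\<^sub>R u + r *\<^sub>R v)) (at r)"
    if "0 \<le> r" "r \<le> t" for r using s that by (intro d') auto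
  from MVT2 [OF t this] obtain r where r: "0 < r" "r < t"
    "f' u (x + s *\<^sub>R u + t *\<^sub>R v) - f' u (x + s *\<^sub>R u + 0 *\<^sub>R v) = (t - 0) * f'' u v (x + s *\<^sub>R u + r *\<^sub>R v)"
    by blast
  show ?thesis
    using s r by (intro exI [of _ s] exI [of _ r]) (auto simp: \<phi>_def algebra_simps)
qed

lemma second_derivative_symmetric_real:
  fixes f :: "'a::real_normed_vector \<Rightarrow> real"
  assumes S: "open S" "x \<in> S"
    and f: "\<And>y. y \<in> S \<Longrightarrow> (f has_derivative (\<lambda>u. f' u y)) (at y)"
    and f': "\<And>u y. y \<in> S \<Longrightarrow> (f' u has_derivative (\<lambda>v. f'' u v y)) (at y)"
    and f'': "\<And>u v. continuous_on S (f'' u v)"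
  shows "f'' u v x = f'' v u x"
proof -
  have "\<bar>f'' u v x - f'' v u x\<bar> \<le> e" if e: "e > 0" for e
  proof -
    have "\<exists>d>0. ball x d \<subseteq> S \<and> (\<forall>y\<in>ball x d. dist (f'' u v y) (f'' u v x) < e / 2)" for u v
    proof -
      obtain d1 where "d1 > 0" "ball x d1 \<subseteq> S" using S openE by blast
      moreover obtain d2 where "d2 > 0" "\<And>y. y \<in> S \<Longrightarrow> dist y x < d2 \<Longrightarrow> dist (f'' u v y) (f'' u v x) < e / 2"
        using f'' [of u v] S(2) e unfolding continuous_on_iff by (metis half_gt_zero)
      ultimately have "ball x (min d1 d2) \<subseteq> S" "\<And>y. y \<in> ball x (min d1 d2) \<Longrightarrow> dist (f'' u v y) (f'' u v x) < e / 2"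
        "min d1 d2 > 0" by (auto simp: subset_iff dist_commute)
      then show ?thesis by blast
    qed
    from this [of u v] this [of v u] obtain d d' where d: "d > 0" "ball x d \<subseteq> S"
      "\<And>y. y\<in>ball x d \<Longrightarrow> dist (f'' u v y) (f'' u v x) < e / 2"
      and d': "d' > 0" "\<And>y. y\<in>ball x d' \<Longrightarrow> dist (f'' v u y) (f'' v u x) < e / 2" by metis
    \<comment> \<open>So small that the parallelogram at \<open>x\<close> spanned by \<open>t u\<close> and \<open>t v\<close> lies in both balls.\<close>
    define t where "t = min d d' / (2 * (norm u + norm v + 1))"
    have t: "t > 0" using d d' by (auto simp: t_def intro!: divide_pos_pos add_nonneg_pos)
    have tb: "t * (norm u + norm v) < min d d'"
    proof -
      have n: "0 \<le> norm u + norm v" by simp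
      have "N < 2 * (N + 1)" if "0 \<le> N" for N :: real using that by simp
      from mult_strict_left_mono [OF this [OF n] t]
      have "t * (norm u + norm v) < t * (2 * (norm u + norm v + 1))" .
      also have "\<dots> = min d d'"
      proof -
        have "0 < norm u + norm v + 1" by (intro add_nonneg_pos n) simp
        then have "2 * (norm u + norm v + 1) \<noteq> 0" by (metis less_irrefl mult_pos_pos zero_less_numeral)
        then show ?thesis unfolding t_def by (rule nonzero_eq_divide_eq [THEN iffD1, OF _ refl])
      qed
      finally show ?thesis .
    qed
    have near: "x + s *\<^sub>R u + r *\<^sub>R v \<in> ball x (min d d')" if "0 \<le> s" "s \<le> t" "0 \<le> r" "r \<le> t" for s r
    proof -
      have "norm (s *\<^sub>R u + r *\<^sub>R v) \<le> norm (s *\<^sub>R u) + norm (r *\<^sub>R v)" by (rule norm_triangle_ineq)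
      also have "\<dots> \<le> t * norm u + t * norm v"
        using that by (intro add_mono) (auto intro: mult_right_mono)
      also have "\<dots> < min d d'" using tb by (simp only: distrib_left)
      finally have "norm (s *\<^sub>R u + r *\<^sub>R v) < min d d'" .
      moreover have "dist x (x + s *\<^sub>R u + r *\<^sub>R v) = norm (s *\<^sub>R u + r *\<^sub>R v)"
        using norm_minus_cancel [of "s *\<^sub>R u + r *\<^sub>R v"] by (simp add: dist_norm)
      ultimately show ?thesis by simp
    qed
    have near': "x + s *\<^sub>R v + r *\<^sub>R u \<in> ball x (min d d')" if "0 \<le> s" "s \<le> t" "0 \<le> r" "r \<le> t" for s r
      using near [of r s] that by (simp add: add_ac)
    have inS: "y \<in> S" if "y \<in> ball x (min d d')" for y using that d(2) by auto
    obtain s r where 1: "0 \<le> s" "s \<le> t" "0 \<le> r" "r \<le> t"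
      "f (x + t *\<^sub>R u + t *\<^sub>R v) - f (x + t *\<^sub>R u) - f (x + t *\<^sub>R v) + f x = t * (t * f'' u v (x + s *\<^sub>R u + r *\<^sub>R v))"
      using mixed_difference [of S f f' f'' t x u v, OF f f' inS [OF near] t] by blast
    obtain s' r' where 2: "0 \<le> s'" "s' \<le> t" "0 \<le> r'" "r' \<le> t"
      "f (x + t *\<^sub>R v + t *\<^sub>R u) - f (x + t *\<^sub>R v) - f (x + t *\<^sub>R u) + f x = t * (t * f'' v u (x + s' *\<^sub>R v + r' *\<^sub>R u))"
      using mixed_difference [of S f f' f'' t x v u, OF f f' inS [OF near'] t] by blast
    have "t * (t * f'' u v (x + s *\<^sub>R u + r *\<^sub>R v)) = t * (t * f'' v u (x + s' *\<^sub>R v + r' *\<^sub>R u))"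
      unfolding 1(5) [symmetric] 2(5) [symmetric] by (simp add: add_ac)
    then have eq: "f'' u v (x + s *\<^sub>R u + r *\<^sub>R v) = f'' v u (x + s' *\<^sub>R v + r' *\<^sub>R u)"
      using t by simp
    have "dist (f'' u v (x + s *\<^sub>R u + r *\<^sub>R v)) (f'' u v x) < e / 2"
      using near [OF 1(1-4)] by (intro d(3)) simp
    moreover have "dist (f'' v u (x + s' *\<^sub>R v + r' *\<^sub>R u)) (f'' v u x) < e / 2"
      using near' [OF 2(1-4)] by (intro d'(2)) simp
    ultimately have "dist (f'' u v x) (f'' v u x) < e"
      unfolding eq by (rule dist_triangle_half_r)
    then show ?thesis by (simp add: dist_real_def)
  qed
  then have "\<bar>f'' u v x - f'' v u x\<bar> \<le> 0 + e" if "e > 0" for e using that by (simp only: add_0)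
  then have "\<bar>f'' u v x - f'' v u x\<bar> \<le> 0" by (rule field_le_epsilon)
  then show ?thesis by simp
qed


lemma second_derivative_symmetric:
  fixes f :: "'a::real_normed_vector \<Rightarrow> 'b::euclidean_space"
  assumes S: "open S" "x \<in> S" and f: "Ck_on 2 S f"
  shows "frechet_derivative (\<lambda>y. frechet_derivative f (at y) u) (at x) v =
         frechet_derivative (\<lambda>y. frechet_derivative f (at y) v) (at x) u"
proof (rule euclidean_eqI)
  fix b :: 'b
  have 1: "(f has_derivative frechet_derivative f (at y)) (at y)" if "y \<in> S" for y
    using f that by (auto simp: numeral_2_eq_2 frechet_derivative_works)
  have 2: "((\<lambda>y. frechet_derivative f (at y) u) has_derivative
      frechet_derivative (\<lambda>y. frechet_derivative f (at y) u) (at y)) (at y)" if "y \<in> S" for y u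
    using f that by (auto simp: numeral_2_eq_2 frechet_derivative_works)
  have 3: "continuous_on S (\<lambda>y. frechet_derivative (\<lambda>y. frechet_derivative f (at y) u) (at y) v)" for u v
    using f by (auto simp: numeral_2_eq_2)
  show "frechet_derivative (\<lambda>y. frechet_derivative f (at y) u) (at x) v \<bullet> b =
         frechet_derivative (\<lambda>y. frechet_derivative f (at y) v) (at x) u \<bullet> b"
    by (rule second_derivative_symmetric_real [where f = "\<lambda>y. f y \<bullet> b"
          and f' = "\<lambda>u y. frechet_derivative f (at y) u \<bullet> b"
          and f'' = "\<lambda>u v y. frechet_derivative (\<lambda>y. frechet_derivative f (at y) u) (at y) v \<bullet> b", OF S])
       (intro has_derivative_inner_left 1 2 continuous_on_inner 3 continuous_on_const; assumption)+
qed

section \<open>Naturality of \<open>\<partial>\<close>\<close>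

lemma tri21_d_dz:
  assumes "\<And>i j. ((\<lambda>y. h y i j) has_derivative h' i j) (at x)"
  shows "tri21 (\<lambda>k i j. d_dz k (\<lambda>y. h y i j) x) u v w
    = (sesq (\<lambda>i j. h' i j u) v w - \<i> * sesq (\<lambda>i j. h' i j (\<i> *s u)) v w) / 2"
proof -
  have 1: "(\<Sum>k\<in>UNIV. d_dz k (\<lambda>y. h y i j) x * u $ k) = (h' i j u - \<i> * h' i j (\<i> *s u)) / 2" for u i j
    using sum_d_dz [OF assms, of u i j] by (simp add: mult.commute)
  have "tri21 (\<lambda>k i j. d_dz k (\<lambda>y. h y i j) x) u v w =
      (\<Sum>i\<in>UNIV. \<Sum>j\<in>UNIV. (\<Sum>k\<in>UNIV. d_dz k (\<lambda>y. h y i j) x * u $ k) * v $ i * cnj (w $ j))" for u v w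
    unfolding tri21_def sum_distrib_right
    by (subst sum.swap) (rule sum.cong [OF refl], rule sum.swap)
  also have "\<dots> u v w = (sesq (\<lambda>i j. h' i j u) v w - \<i> * sesq (\<lambda>i j. h' i j (\<i> *s u)) v w) / 2" for u v w
    unfolding 1 sesq_def by (simp add: sum_distrib_left sum_subtractf sum_divide_distrib algebra_simps diff_divide_distrib)
  finally show ?thesis .
qed

text \<open>\<open>\<partial>\<close> as the exterior derivative with directional derivatives replaced by their
  complex linear parts.\<close>

lemma form21_d_dz_eval:
  assumes "\<And>i j. ((\<lambda>y. h y i j) has_derivative h' i j) (at x)"
  shows "form21 (\<lambda>k i j. d_dz k (\<lambda>y. h y i j) x) [u, v, w] =
    (let P = (\<lambda>u v w. (form11 (\<lambda>i j. h' i j u) [v, w] - \<i> * form11 (\<lambda>i j. h' i j (\<i> *s u)) [v, w]) / 2)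
     in P u v w - P v u w + P w u v)"
  unfolding form21_def form11_def Let_def list.case tri21_d_dz [OF assms] by (simp add: field_simps)

text \<open>Differentiating the pulled back form gives the pullback of its derivative and terms with the
  second derivative \<open>H\<close> of \<open>\<tau>\<close>. These cancel in the alternating sum by symmetry of \<open>H\<close>. Holomorphy of \<open>\<tau>\<close>
  makes \<open>H\<close> complex bilinear, so that taking complex linear parts is compatible with the pullback.\<close>

lemma del_loc_pullback:
  fixes \<tau> :: "complex ^ 'n::finite \<Rightarrow> complex ^ 'n"
  assumes S: "open S" "x \<in> S" and T: "open T" "\<tau> ` S \<subseteq> T" and \<tau>: "holo_on S \<tau>"
    and \<eta>: "\<And>y. y \<in> S \<Longrightarrow> \<eta> y = form11 (h y)" "\<And>i j. (\<lambda>y. h y i j) differentiable (at x)"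
    and \<eta>': "\<And>y. y \<in> T \<Longrightarrow> \<eta>' y = form11 (g y)" "\<And>i j. (\<lambda>y. g y i j) differentiable (at (\<tau> x))"
    and pull: "\<And>y vs. y \<in> S \<Longrightarrow> \<eta> y vs = \<eta>' (\<tau> y) (map (frechet_derivative \<tau> (at y)) vs)"
  shows "del_loc \<eta> x vs = del_loc \<eta>' (\<tau> x) (map (frechet_derivative \<tau> (at x)) vs)"
proof -
  have dl: "del_loc \<eta> x = form21 (\<lambda>k i j. d_dz k (\<lambda>y. h y i j) x)"
    by (rule del_loc_form11 [OF S \<eta>])
  have dl': "del_loc \<eta>' (\<tau> x) = form21 (\<lambda>k i j. d_dz k (\<lambda>y. g y i j) (\<tau> x))"
    using S T by (intro del_loc_form11 [OF T(1) _ \<eta>']) auto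
  define A where "A y = frechet_derivative \<tau> (at y)" for y
  define H where "H v = frechet_derivative (\<lambda>y. A y v) (at x)" for v
  define h' where "h' i j = frechet_derivative (\<lambda>y. h y i j) (at x)" for i j
  define g' where "g' i j = frechet_derivative (\<lambda>y. g y i j) (at (\<tau> x))" for i j
  have sm: "Ck_on 2 S \<tau>" and cl: "\<And>y c v. y \<in> S \<Longrightarrow> A y (c *s v) = c *s A y v"
    using \<tau> by (auto simp: holo_on_def smooth_on_def A_def)
  have \<tau>d: "(\<tau> has_derivative A x) (at x)"
    using sm S by (auto simp: numeral_2_eq_2 A_def frechet_derivative_works)
  have Ad: "((\<lambda>y. A y v) has_derivative H v) (at x)" for v
    using sm S by (auto simp: numeral_2_eq_2 A_def H_def frechet_derivative_works)
  have hd: "((\<lambda>y. h y i j) has_derivative h' i j) (at x)" for i j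
    using \<eta>(2) by (simp add: h'_def frechet_derivative_works)
  have gd: "((\<lambda>y. g y i j) has_derivative g' i j) (at (\<tau> x))" for i j
    using \<eta>'(2) by (simp add: g'_def frechet_derivative_works)
  have Hsym: "H v u = H u v" for u v
    unfolding H_def A_def by (rule second_derivative_symmetric [OF S sm])
  have Hi: "H v (\<i> *s u) = \<i> *s H v u" for u v
  proof -
    have "H (\<i> *s u) v = frechet_derivative (\<lambda>y. \<i> *s A y u) (at x) v"
      unfolding H_def using S cl by (subst frechet_derivative_cong [OF S, of _ "\<lambda>y. \<i> *s A y u"]) auto
    also have "((\<lambda>y. \<i> *s A y u) has_derivative (\<lambda>v. \<i> *s H u v)) (at x)"
    proof -
      have "bounded_linear (\<lambda>z::complex^'n. \<i> *s z)"
        by (intro linear_conv_bounded_linear [THEN iffD1] linearI) (simp_all add: vec_eq_iff algebra_simps)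
      from bounded_linear.has_derivative [OF this Ad] show ?thesis .
    qed
    then have "frechet_derivative (\<lambda>y. \<i> *s A y u) (at x) v = \<i> *s H u v"
      by (simp add: frechet_derivative_at [symmetric])
    finally show ?thesis by (simp add: Hsym)
  qed
  have deriv: "form11 (\<lambda>i j. h' i j u) [v, w] = form11 (\<lambda>i j. g' i j (A x u)) [A x v, A x w]
      + form11 (g (\<tau> x)) [H v u, A x w] + form11 (g (\<tau> x)) [A x v, H w u]" for u v w
  proof -
    have "((\<lambda>y. form11 (h y) [v, w]) has_derivative (\<lambda>u. form11 (\<lambda>i j. h' i j u) [v, w])) (at x)"
      by (rule form11_has_derivative [OF hd])
    moreover have "form11 (h y) [v, w] = form11 (g (\<tau> y)) [A y v, A y w]" if "y \<in> S" for y
      using pull [OF that, of "[v, w]"] \<eta>(1) [OF that] \<eta>'(1) [of "\<tau> y"] T(2) that by (auto simp: A_def)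
    ultimately have "((\<lambda>y. form11 (g (\<tau> y)) [A y v, A y w]) has_derivative (\<lambda>u. form11 (\<lambda>i j. h' i j u) [v, w])) (at x)"
      by (rule has_derivative_transform_within_open [OF _ S])
    from has_derivative_unique [OF this form11_pullback_has_derivative [OF \<tau>d gd Ad]]
    show ?thesis by (rule fun_cong)
  qed
  show ?thesis
  proof (cases "length vs = 3")
    case True
    then obtain u v w where vs: "vs = [u, v, w]" by (auto simp: numeral_3_eq_3 length_Suc_conv)
    let ?Q = "\<lambda>u v w. (form11 (\<lambda>i j. g' i j u) [v, w] - \<i> * form11 (\<lambda>i j. g' i j (\<i> *s u)) [v, w]) / 2"
    have "(form11 (\<lambda>i j. h' i j u) [v, w] - \<i> * form11 (\<lambda>i j. h' i j (\<i> *s u)) [v, w]) / 2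
        = ?Q (A x u) (A x v) (A x w) + \<i> / 2 * sesq (g (\<tau> x)) (H v u) (A x w) - \<i> / 2 * sesq (g (\<tau> x)) (H w u) (A x v)" for u v w
      unfolding deriv Hi cl [OF S(2)]
      by (simp add: form11_def field_simps)
    note R = this
    show ?thesis
      by (simp only: dl dl' vs list.map form21_d_dz_eval [OF hd] form21_d_dz_eval [OF gd] Let_def A_def [symmetric] R)
         (simp add: Hsym [of v u] Hsym [of w u] Hsym [of w v])
  next
    case False
    then show ?thesis by (simp add: dl dl' form_eq_0_length)
  qed
qed


section \<open>The map \<open>#\<close>\<close>

definition positive_definite :: "('n::finite \<Rightarrow> 'n \<Rightarrow> complex) \<Rightarrow> bool" where
  "positive_definite h \<longleftrightarrow> (\<forall>v. v \<noteq> 0 \<longrightarrow> Re (sesq h v v) > 0)"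

lemma Lambda_Theta_2: "\<psi> \<in> Lambda_Theta 2 \<longleftrightarrow> (\<exists>s. \<forall>j vs. \<psi> vs $ j = form20 (\<lambda>k i. s k i j) vs)"
proof
  assume "\<psi> \<in> Lambda_Theta 2"
  then have "\<forall>j. \<exists>s. (\<lambda>vs. \<psi> vs $ j) = form20 s" by (simp add: Lambda_Theta_def Lambda_2_0)
  then obtain s where "\<And>j. (\<lambda>vs. \<psi> vs $ j) = form20 (s j)" by metis
  note * = this
  have "\<psi> vs $ j = form20 (s j) vs" for j vs
    unfolding * [of j, symmetric] ..
  then show "\<exists>s. \<forall>j vs. \<psi> vs $ j = form20 (\<lambda>k i. s k i j) vs"
    by (intro exI [of _ "\<lambda>k i j. s j k i"]) simp
next
  assume "\<exists>s. \<forall>j vs. \<psi> vs $ j = form20 (\<lambda>k i. s k i j) vs"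
  then obtain s where "\<And>j. (\<lambda>vs. \<psi> vs $ j) = form20 (\<lambda>k i. s k i j)" by auto
  then show "\<psi> \<in> Lambda_Theta 2" by (auto simp: Lambda_Theta_def Lambda_2_0)
qed

text \<open>Rewritten in terms of the vectors \<open>\<psi> [u, v]\<close>, the form \<open>\<psi> \<lrcorner> \<omega>\<close> shows how the metric pairs
  them with the remaining argument.\<close>

lemma contract2_eval:
  assumes "\<psi> \<in> Lambda_Theta 2"
  shows "contract_pt 2 \<psi> (form11 h) [u, v, w] =
    \<i> / 2 * (sesq h (\<psi> [u, v]) w - sesq h (\<psi> [u, w]) v + sesq h (\<psi> [v, w]) u)"
proof -
  obtain s where s: "\<And>j vs. \<psi> vs $ j = form20 (\<lambda>k i. s k i j) vs"
    using assms unfolding Lambda_Theta_2 by blast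
  have *: "sesq h (\<psi> [u, v]) w = tri21 (\<lambda>k i l. \<Sum>j\<in>UNIV. s k i j * h j l) u v w
      - tri21 (\<lambda>k i l. \<Sum>j\<in>UNIV. s k i j * h j l) v u w" for u v w
  proof -
    have t: "(\<Sum>j\<in>UNIV. bilin (\<lambda>k i. s k i j) u v * (\<Sum>l\<in>UNIV. h j l * cnj (w $ l))) =
       tri21 (\<lambda>k i l. \<Sum>j\<in>UNIV. s k i j * h j l) u v w" for u v
      unfolding tri21_tensor_bilin tri21_sum ..
    have "sesq h (\<psi> [u, v]) w = (\<Sum>j\<in>UNIV. \<psi> [u, v] $ j * (\<Sum>l\<in>UNIV. h j l * cnj (w $ l)))"
      unfolding sesq_def sum_distrib_left by (simp add: mult_ac)
    also have "\<dots> = (\<Sum>j\<in>UNIV. bilin (\<lambda>k i. s k i j) u v * (\<Sum>l\<in>UNIV. h j l * cnj (w $ l)))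
       - (\<Sum>j\<in>UNIV. bilin (\<lambda>k i. s k i j) v u * (\<Sum>l\<in>UNIV. h j l * cnj (w $ l)))"
      by (simp add: s form20_def algebra_simps sum_subtractf)
    finally show ?thesis by (simp only: t)
  qed
  show ?thesis unfolding contract2_form11 [of \<psi> s, OF s] * by (simp add: form21_def algebra_simps)
qed

text \<open>Of the three terms of \<open>contract2_eval\<close> only the first is antilinear in \<open>w\<close>; comparing
  the values at \<open>w\<close> and \<open>\<i> w\<close> isolates it. Positivity then separates \<open>\<psi>\<close> and \<open>\<psi>'\<close>.\<close>

lemma contract2_inj:
  assumes h: "positive_definite h" and \<psi>: "\<psi> \<in> Lambda_Theta 2" "\<psi>' \<in> Lambda_Theta 2"
    and eq: "contract_pt 2 \<psi> (form11 h) = contract_pt 2 \<psi>' (form11 h)"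
  shows "\<psi> = \<psi>'"
proof
  fix vs
  have I: "\<psi> [u, \<i> *s w] = \<i> *s \<psi> [u, w]" if "\<psi> \<in> Lambda_Theta 2" for \<psi> and u w :: "complex^'a"
    using that unfolding Lambda_Theta_2 vec_eq_iff
    by (auto simp: form20_def bilin_def sum_distrib_left algebra_simps)
  show "\<psi> vs = \<psi>' vs"
  proof (cases "length vs = 2")
    case True
    then obtain u v where vs: "vs = [u, v]" by (auto simp: numeral_2_eq_2 length_Suc_conv)
    have e: "sesq h (\<psi> [u, v]) w - sesq h (\<psi> [u, w]) v + sesq h (\<psi> [v, w]) u =
      sesq h (\<psi>' [u, v]) w - sesq h (\<psi>' [u, w]) v + sesq h (\<psi>' [v, w]) u" for w
      using fun_cong [OF eq, of "[u, v, w]"] by (simp add: contract2_eval \<psi>)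
    have "sesq h (\<psi> [u, v]) w = sesq h (\<psi>' [u, v]) w" for w
    proof -
      have "\<i> * (- sesq h (\<psi> [u, v]) w - sesq h (\<psi> [u, w]) v + sesq h (\<psi> [v, w]) u) =
          \<i> * (- sesq h (\<psi>' [u, v]) w - sesq h (\<psi>' [u, w]) v + sesq h (\<psi>' [v, w]) u)"
        using e [of "\<i> *s w"] by (simp add: I \<psi> algebra_simps)
      then show ?thesis using e [of w] by (simp add: complex_eq_iff)
    qed
    then have "sesq h (\<psi> [u, v] - \<psi>' [u, v]) w = 0" for w
      using sesq_linear(1) [of h "\<psi> [u, v] - \<psi>' [u, v]" "\<psi>' [u, v]" w] by simp
    with h have "\<psi> [u, v] - \<psi>' [u, v] = 0" unfolding positive_definite_def by (metis less_irrefl zero_complex.sel(1))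
    then show ?thesis by (simp add: vs)
  next
    case False
    with \<psi> have "\<psi> vs $ j = 0" "\<psi>' vs $ j = 0" for j
      unfolding Lambda_Theta_2 using form_eq_0_length(3) by metis+
    then show ?thesis by (simp add: vec_eq_iff)
  qed
qed

lemma form20_pullback:
  assumes "complex_linear D"
  shows "form20 s (map D vs) = form20 (\<lambda>m m'. \<Sum>k\<in>UNIV. \<Sum>i\<in>UNIV. s k i * D (axis m 1) $ k * D (axis m' 1) $ i) vs"
proof -
  have "bilin s (D u) (D v) = bilin (\<lambda>m m'. \<Sum>k\<in>UNIV. \<Sum>i\<in>UNIV. s k i * D (axis m 1) $ k * D (axis m' 1) $ i) u v" for u v
  proof -
    have "s k i * D u $ k * D v $ i = (\<Sum>m\<in>UNIV. \<Sum>m'\<in>UNIV. s k i * D (axis m 1) $ k * D (axis m' 1) $ i * u $ m * v $ m')" for k i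
      unfolding complex_linear_axis [OF assms, of u] complex_linear_axis [OF assms, of v]
      by (simp add: sum_distrib_left sum_distrib_right mult_ac)
    then have "bilin s (D u) (D v) = (\<Sum>k\<in>UNIV. \<Sum>i\<in>UNIV. \<Sum>m\<in>UNIV. \<Sum>m'\<in>UNIV.
       s k i * D (axis m 1) $ k * D (axis m' 1) $ i * u $ m * v $ m')" by (simp add: bilin_def)
    also have "\<dots> = (\<Sum>k\<in>UNIV. \<Sum>m\<in>UNIV. \<Sum>m'\<in>UNIV. \<Sum>i\<in>UNIV.
       s k i * D (axis m 1) $ k * D (axis m' 1) $ i * u $ m * v $ m')"
      by (rule sum.cong [OF refl], subst sum.swap, rule sum.cong [OF refl], rule sum.swap)
    also have "\<dots> = (\<Sum>m\<in>UNIV. \<Sum>m'\<in>UNIV. \<Sum>k\<in>UNIV. \<Sum>i\<in>UNIV.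
       s k i * D (axis m 1) $ k * D (axis m' 1) $ i * u $ m * v $ m')"
      by (subst sum.swap, rule sum.cong [OF refl], rule sum.swap)
    finally show ?thesis by (simp add: bilin_def sum_distrib_right)
  qed
  then show ?thesis by (auto simp: form20_def split: list.split)
qed

lemma Lambda_Theta_2_pullback:
  assumes D: "complex_linear D" and E: "complex_linear E" and "\<psi> \<in> Lambda_Theta 2"
  shows "(\<lambda>vs. E (\<psi> (map D vs))) \<in> Lambda_Theta 2"
proof -
  obtain s where s: "\<And>j vs. \<psi> vs $ j = form20 (\<lambda>k i. s k i j) vs"
    using assms unfolding Lambda_Theta_2 by blast
  have lin: "(\<Sum>m\<in>UNIV. e m * form20 (t m) vs) = form20 (\<lambda>k i. \<Sum>m\<in>(UNIV::'a set). e m * t m k i) vs" for e t vs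
  proof -
    have "(\<Sum>m\<in>UNIV. e m * bilin (t m) u v) = bilin (\<lambda>k i. \<Sum>m\<in>(UNIV::'a set). e m * t m k i) u v" for u v
      unfolding bilin_def sum_distrib_right sum_distrib_left
      by (subst sum.swap, rule sum.cong [OF refl], subst sum.swap) (simp add: mult.assoc)
    then show ?thesis
      by (auto simp: form20_def right_diff_distrib sum_subtractf split: list.split)
  qed
  have "E (\<psi> (map D vs)) $ j = (\<Sum>m\<in>UNIV. E (axis m 1) $ j * form20 (\<lambda>k i. s k i m) (map D vs))" for j vs
    by (subst complex_linear_axis [OF E]) (simp only: s)
  then show ?thesis unfolding Lambda_Theta_2 form20_pullback [OF D] lin
    by (intro exI allI)
qed

text \<open>A solution of the equation that defines \<open>#\<close> is transported by \<open>D\<close> from one chart to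
  another. Together with uniqueness (\<open>sharp_eq\<close>) this is naturality of \<open>#\<close>, and it reduces existence
  to a chart in which \<open>\<omega>\<close> is standard at the point.\<close>

lemma sharp_pullback:
  assumes D: "complex_linear D" and E: "complex_linear E" "\<And>v. D (E v) = v"
    and h: "positive_definite h" and h': "positive_definite h'"
    and \<omega>: "\<omega> = form11 h" and \<omega>': "\<omega>' = form11 h'" and p: "\<And>vs. \<omega> vs = \<omega>' (map D vs)" "\<And>vs. \<Gamma> vs = \<Gamma>' (map D vs)"
    and ex: "\<psi>' \<in> Lambda_Theta 2" "contract_pt 2 \<psi>' \<omega>' = \<Gamma>'"
  shows "\<exists>\<psi>. \<psi> \<in> Lambda_Theta 2 \<and> contract_pt 2 \<psi> \<omega> = \<Gamma> \<and> (\<forall>vs. \<psi>' (map D vs) = D (\<psi> vs))"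
proof (intro exI conjI allI)
  let ?\<psi> = "\<lambda>vs. E (\<psi>' (map D vs))"
  show "?\<psi> \<in> Lambda_Theta 2" by (rule Lambda_Theta_2_pullback [OF D E(1) ex(1)])
  show "\<psi>' (map D vs) = D (?\<psi> vs)" for vs by (simp add: E(2))
  have eq: "\<omega> = (\<lambda>vs. \<omega>' (map D vs))" by (rule ext) (rule p(1))
  show "contract_pt 2 ?\<psi> \<omega> = \<Gamma>"
  proof
    fix vs
    have "contract_pt 2 ?\<psi> \<omega> vs = contract_pt 2 \<psi>' \<omega>' (map D vs)"
      unfolding eq by (rule contract_pt_pullback [OF D]) (simp_all only: E(2) \<omega>' linear_form11)
    then show "contract_pt 2 ?\<psi> \<omega> vs = \<Gamma> vs" by (simp only: ex(2) p(2))
  qed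
qed

lemma sharp_eq:
  assumes "positive_definite h" "\<omega> c x = form11 h" "\<psi> \<in> Lambda_Theta 2" "contract_pt 2 \<psi> (\<omega> c x) = \<Gamma> c x"
  shows "sharp 2 \<omega> \<Gamma> c x = \<psi>"
  unfolding sharp_def
proof (rule the_equality)
  show "\<psi> \<in> Lambda_Theta 2 \<and> contract_pt 2 \<psi> (\<omega> c x) = \<Gamma> c x" using assms by simp
  fix \<psi>' assume "\<psi>' \<in> Lambda_Theta 2 \<and> contract_pt 2 \<psi>' (\<omega> c x) = \<Gamma> c x"
  then show "\<psi>' = \<psi>" using contract2_inj [OF assms(1), of \<psi>' \<psi>] assms by simp
qed

section \<open>Calculus of \<open>C\<^sup>k\<close> and holomorphic maps\<close>

lemma Ck_on_subset: "Ck_on k S f \<Longrightarrow> T \<subseteq> S \<Longrightarrow> Ck_on k T f"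
  by (induction k arbitrary: f) (auto intro: continuous_on_subset)

lemma Ck_on_cong:
  assumes "open S" "\<And>x. x \<in> S \<Longrightarrow> f x = g x" "Ck_on k S f"
  shows "Ck_on k S g"
  using assms(2,3)
proof (induction k arbitrary: f g)
  case 0
  then show ?case by (simp cong: continuous_on_cong)
next
  case (Suc k)
  have d: "frechet_derivative f (at x) = frechet_derivative g (at x)" if "x \<in> S" for x
    by (rule frechet_derivative_cong [OF assms(1) that Suc.prems(1)])
  have "g differentiable (at x)" if "x \<in> S" for x
    using Suc.prems that has_derivative_transform_within_open [OF _ assms(1) that, of f _ UNIV g]
    unfolding Ck_on.simps differentiable_def by blast
  moreover have "Ck_on k S (\<lambda>x. frechet_derivative g (at x) v)" for v
    by (rule Suc.IH [of "\<lambda>x. frechet_derivative f (at x) v"]) (use Suc.prems(2) d in auto)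
  ultimately show ?case by simp
qed

lemma Ck_on_Suc_imp: "Ck_on (Suc k) S f \<Longrightarrow> Ck_on k S f"
proof (induction k arbitrary: f)
  case 0
  then show ?case
    by (auto intro!: continuous_at_imp_continuous_on differentiable_imp_continuous_within)
next
  case (Suc k)
  have "\<forall>x\<in>S. f differentiable at x" "\<And>v. Ck_on (Suc k) S (\<lambda>x. frechet_derivative f (at x) v)"
    using Suc.prems unfolding Ck_on.simps(2) [of "Suc k" S f] by blast+
  with Suc.IH show ?case unfolding Ck_on.simps(2) [of k S f] by blast
qed

lemma Ck_on_has_derivative:
  "Ck_on (Suc k) S f \<Longrightarrow> x \<in> S \<Longrightarrow> (f has_derivative frechet_derivative f (at x)) (at x)"
  by (auto simp: frechet_derivative_works)

text \<open>Lets a derivative found by differentiation rules stand in for the chosen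
  \<open>frechet_derivative\<close>.\<close>

lemma Ck_on_SucI:
  assumes "open S" "\<And>x. x \<in> S \<Longrightarrow> (f has_derivative f' x) (at x)" "\<And>v. Ck_on k S (\<lambda>x. f' x v)"
  shows "Ck_on (Suc k) S f"
proof -
  have "f' x v = frechet_derivative f (at x) v" if "x \<in> S" for x v
    using frechet_derivative_at [OF assms(2) [OF that]] by simp
  then have "Ck_on k S (\<lambda>x. frechet_derivative f (at x) v)" for v
    by (rule Ck_on_cong [OF assms(1) _ assms(3)])
  moreover have "f differentiable (at x)" if "x \<in> S" for x
    using assms(2) [OF that] by (rule differentiableI)
  ultimately show ?thesis by simp
qed

lemma Ck_on_const: "open S \<Longrightarrow> Ck_on k S (\<lambda>x. c)"
proof (induction k arbitrary: c)
  case (Suc k)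
  show ?case by (rule Ck_on_SucI [OF Suc.prems has_derivative_const]) (rule Suc.IH [OF Suc.prems])
qed simp

lemma Ck_on_bounded_linear:
  assumes "bounded_linear L" "open S"
  shows "Ck_on k S f \<Longrightarrow> Ck_on k S (\<lambda>x. L (f x))"
proof (induction k arbitrary: f)
  case 0
  then show ?case unfolding Ck_on.simps by (rule bounded_linear.continuous_on [OF assms(1)])
next
  case (Suc k)
  show ?case
    by (rule Ck_on_SucI [OF assms(2) bounded_linear.has_derivative [OF assms(1) Ck_on_has_derivative [OF Suc.prems]]])
       (assumption, rule Suc.IH, use Suc.prems in simp)
qed

lemma Ck_on_add:
  assumes "open S"
  shows "Ck_on k S f \<Longrightarrow> Ck_on k S g \<Longrightarrow> Ck_on k S (\<lambda>x. f x + g x)"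
proof (induction k arbitrary: f g)
  case 0
  then show ?case unfolding Ck_on.simps by (rule continuous_on_add)
next
  case (Suc k)
  show ?case
    by (rule Ck_on_SucI [OF assms has_derivative_add [OF Ck_on_has_derivative [OF Suc.prems(1)] Ck_on_has_derivative [OF Suc.prems(2)]]])
       (assumption, assumption, rule Suc.IH, use Suc.prems in simp_all)
qed

lemma Ck_on_sum:
  assumes "open S" "\<And>i. i \<in> I \<Longrightarrow> Ck_on k S (f i)"
  shows "Ck_on k S (\<lambda>x. \<Sum>i\<in>I. f i x)"
  using assms(2)
proof (induction I rule: infinite_finite_induct)
  case (insert i I)
  have "Ck_on k S (f i)" "Ck_on k S (\<lambda>x. \<Sum> i\<in>I. f i x)" using insert by blast+
  from Ck_on_add [OF assms(1) this] insert.hyps show ?case by simp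
qed (simp_all add: Ck_on_const assms(1))

lemma Ck_on_bilinear:
  assumes B: "bounded_bilinear B" and S: "open S"
  shows "Ck_on k S f \<Longrightarrow> Ck_on k S g \<Longrightarrow> Ck_on k S (\<lambda>x. B (f x) (g x))"
proof (induction k arbitrary: f g)
  case 0
  then show ?case unfolding Ck_on.simps by (rule bounded_bilinear.continuous_on [OF B])
next
  case (Suc k)
  have f': "Ck_on k S (\<lambda>x. frechet_derivative f (at x) v)" and g': "Ck_on k S (\<lambda>x. frechet_derivative g (at x) v)" for v
    using Suc.prems by simp_all
  have C: "Ck_on k S (\<lambda>x. B (f x) (frechet_derivative g (at x) v) + B (frechet_derivative f (at x) v) (g x))" for v
    by (rule Ck_on_add [OF S Suc.IH [OF Ck_on_Suc_imp [OF Suc.prems(1)] g'] Suc.IH [OF f' Ck_on_Suc_imp [OF Suc.prems(2)]]])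
  have D: "((\<lambda>x. B (f x) (g x)) has_derivative
      (\<lambda>v. B (f x) (frechet_derivative g (at x) v) + B (frechet_derivative f (at x) v) (g x))) (at x)" if "x \<in> S" for x
    by (rule bounded_bilinear.FDERIV [OF B Ck_on_has_derivative [OF Suc.prems(1) that] Ck_on_has_derivative [OF Suc.prems(2) that]])
  show ?case by (rule Ck_on_SucI [OF S D C])
qed

lemmas Ck_on_mult = Ck_on_bilinear [OF bounded_bilinear_mult]

lemma Ck_on_prod:
  fixes f :: "_ \<Rightarrow> _ \<Rightarrow> complex"
  assumes "open S" "\<And>i. i \<in> I \<Longrightarrow> Ck_on k S (f i)"
  shows "Ck_on k S (\<lambda>x. \<Prod>i\<in>I. f i x)"
  using assms(2)
proof (induction I rule: infinite_finite_induct)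
  case (insert i I)
  have "Ck_on k S (f i)" "Ck_on k S (\<lambda>x. \<Prod> i\<in>I. f i x)" using insert by blast+
  from Ck_on_mult [OF assms(1) this] insert.hyps show ?case by simp
qed (simp_all add: Ck_on_const assms(1))

lemma Ck_on_inverse:
  fixes f :: "_ \<Rightarrow> complex"
  assumes S: "open S" and nz: "\<And>x. x \<in> S \<Longrightarrow> f x \<noteq> 0"
  shows "Ck_on k S f \<Longrightarrow> Ck_on k S (\<lambda>x. inverse (f x))"
proof (induction k)
  case 0
  then show ?case unfolding Ck_on.simps using nz by (intro continuous_on_inverse) auto
next
  case (Suc k)
  have i: "Ck_on k S (\<lambda>x. inverse (f x))" using Suc.IH Ck_on_Suc_imp [OF Suc.prems] .
  have f': "Ck_on k S (\<lambda>x. frechet_derivative f (at x) v)" for v using Suc.prems by simp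
  have "Ck_on k S (\<lambda>x. (-1) * (inverse (f x) * frechet_derivative f (at x) v * inverse (f x)))" for v
    by (intro Ck_on_mult S i Ck_on_const f')
  then have C: "Ck_on k S (\<lambda>x. - (inverse (f x) * frechet_derivative f (at x) v * inverse (f x)))" for v
    by simp
  have D: "((\<lambda>x. inverse (f x)) has_derivative
      (\<lambda>v. - (inverse (f x) * frechet_derivative f (at x) v * inverse (f x)))) (at x)" if "x \<in> S" for x
    by (rule Deriv.has_derivative_inverse [OF nz [OF that] Ck_on_has_derivative [OF Suc.prems that]])
  show ?case by (rule Ck_on_SucI [OF S D C])
qed

lemma Ck_on_compose:
  fixes f :: "'a::real_normed_vector \<Rightarrow> 'b::euclidean_space"
  assumes S: "open S" and T: "open T" "f ` S \<subseteq> T"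
  shows "Ck_on k S f \<Longrightarrow> Ck_on k T g \<Longrightarrow> Ck_on k S (\<lambda>x. g (f x))"
proof (induction k arbitrary: g)
  case 0
  then show ?case using T continuous_on_compose2 [of T g S f] by simp
next
  case (Suc k)
  let ?d = "\<lambda>x v. \<Sum>b\<in>Basis. (frechet_derivative f (at x) v \<bullet> b) *\<^sub>R frechet_derivative g (at (f x)) b"
  have f': "Ck_on k S (\<lambda>x. frechet_derivative f (at x) v)" and g': "Ck_on k T (\<lambda>x. frechet_derivative g (at x) w)" for v w
    using Suc.prems by simp_all
  have "Ck_on k S (\<lambda>x. ?d x v)" for v
    by (intro Ck_on_sum S Ck_on_bilinear [OF bounded_bilinear_scaleR]
          Ck_on_bounded_linear [OF bounded_linear_inner_left] f')
       (rule Suc.IH [OF Ck_on_Suc_imp [OF Suc.prems(1)] g'])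
  moreover have "((\<lambda>x. g (f x)) has_derivative ?d x) (at x)" if x: "x \<in> S" for x
  proof -
    have g: "(g has_derivative frechet_derivative g (at (f x))) (at (f x))"
      using Ck_on_has_derivative [OF Suc.prems(2)] T x by blast
    note l = has_derivative_linear [OF g]
    have "frechet_derivative g (at (f x)) w = (\<Sum>b\<in>Basis. (w \<bullet> b) *\<^sub>R frechet_derivative g (at (f x)) b)" for w
      by (subst euclidean_representation [of w, symmetric]) (simp add: linear_sum [OF l] linear_scale [OF l])
    then have "?d x = (\<lambda>v. frechet_derivative g (at (f x)) (frechet_derivative f (at x) v))"
      by (intro ext) (rule sym)
    then show ?thesis
      using has_derivative_compose [OF Ck_on_has_derivative [OF Suc.prems(1) x] g] by (simp only:)
  qed
  ultimately show ?case by (rule Ck_on_SucI [OF S, rotated])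
qed

lemma bounded_linear_axis: "bounded_linear (\<lambda>c::complex. axis i c :: complex ^ 'n::finite)"
  by (rule linear_conv_bounded_linear [THEN iffD1], rule linearI) (auto simp: vec_eq_iff axis_def)

lemma Ck_on_vec:
  fixes f :: "'a::real_normed_vector \<Rightarrow> complex ^ 'n::finite"
  assumes "open S" "\<And>i. Ck_on k S (\<lambda>x. f x $ i)"
  shows "Ck_on k S f"
proof (rule Ck_on_cong [OF assms(1)])
  show "Ck_on k S (\<lambda>x. \<Sum>i\<in>UNIV. axis i (f x $ i))"
    by (intro Ck_on_sum assms(1) Ck_on_bounded_linear [OF bounded_linear_axis] assms(2))
  show "(\<Sum>i\<in>UNIV. axis i (f x $ i)) = f x" for x
    by (simp add: vec_eq_iff axis_def)
qed

lemma Ck_on_vec_nth: "open S \<Longrightarrow> Ck_on k S f \<Longrightarrow> Ck_on k S (\<lambda>x. f x $ i)"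
  by (rule Ck_on_bounded_linear [OF bounded_linear_vec_nth])

lemma Ck_on_det:
  fixes M :: "'a::real_normed_vector \<Rightarrow> complex ^ 'n ^ 'n::finite"
  assumes "open S" "\<And>i j. Ck_on k S (\<lambda>x. M x $ i $ j)"
  shows "Ck_on k S (\<lambda>x. det (M x))"
  unfolding det_def by (intro Ck_on_sum Ck_on_mult Ck_on_const Ck_on_prod assms)

text \<open>By Cramer's rule the derivative of the inverse \<open>G\<close> is a rational expression in the first
  derivatives of \<open>F\<close> at \<open>G y\<close>. So if \<open>G\<close> is \<open>C\<^sup>k\<close>, its derivative is \<open>C\<^sup>k\<close> and \<open>G\<close> is \<open>C\<^sup>k\<^sup>+\<^sup>1\<close>.\<close>

lemma holo_on_inverse_map:
  fixes F :: "complex ^ 'n::finite \<Rightarrow> complex ^ 'n"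
  assumes U: "open U" and V: "open V" and F: "holo_on U F" and G: "G ` V \<subseteq> U"
    and dG: "\<And>y. y \<in> V \<Longrightarrow> (G has_derivative G' y) (at y)"
    and inv: "\<And>y v. y \<in> V \<Longrightarrow> frechet_derivative F (at (G y)) (G' y v) = v"
  shows "holo_on V G"
proof -
  let ?D = "\<lambda>x. frechet_derivative F (at x)"
  define M where "M x = (\<chi> i j. ?D x (axis j 1) $ i)" for x
  have cl: "complex_linear (?D x)" if "x \<in> U" for x
  proof -
    have "Ck_on (Suc 0) U F" using F unfolding holo_on_def smooth_on_def by blast
    from has_derivative_linear [OF Ck_on_has_derivative [OF this that]] show ?thesis
      using F that by (auto simp: complex_linear_def holo_on_def linear_add)
  qed
  have M: "M x *v v = ?D x v" if "x \<in> U" for x v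
    unfolding vec_eq_iff complex_linear_axis [OF cl [OF that], of v]
    by (simp add: M_def matrix_vector_mult_def)
  have MG: "M (G y) *v G' y v = v" if "y \<in> V" for y v
    using M [of "G y"] G inv that by auto
  have det: "det (M (G y)) \<noteq> 0" if "y \<in> V" for y
  proof -
    have "surj ((*v) (M (G y)))" using MG [OF that] by (metis surjI)
    then show ?thesis
      by (simp add: matrix_right_invertible_surjective [symmetric] invertible_det_nz [symmetric] invertible_right_inverse)
  qed
  have G': "G' y v = (\<chi> k. det (\<chi> i j. if j = k then v $ i else M (G y) $ i $ j) / det (M (G y)))"
    if "y \<in> V" for y v
    using cramer [OF det [OF that], of "G' y v" v] MG [OF that] by simp
  have "Ck_on k V G" for k
  proof (induction k)
    case 0
    then show ?case
      using dG by (auto intro!: continuous_at_imp_continuous_on has_derivative_continuous)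
  next
    case (Suc k)
    have smM: "Ck_on k U (\<lambda>x. M x $ i $ j)" for i j
    proof -
      have "Ck_on (Suc k) U F" using F unfolding holo_on_def smooth_on_def by blast
      then have "Ck_on k U (\<lambda>x. frechet_derivative F (at x) (axis j 1))" by simp
      from Ck_on_vec_nth [OF U this] show ?thesis by (simp add: M_def)
    qed
    have MGs: "Ck_on k V (\<lambda>y. M (G y) $ i $ j)" for i j
      by (rule Ck_on_compose [OF V U G Suc.IH smM])
    have "Ck_on k V (\<lambda>y. G' y v)" for v
    proof (rule Ck_on_vec [OF V], rule Ck_on_cong [OF V])
      fix m
      show "Ck_on k V (\<lambda>y. det (\<chi> i j. if j = m then v $ i else M (G y) $ i $ j) * inverse (det (M (G y))))"
      proof (intro Ck_on_mult Ck_on_inverse Ck_on_det V MGs det)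
        fix i j
        show "Ck_on k V (\<lambda>y. (\<chi> i j. if j = m then v $ i else M (G y) $ i $ j) $ i $ j)"
          by (cases "j = m") (simp_all add: Ck_on_const V MGs)
      qed
      show "det (\<chi> i j. if j = m then v $ i else M (G y) $ i $ j) * inverse (det (M (G y))) = G' y v $ m" if "y \<in> V" for y
        by (subst G' [OF that]) (simp add: divide_inverse)
    qed
    with dG show ?case by (rule Ck_on_SucI [OF V])
  qed
  moreover have "frechet_derivative G (at y) (c *s v) = c *s frechet_derivative G (at y) v" if y: "y \<in> V" for y c v
  proof -
    obtain N where N: "N ** M (G y) = mat 1"
      using det [OF y] by (auto simp: invertible_det_nz [symmetric] invertible_def)
    have "M (G y) *v G' y (c *s v) = M (G y) *v (c *s G' y v)"
      using MG [OF y] by (simp add: vector_scalar_commute)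
    then have "N *v (M (G y) *v G' y (c *s v)) = N *v (M (G y) *v (c *s G' y v))" by simp
    then have "G' y (c *s v) = c *s G' y v" by (simp add: matrix_vector_mul_assoc N)
    then show ?thesis
      unfolding frechet_derivative_at [OF dG [OF that], symmetric] .
  qed
  ultimately show ?thesis unfolding holo_on_def smooth_on_def by blast
qed

lemma holo_on_compose:
  assumes S: "open S" and T: "open T" "f ` S \<subseteq> T" and f: "holo_on S f" and g: "holo_on T g"
  shows "holo_on S (g \<circ> f)"
proof -
  have "Ck_on k S (g \<circ> f)" for k
    using Ck_on_compose [OF S T, of k g] f g unfolding holo_on_def smooth_on_def o_def by blast
  moreover have "frechet_derivative (g \<circ> f) (at x) (c *s v) = c *s frechet_derivative (g \<circ> f) (at x) v"
    if x: "x \<in> S" for x c v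
  proof -
    have "Ck_on (Suc 0) S f" "Ck_on (Suc 0) T g" using f g unfolding holo_on_def smooth_on_def by blast+
    then have "(f has_derivative frechet_derivative f (at x)) (at x)"
       "(g has_derivative frechet_derivative g (at (f x))) (at (f x))"
      using Ck_on_has_derivative x T(2) by blast+
    from diff_chain_at [OF this] have "frechet_derivative (g \<circ> f) (at x) = frechet_derivative g (at (f x)) \<circ> frechet_derivative f (at x)"
      using frechet_derivative_at by metis
    moreover have "f x \<in> T" using x T(2) by blast
    ultimately show ?thesis using f g x unfolding holo_on_def o_def by simp
  qed
  ultimately show ?thesis unfolding holo_on_def smooth_on_def by blast
qed

section \<open>Unitary frames\<close>

definition hermitian :: "('n::finite \<Rightarrow> 'n \<Rightarrow> complex) \<Rightarrow> bool" where
  "hermitian h \<longleftrightarrow> (\<forall>i j. h j i = cnj (h i j))"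

lemma sesq_hermitian:
  assumes "hermitian h" shows "sesq h w v = cnj (sesq h v w)"
proof -
  have c: "cnj (h i j) = h j i" for i j using assms [unfolded hermitian_def, rule_format, of j i] by (rule sym)
  have "cnj (sesq h v w) = (\<Sum>i\<in>UNIV. \<Sum>j\<in>UNIV. h j i * w $ j * cnj (v $ i))"
    by (simp add: sesq_def c mult_ac)
  also have "\<dots> = sesq h w v" unfolding sesq_def by (rule sum.swap)
  finally show ?thesis ..
qed

definition kronecker :: "'n \<Rightarrow> 'n \<Rightarrow> complex" where
  "kronecker i j = (if i = j then 1 else 0)"

lemma sesq_kronecker: "sesq kronecker v w = (\<Sum>i\<in>UNIV. v $ i * cnj (w $ i))"
proof -
  have "(\<Sum>j\<in>UNIV. kronecker i j * v $ i * cnj (w $ j)) = v $ i * cnj (w $ i)" for i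
  proof -
    have "kronecker i j * v $ i * cnj (w $ j) = (if j = i then v $ i * cnj (w $ i) else 0)" for j
      by (simp add: kronecker_def)
    then show ?thesis by simp
  qed
  then show ?thesis by (simp add: sesq_def)
qed

lemma sum_kronecker: "(\<Sum>j\<in>UNIV. t j * kronecker j l) = (t (l :: 'n::finite) :: complex)"
proof -
  have "t j * kronecker j l = (if j = l then t l else 0)" for j by (simp add: kronecker_def)
  then show ?thesis by simp
qed

lemma sesq_zero [simp]: "sesq h 0 w = 0" "sesq h w 0 = 0"
  by (simp_all add: sesq_def)

lemma sesq_sum_left: "sesq h (\<Sum>p\<in>P. c p *s e p) w = (\<Sum>p\<in>P. c p * sesq h (e p) w)"
  by (induction P rule: infinite_finite_induct) simp_all

lemma sesq_sum_right: "sesq h w (\<Sum>p\<in>P. c p *s e p) = (\<Sum>p\<in>P. cnj (c p) * sesq h w (e p))"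
  by (induction P rule: infinite_finite_induct) simp_all

text \<open>Orthogonality to fewer than \<open>n\<close> vectors is a system with a singular matrix.\<close>

lemma exists_orthogonal:
  fixes e :: "'n::finite \<Rightarrow> complex ^ 'n"
  assumes "S \<noteq> UNIV"
  shows "\<exists>v. v \<noteq> 0 \<and> (\<forall>p\<in>S. sesq h v (e p) = 0)"
proof -
  obtain q where q: "q \<notin> S" using assms by blast
  define B :: "complex ^ 'n ^ 'n" where "B = (\<chi> p m. if p \<in> S then sesq h (axis m 1) (e p) else 0)"
  \<comment> \<open>The row with an index outside \<open>S\<close> is left empty, so the system is singular.\<close>
  have "row q B = 0" using q by (simp add: row_def B_def vec_eq_iff)
  then have "det B = 0" by (rule det_zero_row(2))
  then have "\<not> (\<exists>C. C ** B = mat 1)"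
    by (simp add: invertible_left_inverse [symmetric] invertible_det_nz)
  then obtain v where v: "B *v v = 0" "v \<noteq> 0"
    unfolding matrix_left_invertible_ker by blast
  have "sesq h v (e p) = 0" if "p \<in> S" for p
  proof -
    have "sesq h v (e p) = (\<Sum>m\<in>UNIV. v $ m * sesq h (axis m 1) (e p))"
      by (subst basis_expansion [of v, symmetric]) (rule sesq_sum_left)
    also have "\<dots> = (B *v v) $ p" using that by (simp add: B_def matrix_vector_mult_def mult.commute)
    finally show ?thesis by (simp add: v)
  qed
  with v show ?thesis by blast
qed

text \<open>The Gram-Schmidt process, one index at a time.\<close>

lemma orthonormal_family:
  fixes h :: "'n::finite \<Rightarrow> 'n \<Rightarrow> complex"
  assumes "hermitian h" "positive_definite h"
  shows "\<exists>e :: 'n \<Rightarrow> complex ^ 'n. \<forall>p\<in>S. \<forall>q\<in>S. sesq h (e p) (e q) = kronecker p q"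
proof (induction S rule: infinite_finite_induct)
  case (infinite S)
  then show ?case by simp
next
  case empty
  then show ?case by simp
next
  case (insert s S)
  then obtain e where e: "\<And>p q. p \<in> S \<Longrightarrow> q \<in> S \<Longrightarrow> sesq h (e p) (e q) = kronecker p q" by blast
  obtain v where v: "v \<noteq> 0" "\<And>p. p \<in> S \<Longrightarrow> sesq h v (e p) = 0"
    using exists_orthogonal [of S h e] insert.hyps by blast
  have v': "sesq h (e p) v = 0" if "p \<in> S" for p
    using v(2) [OF that] sesq_hermitian [OF assms(1), of "e p" v] by simp
  define r where "r = Re (sesq h v v)"
  have r: "r > 0" using assms(2) v(1) by (simp add: positive_definite_def r_def)
  have vv: "sesq h v v = of_real r"
    using sesq_hermitian [OF assms(1), of v v] by (simp add: r_def complex_eq_iff)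
  define w where "w = of_real (1 / sqrt r) *s v"
  have "sesq h w w = of_real ((1 / sqrt r) * (1 / sqrt r) * r)"
    by (simp only: w_def sesq_linear vv complex_cnj_complex_of_real of_real_mult mult.assoc)
  also have "(1 / sqrt r) * (1 / sqrt r) * r = 1" using r by (simp add: field_simps)
  finally have ww: "sesq h w w = 1" by simp
  have "sesq h ((e(s := w)) p) ((e(s := w)) q) = kronecker p q" if "p \<in> insert s S" "q \<in> insert s S" for p q
    using that insert.hyps(2) e ww v(2) v' by (auto simp: kronecker_def w_def)
  then show ?case by blast
qed

text \<open>\<open>E\<close> has an orthonormal basis for \<open>h\<close> as its columns, and \<open>L\<close> gives the coordinates in this
  basis.\<close>

lemma unitary_frame:
  fixes h :: "'n::finite \<Rightarrow> 'n \<Rightarrow> complex"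
  assumes "hermitian h" "positive_definite h"
  obtains L E :: "complex ^ 'n ^ 'n" where "L ** E = mat 1" "E ** L = mat 1"
    "\<And>v w. sesq h v w = sesq kronecker (L *v v) (L *v w)"
proof -
  obtain e :: "'n \<Rightarrow> complex ^ 'n" where e: "\<And>p q. sesq h (e p) (e q) = kronecker p q"
    using orthonormal_family [OF assms, of UNIV] by auto
  define E :: "complex ^ 'n ^ 'n" where "E = (\<chi> i p. e p $ i)"
  have E: "E *v c = (\<Sum>p\<in>UNIV. c $ p *s e p)" for c
    by (simp add: E_def matrix_vector_mult_def vec_eq_iff mult.commute)
  have EE: "sesq h (E *v c) (E *v d) = sesq kronecker c d" for c d
    unfolding E sesq_sum_left sesq_sum_right e by (simp add: sesq_def [of kronecker] sum_distrib_left mult_ac) (rule sum.swap)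
  have "c = 0" if "E *v c = 0" for c
  proof -
    have "c $ q = sesq kronecker c (axis q 1)" for q
    proof -
      have "c $ i * cnj (axis q 1 $ i) = (if i = q then c $ q else 0)" for i by (simp add: axis_def)
      then show ?thesis by (simp add: sesq_kronecker)
    qed
    also have "sesq kronecker c (axis q 1) = 0" for q using EE [of c "axis q 1"] that by simp
    finally show ?thesis by (simp add: vec_eq_iff)
  qed
  then obtain L where L: "L ** E = mat 1"
    using matrix_left_invertible_ker [of E] by blast
  then have L': "E ** L = mat 1" by (simp add: matrix_left_right_inverse)
  have "sesq h v w = sesq kronecker (L *v v) (L *v w)" for v w
    using EE [of "L *v v" "L *v w"] by (simp add: matrix_vector_mul_assoc L')
  with L L' that show ?thesis by blast
qed

section \<open>Closedness of the Kaehler form\<close>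

lemma form11_antisym: "form11 h [w, v] = - form11 h [v, w]"
  by (simp add: form11_def algebra_simps)

lemma d_dzbar_cong:
  assumes "open S" "x \<in> S" "\<And>y. y \<in> S \<Longrightarrow> f y = g y"
  shows "d_dzbar k f x = d_dzbar k g x"
  using frechet_derivative_cong [of S x f g] assms by (simp add: d_dzbar_def)

lemma exterior_derivative_form11:
  assumes S: "open S" "x \<in> S" and \<eta>: "\<And>y. y \<in> S \<Longrightarrow> \<eta> y = form11 (h y)"
    and h: "\<And>i j. ((\<lambda>y. h y i j) has_derivative h' i j) (at x)"
  shows "del_loc \<eta> x [u, v, w] + delbar_loc \<eta> x [u, v, w] =
    form11 (\<lambda>i j. h' i j u) [v, w] - form11 (\<lambda>i j. h' i j v) [u, w] + form11 (\<lambda>i j. h' i j w) [u, v]"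
proof -
  let ?f = "\<lambda>v w y. form11 (h y) [v, w]"
  have D: "(?f v w has_derivative (\<lambda>u. form11 (\<lambda>i j. h' i j u) [v, w])) (at x)" for v w
    by (rule form11_has_derivative [OF h])
  have anti: "d_dz k (?f w v) x = - d_dz k (?f v w) x" "d_dzbar k (?f w v) x = - d_dzbar k (?f v w) x" for k v w
    unfolding d_dz_eq [OF D] d_dzbar_eq [OF D] by (simp_all add: form11_antisym [of _ w v] algebra_simps diff_divide_distrib add_divide_distrib)
  have z: "d_dz k (\<lambda>y. form11 (h y) ws) x = 0" "d_dzbar k (\<lambda>y. form11 (h y) ws) x = 0" if "length ws \<noteq> 2" for k ws
    using that by (simp_all add: form_eq_0_length d_dz_eq [OF has_derivative_const] d_dzbar_eq [OF has_derivative_const])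
  have e: "(\<lambda>ws. d_dz k (\<lambda>y. \<eta> y ws) x) = (\<lambda>ws. d_dz k (\<lambda>y. form11 (h y) ws) x)"
     "(\<lambda>ws. d_dzbar k (\<lambda>y. \<eta> y ws) x) = (\<lambda>ws. d_dzbar k (\<lambda>y. form11 (h y) ws) x)" for k
    by (rule ext, rule d_dz_cong [OF S], simp only: \<eta>) (rule ext, rule d_dzbar_cong [OF S], simp only: \<eta>)
  have 1: "wedge 1 (dz k) (\<lambda>ws. d_dz k (\<lambda>y. form11 (h y) ws) x) [u, v, w] =
       u $ k * d_dz k (?f v w) x - v $ k * d_dz k (?f u w) x + w $ k * d_dz k (?f u v) x" for k
    by (rule wedge_degree_1_2 [THEN trans], erule form_eq_0_length(5), erule z(1), rule anti(1)) (simp add: dz_def)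
  have 2: "wedge 1 (dzbar k) (\<lambda>ws. d_dzbar k (\<lambda>y. form11 (h y) ws) x) [u, v, w] =
       cnj (u $ k) * d_dzbar k (?f v w) x - cnj (v $ k) * d_dzbar k (?f u w) x + cnj (w $ k) * d_dzbar k (?f u v) x" for k
    by (rule wedge_degree_1_2 [THEN trans], erule form_eq_0_length(6), erule z(2), rule anti(2)) (simp add: dzbar_def)
  show ?thesis
    unfolding del_loc_def delbar_loc_def e 1 2 sum.distrib sum_subtractf sum_d_dz [OF D] sum_d_dzbar [OF D]
    by (simp add: field_simps)
qed

text \<open>Only one pair of terms of \<open>d\<omega>(u, v, w)\<close> has a component that is complex linear in both
  \<open>u\<close> and \<open>v\<close>; this \<open>(2,1)\<close>-part has to vanish by itself.\<close>

lemma closed_imp_symmetric: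
  assumes closed: "\<And>u v w. form11 (\<lambda>i j. h' i j u) [v, w] - form11 (\<lambda>i j. h' i j v) [u, w] + form11 (\<lambda>i j. h' i j w) [u, v] = 0"
    and h: "\<And>i j. ((\<lambda>y. h y i j) has_derivative h' i j) (at x)"
  shows "tri21 (\<lambda>k i j. d_dz k (\<lambda>y. h y i j) x) u v w = tri21 (\<lambda>k i j. d_dz k (\<lambda>y. h y i j) x) v u w"
proof -
  define s where "s u = sesq (\<lambda>i j. h' i j u)" for u
  have mi: "(\<lambda>i j. h' i j (\<i> *s (\<i> *s u))) = (\<lambda>i j. - h' i j u)" for u
  proof -
    have "\<i> *s (\<i> *s u) = - u" by (simp add: vec_eq_iff)
    then show ?thesis using linear_neg [OF has_derivative_linear [OF h]] by simp
  qed
  have sl: "s u (c *s v) w = c * s u v w" "s u v (c *s w) = cnj c * s u v w" for u v w c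
    by (simp_all add: s_def)
  have smi: "s (\<i> *s (\<i> *s u)) v w = - s u v w" for u v w
    unfolding s_def mi by (simp add: sesq_def sum_negf)
  define Z where "Z u v w = s u v w - s u w v - (s v u w - s v w u) + (s w u v - s w v u)" for u v w
  have Z: "Z u v w = 0" for u v w
  proof -
    have "\<i> / 2 * Z u v w = 0" using closed [of u v w] by (simp add: form11_def Z_def s_def algebra_simps)
    then show ?thesis by simp
  qed
  \<comment> \<open>This combination projects to the part of \<open>Z\<close> that is complex linear in \<open>u\<close> and in \<open>v\<close>.\<close>
  have "2 * (s u v w - \<i> * s (\<i> *s u) v w) - 2 * (s v u w - \<i> * s (\<i> *s v) u w)
     = Z u v w - \<i> * Z (\<i> *s u) v w - \<i> * Z u (\<i> *s v) w - Z (\<i> *s u) (\<i> *s v) w"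
    by (simp add: Z_def sl algebra_simps)
  then have "2 * ((s u v w - \<i> * s (\<i> *s u) v w) - (s v u w - \<i> * s (\<i> *s v) u w)) = 0"
    unfolding Z by (simp add: algebra_simps)
  then have "s u v w - \<i> * s (\<i> *s u) v w = s v u w - \<i> * s (\<i> *s v) u w"
    unfolding mult_eq_0_iff right_minus_eq by simp
  then show ?thesis by (simp add: tri21_d_dz [OF h] s_def)
qed

section \<open>The quadratic change of coordinates\<close>

lemma has_derivative_vecI:
  fixes f :: "'a::real_normed_vector \<Rightarrow> complex ^ 'n::finite"
  assumes "\<And>i. ((\<lambda>y. f y $ i) has_derivative (\<lambda>u. f' u $ i)) F"
  shows "(f has_derivative f') F"
proof -
  have e: "(\<Sum>i\<in>UNIV. axis i (z $ i)) = z" for z :: "complex ^ 'n"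
    by (simp add: vec_eq_iff axis_def)
  have "((\<lambda>y. \<Sum>i\<in>UNIV. axis i (f y $ i)) has_derivative (\<lambda>u. \<Sum>i\<in>UNIV. axis i (f' u $ i))) F"
    by (intro has_derivative_sum bounded_linear.has_derivative [OF bounded_linear_axis] assms)
  then show ?thesis by (simp only: e)
qed

lemma tri21_has_derivative:
  assumes f: "(f has_derivative f') (at x)" and g: "(g has_derivative g') (at x)"
  shows "((\<lambda>y. tri21 C (f y) (g y) w) has_derivative (\<lambda>u. tri21 C (f' u) (g x) w + tri21 C (f x) (g' u) w)) (at x)"
proof -
  have 1: "((\<lambda>y. f y $ i) has_derivative (\<lambda>u. f' u $ i)) (at x)" for i
    using bounded_linear.has_derivative [OF bounded_linear_vec_nth f] by simp
  have 2: "((\<lambda>y. g y $ i) has_derivative (\<lambda>u. g' u $ i)) (at x)" for i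
    using bounded_linear.has_derivative [OF bounded_linear_vec_nth g] by simp
  show ?thesis unfolding tri21_def
    by (rule has_derivative_eq_rhs [OF has_derivative_sum [OF has_derivative_sum [OF has_derivative_sum
        [OF has_derivative_mult_left [OF has_derivative_mult [OF has_derivative_mult_right [OF 1] 2]]]]]])
       (simp add: fun_eq_iff algebra_simps sum.distrib)
qed

text \<open>The map \<open>y \<mapsto> L (y - x) + T(y - x, y - x)/2\<close> with \<open>T(u, v)\<^sub>p = tri21 C u v (E e\<^sub>p)\<close>. If the
  columns of \<open>E\<close> are an orthonormal basis for a hermitian form, \<open>T\<close> is \<open>tri21 C\<close> with its last, antilinear
  argument dualised by that form.\<close>

definition quad_map :: "complex ^ 'n ^ 'n \<Rightarrow> ('n::finite \<Rightarrow> 'n \<Rightarrow> 'n \<Rightarrow> complex) \<Rightarrow> complex ^ 'n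
    \<Rightarrow> complex ^ 'n ^ 'n \<Rightarrow> complex ^ 'n \<Rightarrow> complex ^ 'n" where
  "quad_map L C x E y = L *v (y - x) + (\<chi> p. 1 / 2 * tri21 C (y - x) (y - x) (E *v axis p 1))"

text \<open>The derivative of \<open>quad_map\<close> at \<open>y\<close> if \<open>tri21 C\<close> is symmetric in its first two
  arguments.\<close>

definition quad_deriv :: "complex ^ 'n ^ 'n \<Rightarrow> ('n::finite \<Rightarrow> 'n \<Rightarrow> 'n \<Rightarrow> complex) \<Rightarrow> complex ^ 'n
    \<Rightarrow> complex ^ 'n ^ 'n \<Rightarrow> complex ^ 'n \<Rightarrow> complex ^ 'n \<Rightarrow> complex ^ 'n" where
  "quad_deriv L C x E y v = L *v v + (\<chi> p. tri21 C (y - x) v (E *v axis p 1))"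

lemma tri21_zero [simp]: "tri21 C 0 v w = 0" "tri21 C v 0 w = 0"
  by (simp_all add: tri21_def)

lemma complex_linear_quad_deriv: "complex_linear (quad_deriv L C x E y)"
  unfolding complex_linear_def quad_deriv_def
  by (auto simp: vec_eq_iff matrix_vector_right_distrib vector_scalar_commute [symmetric] algebra_simps)

lemma complex_linear_imp_bounded_linear:
  fixes D :: "complex ^ 'n::finite \<Rightarrow> complex ^ 'n"
  assumes "complex_linear D" shows "bounded_linear D"
proof (rule linear_conv_bounded_linear [THEN iffD1], rule linearI)
  have "r *\<^sub>R v = of_real r *s v" for r and v :: "complex ^ 'n" by (auto simp: vec_eq_iff complex_eq_iff)
  then show "D (r *\<^sub>R v) = r *\<^sub>R D v" for r v using assms by (simp add: complex_linear_def)
  show "D (u + v) = D u + D v" for u v using assms by (simp add: complex_linear_def)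
qed

lemma quad_map_has_derivative:
  assumes sym: "\<And>u v w. tri21 C u v w = tri21 C v u w"
  shows "(quad_map L C x E has_derivative quad_deriv L C x E y) (at y)"
proof (rule has_derivative_vecI)
  fix i
  have d: "((\<lambda>y. y - x) has_derivative (\<lambda>u. u)) (at y)"
    by (auto intro!: derivative_eq_intros)
  have L: "((\<lambda>y. (L *v (y - x)) $ i) has_derivative (\<lambda>u. (L *v u) $ i)) (at y)"
  proof -
    have "complex_linear ((*v) L)" by (auto simp: complex_linear_def matrix_vector_right_distrib vector_scalar_commute)
    then have "bounded_linear (\<lambda>v. (L *v v) $ i)"
      using bounded_linear_compose [OF bounded_linear_vec_nth complex_linear_imp_bounded_linear] by blast
    from bounded_linear.has_derivative [OF this d] show ?thesis .
  qed
  have "((\<lambda>y. 1 / 2 * tri21 C (y - x) (y - x) (E *v axis i 1)) has_derivative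
      (\<lambda>u. 1 / 2 * (tri21 C u (y - x) (E *v axis i 1) + tri21 C (y - x) u (E *v axis i 1)))) (at y)"
    by (rule has_derivative_mult_right [OF tri21_has_derivative [OF d d]])
  then have "((\<lambda>y. 1 / 2 * tri21 C (y - x) (y - x) (E *v axis i 1)) has_derivative
      (\<lambda>u. tri21 C (y - x) u (E *v axis i 1))) (at y)"
    by (rule has_derivative_eq_rhs) (simp add: fun_eq_iff sym [of _ "y - x"])
  from has_derivative_add [OF L this]
  show "((\<lambda>y. quad_map L C x E y $ i) has_derivative (\<lambda>u. quad_deriv L C x E y u $ i)) (at y)"
    by (simp add: quad_map_def quad_deriv_def)
qed

lemma Ck_on_id: "open S \<Longrightarrow> Ck_on k S (\<lambda>y. y)"
proof (induction k)
  case (Suc k)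
  show ?case by (rule Ck_on_SucI [OF Suc.prems has_derivative_ident]) (rule Ck_on_const [OF Suc.prems])
qed simp

lemma quad_map_holo:
  assumes sym: "\<And>u v w. tri21 C u v w = tri21 C v u w" and S: "open S"
  shows "holo_on S (quad_map L C x E)"
proof -
  have "Ck_on k S (quad_map L C x E)" for k
  proof (rule Ck_on_vec [OF S])
    fix i
    have m: "Ck_on k S (\<lambda>y. (y - x) $ m)" for m
    proof -
      have "Ck_on k S (\<lambda>y. y $ m + (- (x $ m)))"
        by (intro Ck_on_add S Ck_on_const Ck_on_vec_nth Ck_on_id)
      then show ?thesis by simp
    qed
    have "Ck_on k S (\<lambda>y. (\<Sum>m\<in>UNIV. L $ i $ m * (y - x) $ m) + 1 / 2 * tri21 C (y - x) (y - x) (E *v axis i 1))"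
      unfolding tri21_def by (intro Ck_on_add Ck_on_sum Ck_on_mult Ck_on_const S m)
    then show "Ck_on k S (\<lambda>y. quad_map L C x E y $ i)"
      by (simp add: quad_map_def matrix_vector_mult_def)
  qed
  moreover have "frechet_derivative (quad_map L C x E) (at y) = quad_deriv L C x E y" for y
    using frechet_derivative_at [OF quad_map_has_derivative [OF sym]] by metis
  ultimately show ?thesis
    using complex_linear_quad_deriv unfolding holo_on_def smooth_on_def complex_linear_def by metis
qed

lemma quad_map_local_inverse:
  fixes L E :: "complex ^ 'n::finite ^ 'n"
  assumes sym: "\<And>u v w. tri21 C u v w = tri21 C v u w" and W: "open W" "x \<in> W"
    and LE: "L ** E = mat 1" "E ** L = mat 1"
  obtains U V G where "open U" "U \<subseteq> W" "x \<in> U" "open V" "homeomorphism U V (quad_map L C x E) G"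
    "holo_on U (quad_map L C x E)" "holo_on V G"
proof -
  let ?F = "quad_map L C x E" let ?D = "quad_deriv L C x E"
  have bl: "bounded_linear (?D y)" for y by (rule complex_linear_imp_bounded_linear [OF complex_linear_quad_deriv])
  have app: "blinfun_apply (Blinfun (?D y)) = ?D y" for y by (rule bounded_linear_Blinfun_apply [OF bl])
  have blE: "bounded_linear ((*v) E)"
    by (rule complex_linear_imp_bounded_linear) (auto simp: complex_linear_def matrix_vector_right_distrib vector_scalar_commute)
  have cont: "continuous_on W (\<lambda>y. Blinfun (?D y))"
  proof (rule continuous_on_blinfun_componentwise)
    fix b :: "complex ^ 'n"
    have "continuous_on W (\<lambda>y. ?D y b $ i)" for i
      unfolding quad_deriv_def tri21_def by (auto intro!: continuous_intros)
    then have "continuous_on W (\<lambda>y. \<chi> i. ?D y b $ i)" by (rule continuous_on_vec_lambda)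
    then show "continuous_on W (\<lambda>y. blinfun_apply (Blinfun (?D y)) b)" by (simp add: app)
  qed
  have inv: "Blinfun ((*v) E) o\<^sub>L Blinfun (?D x) = id_blinfun"
  proof (rule blinfun_eqI)
    fix v
    have "(\<chi> p. 0) = (0 :: complex ^ 'n)" by (simp add: vec_eq_iff)
    then show "blinfun_apply (Blinfun ((*v) E) o\<^sub>L Blinfun (?D x)) v = blinfun_apply id_blinfun v"
      by (simp add: app bounded_linear_Blinfun_apply [OF blE] quad_deriv_def matrix_vector_mul_assoc LE)
  qed
  have der: "(?F has_derivative blinfun_apply (Blinfun (?D y))) (at y)" if "y \<in> W" for y
    unfolding app by (rule quad_map_has_derivative [OF sym])
  obtain U V G G' where UV: "open U" "U \<subseteq> W" "x \<in> U" "open V" "?F x \<in> V" "homeomorphism U V ?F G"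
    and G: "\<And>y. y \<in> V \<Longrightarrow> (G has_derivative (G' y)) (at y)"
       "\<And>y. y \<in> V \<Longrightarrow> G' y = Hilbert_Choice.inv (blinfun_apply (Blinfun (?D (G y))))"
       "\<And>y. y \<in> V \<Longrightarrow> bij (blinfun_apply (Blinfun (?D (G y))))"
    using inverse_function_theorem [OF W(1) der cont W(2) inv] by blast
  have hF: "holo_on U ?F" by (rule quad_map_holo [OF sym UV(1)])
  have "frechet_derivative ?F (at y) = ?D y" for y
    using frechet_derivative_at [OF quad_map_has_derivative [OF sym]] by metis
  then have "frechet_derivative ?F (at (G y)) (G' y v) = v" if "y \<in> V" for y v
    using G(2,3) [OF that] by (simp add: app bij_is_surj surj_f_inv_f)
  moreover have "G ` V \<subseteq> U" using UV(6) by (simp add: homeomorphism_def)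
  ultimately have "holo_on V G"
    by (intro holo_on_inverse_map [OF UV(1,4) hF _ G(1)]) auto
  with UV hF that show ?thesis by blast
qed

section \<open>The metric in the new coordinates\<close>

lemma form11_eqI: "(\<And>v w. form11 g [v, w] = form11 h [v, w]) \<Longrightarrow> g = h"
proof -
  assume a: "\<And>v w. form11 g [v, w] = form11 h [v, w]"
  have "form11 g = form11 h"
    using a by (auto simp: fun_eq_iff form11_def split: list.split)
  then show "g = h" by (metis coeffs11_form11)
qed

lemma form11_zero [simp]: "form11 (\<lambda>i j. 0) vs = 0"
  by (simp add: form11_def sesq_def split: list.split)

text \<open>The derivative of \<open>h\<close> at \<open>x\<close> is the sum of \<open>C\<close> and its conjugate, because \<open>h\<close> is hermitian,
  and these are the terms that the second derivative of the coordinate change contributes to the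
  derivative of the pulled back form. Hence nothing is left for the derivative of \<open>g\<close>.\<close>

lemma quad_map_normalises:
  fixes L E :: "complex ^ 'n::finite ^ 'n"
  assumes h: "\<And>i j. ((\<lambda>y. h y i j) has_derivative h' i j) (at x)" and hermitian: "\<And>y. y \<in> U \<Longrightarrow> hermitian (h y)"
    and U: "open U" "x \<in> U"
    and LE: "L ** E = mat 1" "E ** L = mat 1" "\<And>v w. sesq (h x) v w = sesq kronecker (L *v v) (L *v w)"
    and C: "C = (\<lambda>k i j. d_dz k (\<lambda>y. h y i j) x)" and sym: "\<And>u v w. tri21 C u v w = tri21 C v u w"
    and F: "F = quad_map L C x E"
    and g: "\<And>i j. ((\<lambda>y. g y i j) has_derivative g' i j) (at 0)"
    and pull: "\<And>y v w. y \<in> U \<Longrightarrow> form11 (h y) [v, w] = form11 (g (F y)) [quad_deriv L C x E y v, quad_deriv L C x E y w]"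
  shows "g 0 = kronecker" "g' i j = (\<lambda>u. 0)"
proof -
  let ?A = "quad_deriv L C x E"
  have Fx: "F x = 0" by (simp add: F quad_map_def vec_eq_iff)
  have Ax: "?A x v = L *v v" for v
    by (simp add: quad_deriv_def vec_eq_iff)
  have LEv: "L *v (E *v v) = v" for v by (simp add: matrix_vector_mul_assoc LE)
  have "form11 (g 0) [v, w] = form11 kronecker [v, w]" for v w
    using pull [OF U(2), of "E *v v" "E *v w"] by (simp add: Fx Ax LEv form11_def LE(3))
  then show g0: "g 0 = kronecker" by (rule form11_eqI)
  define T where "T u v = (\<chi> p. tri21 C u v (E *v axis p 1))" for u v
  have Ad: "((\<lambda>y. ?A y v) has_derivative (\<lambda>u. T u v)) (at x)" for v
  proof (rule has_derivative_vecI)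
    fix i
    have d: "((\<lambda>y. y - x) has_derivative (\<lambda>u. u)) (at x)"
      by (auto intro!: derivative_eq_intros)
    have "((\<lambda>y. (L *v v) $ i + tri21 C (y - x) v (E *v axis i 1)) has_derivative
       (\<lambda>u. 0 + (tri21 C u v (E *v axis i 1) + tri21 C (x - x) 0 (E *v axis i 1)))) (at x)"
      by (rule has_derivative_add [OF has_derivative_const tri21_has_derivative [OF d has_derivative_const]])
    then show "((\<lambda>y. ?A y v $ i) has_derivative (\<lambda>u. T u v $ i)) (at x)"
      by (simp add: quad_deriv_def T_def)
  qed
  have Fd: "(F has_derivative (*v) L) (at x)"
  proof -
    have "?A x = (*v) L" using Ax by (rule ext)
    then show ?thesis using quad_map_has_derivative [OF sym, of L x E x] by (simp add: F)
  qed
  have gd: "((\<lambda>y. g y i j) has_derivative g' i j) (at (F x))" for i j using g by (simp add: Fx)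
  have deriv: "form11 (\<lambda>i j. h' i j u) [v, w] = form11 (\<lambda>i j. g' i j (L *v u)) [L *v v, L *v w]
      + form11 kronecker [T u v, L *v w] + form11 kronecker [L *v v, T u w]" for u v w
  proof -
    have "((\<lambda>y. form11 (g (F y)) [?A y v, ?A y w]) has_derivative (\<lambda>u. form11 (\<lambda>i j. h' i j u) [v, w])) (at x)"
      by (rule has_derivative_transform_within_open [OF form11_has_derivative [OF h] U pull])
    from has_derivative_unique [OF this form11_pullback_has_derivative [OF Fd gd Ad]]
    show ?thesis by (auto simp: fun_eq_iff Fx Ax g0)
  qed
  have Tw: "sesq kronecker (T u v) (L *v w) = tri21 C u v w" for u v w
  proof -
    have "w = E *v (L *v w)" by (simp add: matrix_vector_mul_assoc LE)
    also have "\<dots> = (\<Sum>p\<in>UNIV. (L *v w) $ p *s (E *v axis p 1))"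
    proof -
      have "complex_linear ((*v) E)" by (auto simp: complex_linear_def matrix_vector_right_distrib vector_scalar_commute)
      from complex_linear_axis [OF this, of "L *v w"] show ?thesis by (simp add: vec_eq_iff mult.commute)
    qed
    finally have w: "w = (\<Sum>p\<in>UNIV. (L *v w) $ p *s (E *v axis p 1))" .
    have z: "tri21 C u v 0 = 0" by (simp add: tri21_def)
    have "tri21 C u v (\<Sum>p\<in>P. c p *s e p) = (\<Sum>p\<in>P. cnj (c p) * tri21 C u v (e p))" for P c and e :: "'n \<Rightarrow> complex ^ 'n"
      by (induction P rule: infinite_finite_induct) (simp_all add: z)
    from this [where P = UNIV and c = "\<lambda>p. (L *v w) $ p" and e = "\<lambda>p. E *v axis p 1"]
    show ?thesis unfolding w [symmetric] by (simp add: sesq_kronecker T_def mult.commute)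
  qed
  have hk: "hermitian kronecker" by (simp add: hermitian_def kronecker_def)
  have Tw': "sesq kronecker (L *v w) (T u v) = cnj (tri21 C u v w)" for u v w
    by (subst sesq_hermitian [OF hk]) (simp add: Tw)
  have h'herm: "h' j i u = cnj (h' i j u)" for i j u
  proof -
    have "((\<lambda>y. h y j i) has_derivative (\<lambda>u. cnj (h' i j u))) (at x)"
      by (rule has_derivative_transform_within_open [OF bounded_linear.has_derivative [OF bounded_linear_cnj h] U])
         (use hermitian [unfolded hermitian_def] in metis)
    from has_derivative_unique [OF this h] show ?thesis by metis
  qed
  have hs: "sesq (\<lambda>i j. h' i j u) v w = tri21 C u v w + cnj (tri21 C u w v)" for u v w
  proof -
    have hr: "hermitian (\<lambda>i j. h' i j u)" for u unfolding hermitian_def using h'herm by blast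
    have "cnj (sesq (\<lambda>i j. h' i j u) w v) = sesq (\<lambda>i j. h' i j u) v w" for u
      by (rule sesq_hermitian [OF hr, symmetric])
    then show ?thesis
      unfolding C tri21_d_dz [OF h] by (simp add: field_simps)
  qed
  have "form11 (\<lambda>i j. g' i j (L *v u)) [L *v v, L *v w] = 0" for u v w
    using deriv [of u v w] by (simp add: form11_def hs Tw Tw' algebra_simps)
  from this [of "E *v _" "E *v _" "E *v _"]
  have "form11 (\<lambda>i j. g' i j u) [v, w] = form11 (\<lambda>i j. 0) [v, w]" for u v w by (simp add: LEv)
  then have "(\<lambda>i j. g' i j u) = (\<lambda>i j. 0)" for u by (rule form11_eqI)
  then show "g' i j = (\<lambda>u. 0)" by (metis (no_types))
qed

lemma holo_on_subset: "holo_on S f \<Longrightarrow> T \<subseteq> S \<Longrightarrow> holo_on T f"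
  unfolding holo_on_def smooth_on_def by (meson Ck_on_subset subsetD)

lemma holo_on_cong:
  assumes S: "open S" and eq: "\<And>x. x \<in> S \<Longrightarrow> f x = g x" and f: "holo_on S f"
  shows "holo_on S g"
proof -
  have "Ck_on k S g" for k
    using f by (intro Ck_on_cong [OF S eq]) (simp_all add: holo_on_def smooth_on_def)
  moreover have "frechet_derivative g (at x) = frechet_derivative f (at x)" if "x \<in> S" for x
    by (rule frechet_derivative_cong [OF S that, symmetric]) (rule eq)
  ultimately show ?thesis using f unfolding holo_on_def smooth_on_def by metis
qed

lemma holo_on_has_derivative:
  assumes "holo_on S f" "x \<in> S"
  shows "(f has_derivative frechet_derivative f (at x)) (at x)"
proof -
  have "Ck_on (Suc 0) S f" using assms unfolding holo_on_def smooth_on_def by blast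
  from Ck_on_has_derivative [OF this assms(2)] show ?thesis .
qed

lemma holo_on_imp_complex_linear:
  assumes "holo_on S f" "x \<in> S"
  shows "complex_linear (frechet_derivative f (at x))"
  using has_derivative_linear [OF holo_on_has_derivative [OF assms]] assms
  by (auto simp: complex_linear_def holo_on_def linear_add)

section \<open>Charts\<close>

lemma is_chartD:
  assumes "is_chart X c"
  shows "openin X (fst c)" "open (chart_image c)" "inj_on (snd c) (fst c)" "fst c \<subseteq> topspace X"
    "homeomorphic_map (subtopology X (fst c)) (top_of_set (chart_image c)) (snd c)"
proof -
  show "openin X (fst c)" and o: "open (chart_image c)"
    and h: "homeomorphic_map (subtopology X (fst c)) (top_of_set (chart_image c)) (snd c)"
    using assms by (auto simp: is_chart_def)
  show s: "fst c \<subseteq> topspace X" using assms openin_subset by (auto simp: is_chart_def)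
  have "topspace (subtopology X (fst c)) = fst c" using s by (simp add: Int_absorb1)
  then show "inj_on (snd c) (fst c)"
    using homeomorphic_imp_injective_map [OF h] by simp
qed

lemma chart_inv_snd: "is_chart X c \<Longrightarrow> p \<in> fst c \<Longrightarrow> chart_inv c (snd c p) = p"
  unfolding chart_inv_def by (rule inv_into_f_f [OF is_chartD(3)])

lemma chart_inv_in: "x \<in> chart_image c \<Longrightarrow> chart_inv c x \<in> fst c"
  unfolding chart_inv_def chart_image_def by (rule inv_into_into)

lemma snd_chart_inv: "x \<in> chart_image c \<Longrightarrow> snd c (chart_inv c x) = x"
  unfolding chart_inv_def chart_image_def by (rule f_inv_into_f)

lemma overlap_iff:
  assumes "is_chart X c"
  shows "x \<in> overlap c c' \<longleftrightarrow> x \<in> chart_image c \<and> chart_inv c x \<in> fst c'"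
proof
  assume "x \<in> overlap c c'"
  then obtain p where "p \<in> fst c" "p \<in> fst c'" "x = snd c p" by (auto simp: overlap_def)
  then show "x \<in> chart_image c \<and> chart_inv c x \<in> fst c'"
    using chart_inv_snd [OF assms] by (auto simp: chart_image_def)
next
  assume "x \<in> chart_image c \<and> chart_inv c x \<in> fst c'"
  then show "x \<in> overlap c c'"
    using chart_inv_in snd_chart_inv unfolding overlap_def by (metis IntI image_eqI)
qed

lemma overlap_open:
  assumes c: "is_chart X c" and c': "is_chart X c'"
  shows "open (overlap c c')"
proof -
  have "openin X (fst c \<inter> fst c')" using is_chartD(1) [OF c] is_chartD(1) [OF c'] by (rule openin_Int)
  then have "openin (subtopology X (fst c)) (fst c \<inter> fst c')"
    using is_chartD(1) [OF c] by (simp add: openin_open_subtopology)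
  moreover have "fst c \<inter> fst c' \<subseteq> topspace (subtopology X (fst c))"
    using is_chartD(4) [OF c] by auto
  ultimately have "openin (top_of_set (chart_image c)) (overlap c c')"
    using homeomorphic_map_openness [OF is_chartD(5) [OF c]] by (simp add: overlap_def)
  then show ?thesis using is_chartD(2) [OF c] by (simp add: openin_open_eq)
qed

lemma transition_in_overlap:
  assumes "is_chart X c" "is_chart X c'" "x \<in> overlap c c'"
  shows "transition c c' x \<in> overlap c' c" "transition c' c (transition c c' x) = x"
proof -
  have x: "x \<in> chart_image c" "chart_inv c x \<in> fst c'" using assms overlap_iff by blast+
  then show "transition c c' x \<in> overlap c' c"
    using chart_inv_in [of x c] by (auto simp: transition_def overlap_def)
  show "transition c' c (transition c c' x) = x"
    using x chart_inv_snd [OF assms(2)] snd_chart_inv by (simp add: transition_def)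
qed

lemma overlap_subset: "overlap c c' \<subseteq> chart_image c"
  by (auto simp: overlap_def chart_image_def)

lemma complex_manifoldD:
  assumes "complex_manifold X A"
  shows "c \<in> A \<Longrightarrow> is_chart X c"
    "c \<in> A \<Longrightarrow> c' \<in> A \<Longrightarrow> holo_on (overlap c c') (transition c c')"
    "is_chart X c \<Longrightarrow> (\<And>c'. c' \<in> A \<Longrightarrow> compatible c c') \<Longrightarrow> c \<in> A"
  using assms unfolding complex_manifold_def compatible_def by blast+

text \<open>The chain rule for the mutually inverse maps \<open>transition c c'\<close> and \<open>transition c' c\<close>.\<close>

lemma d_transition_inverse:
  assumes M: "complex_manifold X A" and c: "c \<in> A" "c' \<in> A" and x: "x \<in> overlap c c'"
  shows "complex_linear (d_transition c c' x)" "complex_linear (d_transition c' c (transition c c' x))"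
    "d_transition c c' x (d_transition c' c (transition c c' x) v) = v"
proof -
  note ch = complex_manifoldD(1) [OF M c(1)] complex_manifoldD(1) [OF M c(2)]
  note y = transition_in_overlap [OF ch x]
  show "complex_linear (d_transition c c' x)" "complex_linear (d_transition c' c (transition c c' x))"
    unfolding d_transition_def using holo_on_imp_complex_linear complex_manifoldD(2) [OF M] c x y by blast+
  have 1: "(transition c c' has_derivative d_transition c c' x) (at x)"
    unfolding d_transition_def by (rule holo_on_has_derivative [OF complex_manifoldD(2) [OF M c] x])
  have 2: "(transition c' c has_derivative d_transition c' c (transition c c' x)) (at (transition c c' x))"
    unfolding d_transition_def by (rule holo_on_has_derivative [OF complex_manifoldD(2) [OF M c(2,1)] y(1)])
  have "(transition c c' has_derivative d_transition c c' x) (at (transition c' c (transition c c' x)))"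
    using 1 y(2) by simp
  from has_derivative_compose [OF 2 this]
  have "((\<lambda>z. transition c c' (transition c' c z)) has_derivative (\<lambda>v. d_transition c c' x (d_transition c' c (transition c c' x) v)))
     (at (transition c c' x))" .
  moreover have "((\<lambda>z. transition c c' (transition c' c z)) has_derivative (\<lambda>v. v)) (at (transition c c' x))"
    by (rule has_derivative_transform_within_open [OF has_derivative_ident overlap_open [OF ch(2,1)] y(1)])
       (rule transition_in_overlap(2) [OF ch(2,1), symmetric])
  ultimately have "(\<lambda>v. d_transition c c' x (d_transition c' c (transition c c' x) v)) = (\<lambda>v. v)"
    by (rule has_derivative_unique)
  then show "d_transition c c' x (d_transition c' c (transition c c' x) v) = v" by (rule fun_cong)
qed

lemma homeomorphism_imp_map:
  assumes "homeomorphism U V F G"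
  shows "homeomorphic_map (top_of_set U) (top_of_set V) F"
proof -
  have "homeomorphic_maps (top_of_set U) (top_of_set V) F G"
    using assms unfolding homeomorphic_maps_def homeomorphism_def by auto
  then show ?thesis using homeomorphic_maps_map by blast
qed

text \<open>The transition maps between \<open>n\<close> and the charts of the atlas are those of \<open>c\<close> composed with
  \<open>F\<close> or \<open>G\<close>, so \<open>n\<close> is compatible with the atlas and belongs to it by maximality.\<close>

lemma reparametrised_chart:
  assumes M: "complex_manifold X A" and c: "c \<in> A"
    and U: "open U" "U \<subseteq> chart_image c" and V: "open V" and hom: "homeomorphism U V F G"
    and F: "holo_on U F" and G: "holo_on V G"
  defines "n \<equiv> ({p \<in> fst c. snd c p \<in> U}, F \<circ> snd c)"
  shows "n \<in> A" "chart_image n = V" "overlap c n = U" "\<And>y. y \<in> U \<Longrightarrow> transition c n y = F y"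
proof -
  note ch = complex_manifoldD(1) [OF M c]
  let ?U = "{p \<in> fst c. snd c p \<in> U}"
  have img: "snd c ` ?U = U" using U(2) by (auto simp: chart_image_def)
  have FG: "\<And>y. y \<in> V \<Longrightarrow> F (G y) = y" "\<And>x. x \<in> U \<Longrightarrow> G (F x) = x" "F ` U = V" "G ` V = U"
    using hom by (auto simp: homeomorphism_def)
  show im: "chart_image n = V"
  proof -
    have "chart_image n = F ` (snd c ` ?U)" by (simp add: chart_image_def n_def image_image)
    then show ?thesis by (simp only: img FG(3))
  qed
  show ov: "overlap c n = U"
    using img by (auto simp: overlap_def n_def)
  show tr: "transition c n y = F y" if "y \<in> U" for y
    using snd_chart_inv [of y c] U(2) that by (auto simp: transition_def n_def)
  have ts: "topspace (subtopology X (fst c)) = fst c" using is_chartD(4) [OF ch] by (simp add: Int_absorb1)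
  have oU: "openin X ?U"
  proof -
    have "openin (top_of_set (chart_image c)) U" using U by (simp add: openin_open_eq is_chartD(2) [OF ch])
    from openin_continuous_map_preimage [OF homeomorphic_imp_continuous_map [OF is_chartD(5) [OF ch]] this]
    show ?thesis unfolding ts using is_chartD(1) [OF ch] by (simp add: openin_open_subtopology)
  qed
  have hm: "homeomorphic_map (subtopology X ?U) (top_of_set V) (F \<circ> snd c)"
  proof (rule homeomorphic_map_compose [OF _ homeomorphism_imp_map [OF hom]])
    have "homeomorphic_map (subtopology (subtopology X (fst c)) ?U) (subtopology (top_of_set (chart_image c)) U) (snd c)"
    proof (rule homeomorphic_map_subtopologies [OF is_chartD(5) [OF ch]])
      show "snd c ` (topspace (subtopology X (fst c)) \<inter> ?U) = topspace (top_of_set (chart_image c)) \<inter> U"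
        unfolding ts using img U(2) by auto
    qed
    moreover have "fst c \<inter> ?U = ?U" "chart_image c \<inter> U = U" using U(2) by auto
    ultimately show "homeomorphic_map (subtopology X ?U) (top_of_set U) (snd c)"
      by (simp only: subtopology_subtopology)
  qed
  have nch: "is_chart X n"
    unfolding is_chart_def im using oU hm V by (simp add: n_def)
  have ninv: "chart_inv n y = chart_inv c (G y)" if "y \<in> V" for y
  proof -
    have Gy: "G y \<in> U" using FG that by blast
    then have "G y \<in> chart_image c" using U by blast
    then have "chart_inv c (G y) \<in> fst n" "snd n (chart_inv c (G y)) = y"
      using chart_inv_in [of "G y" c] snd_chart_inv [of "G y" c] Gy FG(1) [OF that] by (auto simp: n_def)
    then show ?thesis using chart_inv_snd [OF nch] by metis
  qed
  have "compatible n c'" if c': "c' \<in> A" for c'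
  proof -
    note ch' = complex_manifoldD(1) [OF M c']
    have sub: "overlap n c' \<subseteq> V" using overlap_subset [of n c'] im by simp
    have Gim: "G ` overlap n c' \<subseteq> overlap c c'"
    proof
      fix z assume "z \<in> G ` overlap n c'"
      then obtain y where y: "z = G y" "y \<in> overlap n c'" by blast
      then have "chart_inv c (G y) \<in> fst c'" using ninv sub overlap_iff [OF nch] by (metis subsetD)
      moreover have "G y \<in> chart_image c" using y sub FG(4) U(2) by blast
      ultimately show "z \<in> overlap c c'" using overlap_iff [OF ch] y(1) by blast
    qed
    have "holo_on (overlap n c') (transition c c' \<circ> G)"
      by (rule holo_on_compose [OF overlap_open [OF nch ch'] overlap_open [OF ch ch'] Gim
            holo_on_subset [OF G sub] complex_manifoldD(2) [OF M c c']])
    then have 1: "holo_on (overlap n c') (transition n c')"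
      by (rule holo_on_cong [OF overlap_open [OF nch ch'], rotated])
         (use sub ninv in \<open>auto simp: transition_def\<close>)
    have sub': "overlap c' n \<subseteq> overlap c' c" by (auto simp: overlap_def n_def)
    have im': "transition c' c ` overlap c' n \<subseteq> U"
    proof
      fix z assume "z \<in> transition c' c ` overlap c' n"
      then obtain y where y: "z = transition c' c y" "y \<in> overlap c' n" by blast
      then have "chart_inv c' y \<in> fst n" using overlap_iff [OF ch'] by blast
      then show "z \<in> U" using y by (simp add: transition_def n_def)
    qed
    have "holo_on (overlap c' n) (F \<circ> transition c' c)"
      by (rule holo_on_compose [OF overlap_open [OF ch' nch] U(1) im'
            holo_on_subset [OF complex_manifoldD(2) [OF M c' c] sub'] F])
    then have 2: "holo_on (overlap c' n) (transition c' n)"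
      by (rule holo_on_cong [OF overlap_open [OF ch' nch], rotated]) (simp add: transition_def n_def)
    show ?thesis using 1 2 by (simp add: compatible_def)
  qed
  then show "n \<in> A" by (rule complex_manifoldD(3) [OF M nch])
qed

section \<open>Coefficients of forms in charts\<close>

lemma smooth_on_imp_differentiable: "smooth_on S f \<Longrightarrow> x \<in> S \<Longrightarrow> f differentiable (at x)"
  unfolding smooth_on_def by (metis Ck_on.simps(2))

lemma form_coefficients:
  assumes \<eta>: "\<eta> \<in> forms A 1 1" and c: "c \<in> A" and y: "y \<in> chart_image c"
  shows "\<eta> c y = form11 (coeffs11 (\<eta> c y))" "(\<lambda>y. coeffs11 (\<eta> c y) i j) differentiable (at y)"
proof -
  have "\<eta> c y \<in> Lambda 1 1" using assms by (simp add: forms_def)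
  then show "\<eta> c y = form11 (coeffs11 (\<eta> c y))" unfolding Lambda_1_1 by auto
  have "(\<lambda>y. \<eta> c y vs) differentiable (at y)" for vs
    using \<eta> c y by (intro smooth_on_imp_differentiable [of "chart_image c"]) (auto simp: forms_def)
  then show "(\<lambda>y. coeffs11 (\<eta> c y) i j) differentiable (at y)"
    unfolding coeffs11_def by (intro differentiable_mult differentiable_diff differentiable_const)
qed

lemma vform_coefficients:
  assumes \<theta>: "\<theta> \<in> forms_Theta A 1" and c: "c \<in> A" and y: "y \<in> chart_image c"
  shows "\<theta> c y vs $ j = form10 (\<lambda>i. \<theta> c y [axis i 1] $ j) vs" "(\<lambda>y. \<theta> c y vs $ j) differentiable (at y)"
proof -
  have "(\<lambda>vs. \<theta> c y vs $ j) \<in> Lambda 1 0" using assms by (simp add: forms_Theta_def Lambda_Theta_def)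
  then obtain t where t: "(\<lambda>vs. \<theta> c y vs $ j) = form10 t" using Lambda_1_0 by blast
  have t': "\<theta> c y vs $ j = form10 t vs" for vs by (rule fun_cong [OF t])
  show "\<theta> c y vs $ j = form10 (\<lambda>i. \<theta> c y [axis i 1] $ j) vs"
    unfolding t' form10_axis ..
  have "(\<lambda>y. \<theta> c y vs) differentiable (at y)"
    using \<theta> c y by (intro smooth_on_imp_differentiable [of "chart_image c"]) (auto simp: forms_Theta_def)
  then show "(\<lambda>y. \<theta> c y vs $ j) differentiable (at y)"
    unfolding differentiable_def using bounded_linear.has_derivative [OF bounded_linear_vec_nth] by blast
qed

section \<open>Normal charts\<close>

text \<open>The derivative is differentiable and vanishes at the origin, so it is \<open>O(|y|)\<close>; the mean value
  inequality gives one more factor. This and its converse \<open>bigo_quadratic_imp\<close> translate the condition on a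
  normal chart into one on first-order jets.\<close>

lemma bigo_quadratic:
  fixes f :: "'a::euclidean_space \<Rightarrow> complex"
  assumes S: "open S" "0 \<in> S" and f: "Ck_on 2 S f" "f 0 = 0" "(f has_derivative (\<lambda>_. 0)) (at 0)"
  shows "f \<in> O[nhds 0](\<lambda>z. of_real ((norm z)\<^sup>2))"
proof -
  let ?D = "\<lambda>y. frechet_derivative f (at y)"
  have D: "(f has_derivative ?D y) (at y)" if "y \<in> S" for y
    using f that by (auto simp: numeral_2_eq_2 frechet_derivative_works)
  have D0: "?D 0 = (\<lambda>_. 0)" using frechet_derivative_at [OF f(3)] by simp
  have "\<exists>C d. 0 < d \<and> (\<forall>y. norm y < d \<longrightarrow> norm (?D y b) \<le> C * norm y)" for b
  proof -
    have "(\<lambda>y. ?D y b) differentiable (at 0)" using f S by (auto simp: numeral_2_eq_2)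
    then obtain g' where g': "((\<lambda>y. ?D y b) has_derivative g') (at 0)" by (auto simp: differentiable_def)
    obtain d where d: "d > 0" "\<And>y. norm y < d \<Longrightarrow> norm (?D y b - g' y) \<le> norm y"
      using g' [unfolded has_derivative_at_alt] D0 by (metis diff_zero mult_1 zero_less_one)
    obtain K where K: "\<And>y. norm (g' y) \<le> norm y * K"
      using bounded_linear.bounded [OF has_derivative_bounded_linear [OF g']] by blast
    have "norm (?D y b) \<le> (K + 1) * norm y" if "norm y < d" for y
    proof -
      have "norm (?D y b) \<le> norm (?D y b - g' y) + norm (g' y)" by (metis diff_add_cancel norm_triangle_ineq)
      also have "\<dots> \<le> norm y + norm y * K" using d(2) [OF that] K by (rule add_mono)
      finally show ?thesis by (simp add: algebra_simps)
    qed
    with d(1) show ?thesis by blast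
  qed
  then obtain C d where Cd: "\<And>b. 0 < d b" "\<And>b y. norm y < d b \<Longrightarrow> norm (?D y b) \<le> C b * norm y"
    by metis
  obtain r where r: "r > 0" "ball 0 r \<subseteq> S" using S openE by blast
  define \<delta> where "\<delta> = Min (insert r (d ` Basis))"
  have fin: "finite (insert r (d ` (Basis :: 'a set)))" by simp
  have \<delta>: "\<delta> > 0" "\<delta> \<le> r" "\<And>b. b \<in> Basis \<Longrightarrow> \<delta> \<le> d b"
    unfolding \<delta>_def using Min_le [OF fin] Min_in [OF fin] r(1) Cd(1) by auto
  define K where "K = (\<Sum>b\<in>Basis. \<bar>C b\<bar>)"
  have on: "onorm (?D y) \<le> K * norm y" if "norm y < \<delta>" for y
  proof (rule onorm_le)
    fix v
    have "y \<in> S" using that \<delta>(2) r(2) by (auto simp: subset_iff)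
    note l = has_derivative_linear [OF D [OF this]]
    have "?D y v = (\<Sum>b\<in>Basis. (v \<bullet> b) *\<^sub>R ?D y b)"
      by (subst euclidean_representation [of v, symmetric]) (simp only: linear_sum [OF l] linear_scale [OF l])
    then have "norm (?D y v) \<le> (\<Sum>b\<in>Basis. norm ((v \<bullet> b) *\<^sub>R ?D y b))" by (simp only: norm_sum)
    also have "\<dots> \<le> (\<Sum>b\<in>Basis. norm v * (\<bar>C b\<bar> * norm y))"
    proof (rule sum_mono)
      fix b :: 'a assume b: "b \<in> Basis"
      have "norm (?D y b) \<le> C b * norm y" using Cd(2) \<delta>(3) [OF b] that by (meson less_le_trans)
      also have "\<dots> \<le> \<bar>C b\<bar> * norm y" by (intro mult_right_mono) auto
      finally have "norm (?D y b) \<le> \<bar>C b\<bar> * norm y" .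
      then show "norm ((v \<bullet> b) *\<^sub>R ?D y b) \<le> norm v * (\<bar>C b\<bar> * norm y)"
        using Basis_le_norm [OF b, of v] by (simp only: norm_scaleR) (intro mult_mono; simp)
    qed
    also have "\<dots> = K * norm y * norm v"
      by (simp add: K_def sum_distrib_left sum_distrib_right mult_ac)
    finally show "norm (?D y v) \<le> K * norm y * norm v" .
  qed
  have "norm (f z) \<le> K * norm (of_real ((norm z)\<^sup>2) :: complex)" if z: "norm z < \<delta>" for z
  proof -
    have K: "K \<ge> 0" by (simp add: K_def sum_nonneg)
    have "norm (f z - f 0) \<le> K * norm z * norm (z - 0)"
    proof (rule differentiable_bound [of "cball 0 (norm z)" f ?D])
      fix y :: 'a assume y: "y \<in> cball 0 (norm z)"
      then have yn: "norm y \<le> norm z" by simp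
      then have "y \<in> S" using z \<delta>(2) r(2) by (auto simp: subset_iff)
      then show "(f has_derivative ?D y) (at y within cball 0 (norm z))"
        using D has_derivative_at_withinI by blast
      have "onorm (?D y) \<le> K * norm y" using on yn z by simp
      also have "\<dots> \<le> K * norm z" using yn K by (rule mult_left_mono)
      finally show "onorm (?D y) \<le> K * norm z" .
    qed auto
    then show ?thesis by (simp add: f(2) norm_mult power2_eq_square mult.assoc)
  qed
  moreover have "eventually (\<lambda>z::'a. norm z < \<delta>) (nhds 0)"
    using eventually_nhds_metric [of "\<lambda>z. norm z < \<delta>" 0] \<delta>(1) by auto
  ultimately show ?thesis
    by (intro bigoI [of _ K]) (auto elim: eventually_mono)
qed

lemma bigo_quadratic_imp:
  fixes f :: "'a::euclidean_space \<Rightarrow> complex"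
  assumes "f \<in> O[nhds 0](\<lambda>z. of_real ((norm z)\<^sup>2))"
  shows "f 0 = 0" "(f has_derivative (\<lambda>_. 0)) (at 0)"
proof -
  obtain K where K: "K > 0" "eventually (\<lambda>z. norm (f z) \<le> K * norm (of_real ((norm z)\<^sup>2) :: complex)) (nhds 0)"
    using landau_o.bigE [OF assms] by blast
  obtain d where d: "d > 0" "\<And>z. norm z < d \<Longrightarrow> norm (f z) \<le> K * (norm z)\<^sup>2"
    using K(2) unfolding eventually_nhds_metric by (auto simp: norm_power)
  show f0: "f 0 = 0" using d(2) [of 0] d(1) by simp
  show "(f has_derivative (\<lambda>_. 0)) (at 0)"
    unfolding has_derivative_at_alt
  proof (intro conjI allI impI)
    fix e :: real assume e: "e > 0"
    show "\<exists>d>0. \<forall>y. norm (y - 0) < d \<longrightarrow> norm (f y - f 0 - 0) \<le> e * norm (y - 0)"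
    proof (intro exI [of _ "min d (e / K)"] conjI allI impI)
      show "min d (e / K) > 0" using d(1) e K(1) by simp
      fix y :: 'a assume y: "norm (y - 0) < min d (e / K)"
      have "norm (f y) \<le> (K * norm y) * norm y" using d(2) [of y] y by (simp add: power2_eq_square mult.assoc)
      also have "\<dots> \<le> e * norm y"
      proof (rule mult_right_mono)
        show "K * norm y \<le> e" using y K(1) by (simp add: pos_less_divide_eq mult.commute)
      qed simp
      finally show "norm (f y - f 0 - 0) \<le> e * norm (y - 0)" by (simp add: f0)
    qed
  qed simp
qed

lemma standard_form_eq_form11: "\<i> / 2 * (\<Sum>i\<in>UNIV. wedges [dz i, dzbar i] vs) = form11 kronecker vs"
proof -
  have "(\<Sum>j\<in>UNIV. kronecker i j * wedges [dz i, dzbar j] vs) = wedges [dz i, dzbar i] vs" for i :: 'a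
  proof -
    have "kronecker i j * wedges [dz i, dzbar j] vs = (if j = i then wedges [dz i, dzbar i] vs else 0)" for j :: 'a
      by (simp add: kronecker_def)
    then show ?thesis by simp
  qed
  then show ?thesis by (simp only: form11_wedges)
qed

text \<open>A \<open>(1,1)\<close>-form is real exactly if its matrix is hermitian, and
  \<open>\<omega>(v, \<i> v)\<close> is the value of the hermitian form at \<open>v\<close>.\<close>

lemma kaehler_coefficients:
  assumes K: "kaehler_form A \<omega>" and c: "c \<in> A" and y: "y \<in> chart_image c"
  shows "hermitian (coeffs11 (\<omega> c y))" "positive_definite (coeffs11 (\<omega> c y))"
proof -
  let ?h = "coeffs11 (\<omega> c y)"
  have \<omega>: "\<omega> \<in> forms A 1 1" using K by (simp add: kaehler_form_def)
  have form: "\<omega> c y = form11 ?h" by (rule form_coefficients(1) [OF \<omega> c y])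
  have real: "form11 ?h vs = cnj (form11 ?h vs)" for vs
  proof -
    have "\<omega> c y vs \<in> \<real>" using K c y unfolding kaehler_form_def by blast
    then show ?thesis by (simp only: form [symmetric] Reals_cnj_iff)
  qed
  have hs: "sesq ?h w v = cnj (sesq ?h v w)" for v w
  proof -
    have "- (form11 ?h [\<i> *s v, w]) - \<i> * form11 ?h [v, w] = sesq ?h v w"
      "- (form11 ?h [\<i> *s w, v]) - \<i> * form11 ?h [w, v] = sesq ?h w v"
      by (simp_all add: form11_def algebra_simps)
    moreover have "form11 ?h [\<i> *s w, v] = form11 ?h [v, \<i> *s w] * (-1)" "form11 ?h [v, \<i> *s w] = - form11 ?h [\<i> *s v, w]"
       "form11 ?h [w, v] = - form11 ?h [v, w]"
      by (simp_all add: form11_def algebra_simps)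
    ultimately show ?thesis
      using real [of "[v, w]"] real [of "[\<i> *s v, w]"] by (simp add: complex_eq_iff)
  qed
  have "?h j i = cnj (?h i j)" for i j
    using hs [of "axis j 1" "axis i 1"] unfolding sesq_axis(2) .
  then show "hermitian ?h" unfolding hermitian_def by blast
  show "positive_definite ?h"
    unfolding positive_definite_def
  proof (intro allI impI)
    fix v :: "complex ^ 'b" assume "v \<noteq> 0"
    then have "Re (\<omega> c y [v, \<i> *s v]) > 0" using K c y unfolding kaehler_form_def by blast
    then have "Re (form11 ?h [v, \<i> *s v]) > 0" by (simp only: form [symmetric])
    then show "Re (sesq ?h v v) > 0" by (simp add: form11_def)
  qed
qed

lemma kaehler_symmetric:
  assumes M: "complex_manifold X A" and K: "kaehler_form A \<omega>" and c: "c \<in> A" and x: "x \<in> chart_image c"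
  shows "tri21 (\<lambda>k i j. d_dz k (\<lambda>y. coeffs11 (\<omega> c y) i j) x) u v w = tri21 (\<lambda>k i j. d_dz k (\<lambda>y. coeffs11 (\<omega> c y) i j) x) v u w"
proof -
  have \<omega>: "\<omega> \<in> forms A 1 1" using K by (simp add: kaehler_form_def)
  note o = is_chartD(2) [OF complex_manifoldD(1) [OF M c]]
  define h' where "h' i j = frechet_derivative (\<lambda>y. coeffs11 (\<omega> c y) i j) (at x)" for i j
  have h: "((\<lambda>y. coeffs11 (\<omega> c y) i j) has_derivative h' i j) (at x)" for i j
    using form_coefficients(2) [OF \<omega> c x] by (simp add: h'_def frechet_derivative_works)
  have "(del \<omega> + delbar \<omega>) c x = 0 c x" using K c x unfolding kaehler_form_def form_eq_def by blast
  then have "del_loc (\<omega> c) x vs + delbar_loc (\<omega> c) x vs = 0" for vs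
    by (simp add: del_def delbar_def fun_eq_iff)
  then have "form11 (\<lambda>i j. h' i j u) [v, w] - form11 (\<lambda>i j. h' i j v) [u, w] + form11 (\<lambda>i j. h' i j w) [u, v] = 0" for u v w
    using exterior_derivative_form11 [OF o x form_coefficients(1) [OF \<omega> c] h, of u v w] by metis
  from closed_imp_symmetric [OF this h] show ?thesis .
qed

lemma normal_chart_exists:
  fixes A :: "('a, 'n::finite) chart set"
  assumes M: "complex_manifold X A" and K: "kaehler_form A \<omega>" and c: "c \<in> A" and x: "x \<in> chart_image c"
  shows "\<exists>n. normal_chart_at A \<omega> (chart_inv c x) n"
proof -
  have \<omega>: "\<omega> \<in> forms A 1 1" using K by (simp add: kaehler_form_def)
  note ch = complex_manifoldD(1) [OF M c]
  let ?h = "\<lambda>y. coeffs11 (\<omega> c y)"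
  define h' where "h' i j = frechet_derivative (\<lambda>y. ?h y i j) (at x)" for i j
  have h: "((\<lambda>y. ?h y i j) has_derivative h' i j) (at x)" for i j
    using form_coefficients(2) [OF \<omega> c x] by (simp add: h'_def frechet_derivative_works)
  define C where "C = (\<lambda>k i j. d_dz k (\<lambda>y. ?h y i j) x)"
  have sym: "tri21 C u v w = tri21 C v u w" for u v w
    unfolding C_def by (rule kaehler_symmetric [OF M K c x])
  obtain L E :: "complex ^ 'n ^ 'n" where LE: "L ** E = mat 1" "E ** L = mat 1"
    "\<And>v w. sesq (?h x) v w = sesq kronecker (L *v v) (L *v w)"
    using unitary_frame [OF kaehler_coefficients [OF K c x]] by metis
  let ?F = "quad_map L C x E"
  obtain U V G where U: "open U" "U \<subseteq> chart_image c" "x \<in> U" and V: "open V" and hom: "homeomorphism U V ?F G"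
    and holo: "holo_on U ?F" "holo_on V G"
    using quad_map_local_inverse [OF sym is_chartD(2) [OF ch] x LE(1,2)] by metis
  define n where "n = ({p \<in> fst c. snd c p \<in> U}, ?F \<circ> snd c)"
  note n = reparametrised_chart [OF M c U(1,2) V hom holo, folded n_def]
  have Fx: "?F x = 0" by (simp add: quad_map_def vec_eq_iff)
  have V0: "0 \<in> V" using hom U(3) Fx by (force simp: homeomorphism_def)
  let ?g = "\<lambda>y. coeffs11 (\<omega> n y)"
  define g' where "g' i j = frechet_derivative (\<lambda>y. ?g y i j) (at 0)" for i j
  have g: "((\<lambda>y. ?g y i j) has_derivative g' i j) (at 0)" for i j
    using form_coefficients(2) [OF \<omega> n(1)] V0 n(2) by (simp add: g'_def frechet_derivative_works)
  have dt: "d_transition c n y = quad_deriv L C x E y" if "y \<in> U" for y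
  proof -
    have "d_transition c n y = frechet_derivative ?F (at y)"
      unfolding d_transition_def by (rule frechet_derivative_cong [OF U(1) that n(4)])
    then show ?thesis using frechet_derivative_at [OF quad_map_has_derivative [OF sym]] by metis
  qed
  have pull: "form11 (?h y) [v, w] = form11 (?g (?F y)) [quad_deriv L C x E y v, quad_deriv L C x E y w]" if y: "y \<in> U" for y v w
  proof -
    have "\<omega> c y [v, w] = \<omega> n (transition c n y) (map (d_transition c n y) [v, w])"
      using \<omega> c n(1) y n(3) unfolding forms_def by blast
    moreover have "?F y \<in> chart_image n" using hom y n(2) by (auto simp: homeomorphism_def)
    ultimately show ?thesis
      using form_coefficients(1) [OF \<omega> c, of y] form_coefficients(1) [OF \<omega> n(1), of "?F y"] y U(2)
      by (simp add: n(4) dt subset_iff del: coeffs11_form11)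
  qed
  have hermU: "hermitian (?h y)" if "y \<in> U" for y
    using kaehler_coefficients(1) [OF K c] U(2) that by blast
  note nc = quad_map_normalises [OF h hermU U(1,3) LE C_def sym refl g pull]
  have O: "(\<lambda>z. \<omega> n z vs - form11 kronecker vs) \<in> O[nhds 0](\<lambda>z. of_real ((norm z)\<^sup>2))" for vs
  proof (rule bigo_quadratic [OF V V0])
    have "Ck_on 2 V (\<lambda>z. \<omega> n z vs)" using \<omega> n(1,2) unfolding forms_def smooth_on_def by blast
    then have "Ck_on 2 V (\<lambda>z. \<omega> n z vs + - form11 kronecker vs)" by (intro Ck_on_add Ck_on_const V)
    then show "Ck_on 2 V (\<lambda>z. \<omega> n z vs - form11 kronecker vs)" by simp
    have \<omega>n: "\<omega> n z = form11 (?g z)" if "z \<in> V" for z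
      using form_coefficients(1) [OF \<omega> n(1)] that n(2) by blast
    show "\<omega> n 0 vs - form11 kronecker vs = 0" using \<omega>n [OF V0] nc(1) by simp
    have "((\<lambda>z. form11 (?g z) vs) has_derivative (\<lambda>u. form11 (\<lambda>i j. g' i j u) vs)) (at 0)"
      by (rule form11_has_derivative [OF g])
    then have "((\<lambda>z. form11 (?g z) vs) has_derivative (\<lambda>u. 0)) (at 0)"
      by (simp add: nc(2))
    then have "((\<lambda>z. \<omega> n z vs) has_derivative (\<lambda>u. 0)) (at 0)"
      by (rule has_derivative_transform_within_open [OF _ V V0]) (simp add: \<omega>n [symmetric])
    from has_derivative_diff [OF this has_derivative_const]
    show "((\<lambda>z. \<omega> n z vs - form11 kronecker vs) has_derivative (\<lambda>_. 0)) (at 0)" by simp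
  qed
  have "chart_inv c x \<in> fst n" "snd n (chart_inv c x) = 0"
    using chart_inv_in [OF x] snd_chart_inv [OF x] U(3) Fx by (auto simp: n_def)
  with n(1) O show ?thesis
    unfolding normal_chart_at_def standard_form_eq_form11 by blast
qed

lemma normal_chart_coefficients:
  assumes M: "complex_manifold X A" and \<omega>: "\<omega> \<in> forms A 1 1" and n: "normal_chart_at A \<omega> P n"
  shows "coeffs11 (\<omega> n 0) = kronecker" "((\<lambda>y. coeffs11 (\<omega> n y) i j) has_derivative (\<lambda>_. 0)) (at 0)"
proof -
  have O: "(\<lambda>z. \<omega> n z vs - form11 kronecker vs) \<in> O[nhds 0](\<lambda>z. of_real ((norm z)\<^sup>2))" for vs
    using n unfolding normal_chart_at_def standard_form_eq_form11 by blast
  have "\<omega> n 0 = form11 kronecker" using bigo_quadratic_imp(1) [OF O] by (auto simp: fun_eq_iff)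
  then show "coeffs11 (\<omega> n 0) = kronecker" by simp
  have d: "((\<lambda>z. \<omega> n z vs) has_derivative (\<lambda>_. 0)) (at 0)" for vs
    using has_derivative_add [OF bigo_quadratic_imp(2) [OF O [of vs]] has_derivative_const [of "form11 kronecker vs"]]
    by (simp only: diff_add_cancel add_0)
  show "((\<lambda>y. coeffs11 (\<omega> n y) i j) has_derivative (\<lambda>_. 0)) (at 0)"
    unfolding coeffs11_def
    by (rule has_derivative_eq_rhs [OF has_derivative_mult_right [OF has_derivative_diff [OF d has_derivative_mult_right [OF d]]]]) simp
qed

section \<open>The identity\<close>

text \<open>The theorem at the centre of a normal chart, where \<open>da k i j\<close> and \<open>db k i j\<close> stand for \<open>\<partial>\<^sub>k a\<^sub>i\<^sub>j\<close>
  and \<open>\<partial>\<^sub>k b\<^sub>i\<^sub>j\<close>. The two lines on the left are the bracket and \<open>\<partial>(\<theta> \<lrcorner> \<beta> + \<phi> \<lrcorner> \<alpha>)\<close>.\<close>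

lemma coefficient_identity:
  fixes a b :: "'n::finite \<Rightarrow> 'n \<Rightarrow> complex" and da db :: "'n \<Rightarrow> 'n \<Rightarrow> 'n \<Rightarrow> complex"
  shows "form21 (\<lambda>i k l. \<Sum>j\<in>UNIV. a i j * db j k l + b i j * da j k l) vs
     + form21 (\<lambda>k i l. \<Sum>j\<in>UNIV. da k i j * b j l + a i j * db k j l + (db k i j * a j l + b i j * da k j l)) vs
   = form21 (\<lambda>k i l. \<Sum>j\<in>UNIV. da k i j * b j l) vs + form21 (\<lambda>k i l. \<Sum>j\<in>UNIV. db k i j * a j l) vs
     + form21 (\<lambda>i k l. \<Sum>j\<in>UNIV. a i j * (db j k l - db k j l)) vs
     + form21 (\<lambda>i k l. \<Sum>j\<in>UNIV. b i j * (da j k l - da k j l)) vs"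
proof -
  have swap: "form21 (\<lambda>i k l. \<Sum>j\<in>UNIV. a i j * (db j k l - db k j l)) vs =
     form21 (\<lambda>i k l. \<Sum>j\<in>UNIV. a i j * db j k l) vs + form21 (\<lambda>k i l. \<Sum>j\<in>UNIV. a i j * db k j l) vs"
    for a :: "'n \<Rightarrow> 'n \<Rightarrow> complex" and db :: "'n \<Rightarrow> 'n \<Rightarrow> 'n \<Rightarrow> complex"
  proof -
    have "form21 (\<lambda>i k l. \<Sum>j\<in>UNIV. a i j * (db j k l - db k j l)) vs
      + form21 (\<lambda>i k l. \<Sum>j\<in>UNIV. a i j * db k j l) vs = form21 (\<lambda>i k l. \<Sum>j\<in>UNIV. a i j * db j k l) vs"
      unfolding form21_add by (simp add: algebra_simps sum_subtractf)
    moreover have "form21 (\<lambda>i k l. \<Sum>j\<in>UNIV. a i j * db k j l) vs = - form21 (\<lambda>k i l. \<Sum>j\<in>UNIV. a i j * db k j l) vs"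
      by (rule form21_swap)
    ultimately show ?thesis by (simp add: algebra_simps)
  qed
  show ?thesis
    unfolding swap form21_add by (simp only: sum.distrib add_ac)
qed

lemma add_form_apply: "(\<eta> + \<zeta>) c x vs = \<eta> c x vs + (\<zeta> c x vs :: complex)"
  by simp

lemma contract_pullback:
  assumes M: "complex_manifold X A" and c: "c \<in> A" "n \<in> A" and y: "y \<in> overlap c n"
    and \<eta>: "\<And>vs. linear (\<lambda>v. \<eta> n (transition c n y) (v # vs))"
    and \<eta>p: "\<And>vs. \<eta> c y vs = \<eta> n (transition c n y) (map (d_transition c n y) vs)"
    and \<theta>: "\<And>vs. d_transition c n y (\<theta> c y vs) = \<theta> n (transition c n y) (map (d_transition c n y) vs)"
  shows "contract p \<theta> \<eta> c y vs = contract p \<theta> \<eta> n (transition c n y) (map (d_transition c n y) vs)"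
proof -
  have e: "\<eta> c y = (\<lambda>vs. \<eta> n (transition c n y) (map (d_transition c n y) vs))" by (rule ext) (rule \<eta>p)
  show ?thesis unfolding contract_def e
    by (rule contract_pt_pullback [where D = "d_transition c n y" and \<eta> = "\<eta> n (transition c n y)"])
       (rule d_transition_inverse(1) [OF M c y], rule \<eta>, rule \<theta> [symmetric])
qed

lemma del_pullback:
  assumes M: "complex_manifold X A" and c: "c \<in> A" "n \<in> A" and x: "x \<in> overlap c n"
    and h: "\<And>c y. c \<in> A \<Longrightarrow> y \<in> chart_image c \<Longrightarrow> \<eta> c y = form11 (h c y)"
    and hd: "\<And>c y i j. c \<in> A \<Longrightarrow> y \<in> chart_image c \<Longrightarrow> (\<lambda>y. h c y i j) differentiable (at y)"
    and pull: "\<And>y vs. y \<in> overlap c n \<Longrightarrow> \<eta> c y vs = \<eta> n (transition c n y) (map (d_transition c n y) vs)"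
  shows "del \<eta> c x vs = del \<eta> n (transition c n x) (map (d_transition c n x) vs)"
proof -
  note ch = complex_manifoldD(1) [OF M c(1)] complex_manifoldD(1) [OF M c(2)]
  have im: "transition c n ` overlap c n \<subseteq> chart_image n"
    using transition_in_overlap(1) [OF ch] overlap_subset by blast
  have xs: "x \<in> chart_image c" "transition c n x \<in> chart_image n" using x overlap_subset im by blast+
  show ?thesis
    unfolding del_def d_transition_def
  proof (rule del_loc_pullback [OF overlap_open [OF ch] x is_chartD(2) [OF ch(2)] im complex_manifoldD(2) [OF M c]])
    show "\<eta> c y = form11 (h c y)" if "y \<in> overlap c n" for y
      using h [OF c(1)] overlap_subset that by blast
    show "(\<lambda>y. h c y i j) differentiable (at x)" for i j by (rule hd [OF c(1) xs(1)])
    show "\<eta> n y = form11 (h n y)" if "y \<in> chart_image n" for y by (rule h [OF c(2) that])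
    show "(\<lambda>y. h n y i j) differentiable (at (transition c n x))" for i j by (rule hd [OF c(2) xs(2)])
    show "\<eta> c y vs = \<eta> n (transition c n y) (map (frechet_derivative (transition c n) (at y)) vs)"
      if "y \<in> overlap c n" for y vs using pull [OF that] unfolding d_transition_def .
  qed
qed

theorem proposition2p2:
  fixes X :: "'a topology" and A :: "('a, 'n::finite) chart set"
    and \<omega> \<alpha> \<beta> :: "('a, 'n) form" and \<theta> \<phi> :: "('a, 'n) vform"
  assumes "complex_manifold X A" and "compact_space X" and "kaehler_form A \<omega>"
    and "\<alpha> \<in> forms A 1 1" and "\<beta> \<in> forms A 1 1"
    and "\<theta> \<in> forms_Theta A 1" and "form_eq A (contract 1 \<theta> \<omega>) \<alpha>"
    and "\<phi> \<in> forms_Theta A 1" and "form_eq A (contract 1 \<phi> \<omega>) \<beta>"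
  shows "form_eq A
    (bracket A \<omega> \<alpha> \<beta> + del (contract 1 \<theta> \<beta> + contract 1 \<phi> \<alpha>))
    (contract 2 (sharp 2 \<omega> (del \<alpha>)) \<beta> + contract 2 (sharp 2 \<omega> (del \<beta>)) \<alpha>
       + contract 1 \<theta> (del \<beta>) + contract 1 \<phi> (del \<alpha>))"
  unfolding form_eq_def
proof (intro ballI)
  fix c x assume c: "c \<in> A" and x: "x \<in> chart_image c"
  note M = assms(1) and K = assms(3) and \<alpha> = assms(4) and \<beta> = assms(5) and \<theta> = assms(6) and \<phi> = assms(8)
  have \<omega>: "\<omega> \<in> forms A 1 1" using K by (simp add: kaehler_form_def)
  \<comment> \<open>The chart that the definition of the bracket chooses at the point with coordinates \<open>x\<close>.\<close>
  define n where "n = (SOME n. normal_chart_at A \<omega> (chart_inv c x) n)"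
  have n: "normal_chart_at A \<omega> (chart_inv c x) n"
    unfolding n_def by (rule someI_ex [OF normal_chart_exists [OF M K c x]])
  have nA: "n \<in> A" and nP: "chart_inv c x \<in> fst n" "snd n (chart_inv c x) = 0"
    using n by (auto simp: normal_chart_at_def)
  have xo: "x \<in> overlap c n" using overlap_iff [OF complex_manifoldD(1) [OF M c]] x nP by blast
  have \<tau>x: "transition c n x = 0" using nP by (simp add: transition_def)
  have S: "open (chart_image n)" by (rule is_chartD(2) [OF complex_manifoldD(1) [OF M nA]])
  have S0: "0 \<in> chart_image n" using nP by (force simp: chart_image_def)
  define D where "D = d_transition c n x"

  define a where "a c y = coeffs11 (\<alpha> c y)" for c y
  define b where "b c y = coeffs11 (\<beta> c y)" for c y
  define g where "g c y = coeffs11 (\<omega> c y)" for c y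
  define t where "t c y i j = \<theta> c y [axis i 1] $ j" for c y i j
  define f where "f c y i j = \<phi> c y [axis i 1] $ j" for c y i j
  have a: "\<alpha> c y = form11 (a c y)" "(\<lambda>y. a c y i j) differentiable (at y)"
    if "c \<in> A" "y \<in> chart_image c" for c y i j
    unfolding a_def using form_coefficients [OF \<alpha> that] by blast+
  have b: "\<beta> c y = form11 (b c y)" "(\<lambda>y. b c y i j) differentiable (at y)"
    if "c \<in> A" "y \<in> chart_image c" for c y i j
    unfolding b_def using form_coefficients [OF \<beta> that] by blast+
  have g: "\<omega> c y = form11 (g c y)" "(\<lambda>y. g c y i j) differentiable (at y)"
    if "c \<in> A" "y \<in> chart_image c" for c y i j
    unfolding g_def using form_coefficients [OF \<omega> that] by blast+
  have t: "\<theta> c y vs $ j = form10 (\<lambda>i. t c y i j) vs" "(\<lambda>y. t c y i j) differentiable (at y)"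
    if "c \<in> A" "y \<in> chart_image c" for c y vs i j
    unfolding t_def using vform_coefficients [OF \<theta> that] by blast+
  have f: "\<phi> c y vs $ j = form10 (\<lambda>i. f c y i j) vs" "(\<lambda>y. f c y i j) differentiable (at y)"
    if "c \<in> A" "y \<in> chart_image c" for c y vs i j
    unfolding f_def using vform_coefficients [OF \<phi> that] by blast+
  have g0: "g n 0 = kronecker" "((\<lambda>y. g n y i j) has_derivative (\<lambda>_. 0)) (at 0)" for i j
    unfolding g_def using normal_chart_coefficients [OF M \<omega> n] by blast+
  have g0d: "d_dz k (\<lambda>y. g n y i j) 0 = 0" for i j k
    using d_dz_eq [OF g0(2)] by simp

  have a_eq: "a c y = (\<lambda>i l. \<Sum>j\<in>UNIV. t c y i j * g c y j l)" if "c \<in> A" "y \<in> chart_image c" for c y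
  proof -
    have "form11 (a c y) = contract_pt 1 (\<theta> c y) (form11 (g c y))"
    proof -
      have "contract 1 \<theta> \<omega> c y = \<alpha> c y" using assms(7) that unfolding form_eq_def by blast
      then show ?thesis by (simp only: contract_def a(1) [OF that] g(1) [OF that])
    qed
    also have "\<dots> = form11 (\<lambda>i l. \<Sum>j\<in>UNIV. t c y i j * g c y j l)"
      by (rule contract_form11) (rule t(1) [OF that])
    finally show ?thesis by (rule form11_inject)
  qed
  have b_eq: "b c y = (\<lambda>i l. \<Sum>j\<in>UNIV. f c y i j * g c y j l)" if "c \<in> A" "y \<in> chart_image c" for c y
  proof -
    have "form11 (b c y) = contract_pt 1 (\<phi> c y) (form11 (g c y))"
    proof -
      have "contract 1 \<phi> \<omega> c y = \<beta> c y" using assms(9) that unfolding form_eq_def by blast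
      then show ?thesis by (simp only: contract_def b(1) [OF that] g(1) [OF that])
    qed
    also have "\<dots> = form11 (\<lambda>i l. \<Sum>j\<in>UNIV. f c y i j * g c y j l)"
      by (rule contract_form11) (rule f(1) [OF that])
    finally show ?thesis by (rule form11_inject)
  qed

  define da where "da k i j = d_dz k (\<lambda>y. a n y i j) 0" for k i j
  define db where "db k i j = d_dz k (\<lambda>y. b n y i j) 0" for k i j
  \<comment> \<open>As \<open>g\<close> is the identity to first order, \<open>t\<close> and \<open>a\<close>, and \<open>f\<close> and \<open>b\<close>, agree to first order at 0.\<close>
  have t0: "t n 0 = a n 0" unfolding a_eq [OF nA S0] g0 sum_kronecker ..
  have f0: "f n 0 = b n 0" unfolding b_eq [OF nA S0] g0 sum_kronecker ..
  have t0d: "d_dz k (\<lambda>y. t n y i l) 0 = da k i l" for k i l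
  proof -
    have "da k i l = d_dz k (\<lambda>y. \<Sum>j\<in>UNIV. t n y i j * g n y j l) 0"
      unfolding da_def by (rule d_dz_cong [OF S S0]) (simp only: a_eq [OF nA])
    also have "\<dots> = (\<Sum>j\<in>UNIV. d_dz k (\<lambda>y. t n y i j * g n y j l) 0)"
      by (rule d_dz_sum) (intro differentiable_mult t(2) g(2) nA S0)
    also have "\<dots> = (\<Sum>j\<in>UNIV. d_dz k (\<lambda>y. t n y i j) 0 * kronecker j l)"
      by (intro sum.cong refl, subst d_dz_mult [OF t(2) [OF nA S0] g(2) [OF nA S0]]) (simp add: g0d g0(1))
    finally show ?thesis by (simp only: sum_kronecker)
  qed
  have f0d: "d_dz k (\<lambda>y. f n y i l) 0 = db k i l" for k i l
  proof -
    have "db k i l = d_dz k (\<lambda>y. \<Sum>j\<in>UNIV. f n y i j * g n y j l) 0"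
      unfolding db_def by (rule d_dz_cong [OF S S0]) (simp only: b_eq [OF nA])
    also have "\<dots> = (\<Sum>j\<in>UNIV. d_dz k (\<lambda>y. f n y i j * g n y j l) 0)"
      by (rule d_dz_sum) (intro differentiable_mult f(2) g(2) nA S0)
    also have "\<dots> = (\<Sum>j\<in>UNIV. d_dz k (\<lambda>y. f n y i j) 0 * kronecker j l)"
      by (intro sum.cong refl, subst d_dz_mult [OF f(2) [OF nA S0] g(2) [OF nA S0]]) (simp add: g0d g0(1))
    finally show ?thesis by (simp only: sum_kronecker)
  qed

  let ?\<eta> = "contract 1 \<theta> \<beta> + contract 1 \<phi> \<alpha>"
  define m where "m c y i l = (\<Sum>j\<in>UNIV. t c y i j * b c y j l + f c y i j * a c y j l)" for c y i l
  have \<eta>: "?\<eta> c y = form11 (m c y)" if "c \<in> A" "y \<in> chart_image c" for c y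
  proof
    fix vs
    have "?\<eta> c y vs = form11 (\<lambda>i l. \<Sum>j\<in>UNIV. t c y i j * b c y j l) vs + form11 (\<lambda>i l. \<Sum>j\<in>UNIV. f c y i j * a c y j l) vs"
      unfolding add_form_apply contract_def a(1) [OF that] b(1) [OF that]
      by (simp only: contract_form11 [of "\<theta> c y" "t c y", OF t(1) [OF that]]
           contract_form11 [of "\<phi> c y" "f c y", OF f(1) [OF that]])
    also have "\<dots> = form11 (m c y) vs"
      unfolding form11_add by (simp only: m_def [abs_def] sum.distrib)
    finally show "?\<eta> c y vs = form11 (m c y) vs" .
  qed
  have md: "(\<lambda>y. m c y i l) differentiable (at y)" if "c \<in> A" "y \<in> chart_image c" for c y i l
    unfolding m_def
    by (intro differentiable_sum differentiable_add differentiable_mult ballI t(2) f(2) a(2) b(2) that finite)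

  have pull: "\<zeta> c y vs = \<zeta> n (transition c n y) (map (d_transition c n y) vs)"
    if "\<zeta> \<in> forms A 1 1" "y \<in> overlap c n" for \<zeta> y vs
    using that c nA unfolding forms_def by blast
  have pull\<Theta>: "d_transition c n y (\<zeta> c y vs) = \<zeta> n (transition c n y) (map (d_transition c n y) vs)"
    if "\<zeta> \<in> forms_Theta A 1" "y \<in> overlap c n" for \<zeta> y vs
    using that c nA unfolding forms_Theta_def by blast
  have ty: "transition c n y \<in> chart_image n" if "y \<in> overlap c n" for y
    using transition_in_overlap(1) [OF complex_manifoldD(1) [OF M c] complex_manifoldD(1) [OF M nA] that] overlap_subset by blast
  \<comment> \<open>All terms are carried from \<open>c\<close> to \<open>n\<close> with the derivative \<open>D\<close> of the transition map.\<close>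
  have \<eta>pull: "?\<eta> c y vs = ?\<eta> n (transition c n y) (map (d_transition c n y) vs)" if y: "y \<in> overlap c n" for y vs
    unfolding add_form_apply
    by (intro arg_cong2 [where f = "(+)"] contract_pullback [OF M c nA y])
       (simp_all only: a(1) [OF nA ty [OF y]] b(1) [OF nA ty [OF y]] linear_form11 pull [OF \<alpha> y] pull [OF \<beta> y] pull\<Theta> [OF \<theta> y] pull\<Theta> [OF \<phi> y])
  have del\<eta>: "del ?\<eta> c x vs = del ?\<eta> n 0 (map D vs)" for vs
  proof -
    have "del ?\<eta> c x vs = del ?\<eta> n (transition c n x) (map (d_transition c n x) vs)"
      by (rule del_pullback [where h = m, OF M c nA xo]) (rule \<eta>, assumption, assumption, rule md, assumption, assumption, rule \<eta>pull, assumption)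
    then show ?thesis by (simp only: \<tau>x D_def)
  qed
  have del\<alpha>: "del \<alpha> c x vs = del \<alpha> n 0 (map D vs)" for vs
  proof -
    have "del \<alpha> c x vs = del \<alpha> n (transition c n x) (map (d_transition c n x) vs)"
      by (rule del_pullback [where h = a, OF M c nA xo]) (rule a(1), assumption, assumption, rule a(2), assumption, assumption, rule pull [OF \<alpha>], assumption)
    then show ?thesis by (simp only: \<tau>x D_def)
  qed
  have del\<beta>: "del \<beta> c x vs = del \<beta> n 0 (map D vs)" for vs
  proof -
    have "del \<beta> c x vs = del \<beta> n (transition c n x) (map (d_transition c n x) vs)"
      by (rule del_pullback [where h = b, OF M c nA xo]) (rule b(1), assumption, assumption, rule b(2), assumption, assumption, rule pull [OF \<beta>], assumption)
    then show ?thesis by (simp only: \<tau>x D_def)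
  qed
  have del\<alpha>n: "del \<alpha> n 0 = form21 da"
    unfolding del_def da_def [abs_def]
    by (rule del_loc_form11 [where h = "a n", OF S S0]) (rule a(1) [OF nA], assumption, rule a(2) [OF nA S0])
  have del\<beta>n: "del \<beta> n 0 = form21 db"
    unfolding del_def db_def [abs_def]
    by (rule del_loc_form11 [where h = "b n", OF S S0]) (rule b(1) [OF nA], assumption, rule b(2) [OF nA S0])

  have D: "complex_linear D" "\<And>vs. D (\<theta> c x vs) = \<theta> n 0 (map D vs)" "\<And>vs. D (\<phi> c x vs) = \<phi> n 0 (map D vs)"
    using d_transition_inverse(1) [OF M c nA xo] pull\<Theta> [OF \<theta> xo] pull\<Theta> [OF \<phi> xo] by (simp_all add: D_def \<tau>x)
  have sharp: "contract 2 (sharp 2 \<omega> \<Gamma>) \<zeta> c x vs = form21 (\<lambda>k i l. \<Sum>j\<in>UNIV. C k i j * z j l) (map D vs)"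
    if \<Gamma>: "\<Gamma> n 0 = form21 C" "\<And>vs. \<Gamma> c x vs = \<Gamma> n 0 (map D vs)" and \<zeta>: "\<zeta> \<in> forms A 1 1" "\<zeta> n 0 = form11 z" for \<Gamma> \<zeta> C z vs
  proof -
    \<comment> \<open>As \<open>\<omega>\<close> is standard at 0, \<open>#\<close> just reads the last index of \<open>C\<close> as that of \<open>\<partial>/\<partial>z\<^sub>j\<close>.\<close>
    define \<psi>' :: "'n valtform" where "\<psi>' vs = (\<chi> j. form20 (\<lambda>k i. C k i j) vs)" for vs
    have \<psi>': "\<psi>' vs $ j = form20 (\<lambda>k i. C k i j) vs" for vs j by (simp add: \<psi>'_def)
    have 1: "\<psi>' \<in> Lambda_Theta 2" unfolding Lambda_Theta_2 using \<psi>' by blast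
    have 2: "contract_pt 2 \<psi>' (\<omega> n 0) = \<Gamma> n 0"
      unfolding g(1) [OF nA S0] g0(1) contract2_form11 [of \<psi>' C, OF \<psi>'] sum_kronecker \<Gamma> ..
    have pd: "positive_definite (g c x)" "positive_definite (g n 0)"
      unfolding g_def using kaehler_coefficients(2) [OF K] c x nA S0 by blast+
    have \<omega>x: "\<omega> c x vs = \<omega> n 0 (map D vs)" for vs
      by (simp only: pull [OF \<omega> xo] \<tau>x D_def)
    have DE: "D (d_transition n c (transition c n x) v) = v" for v
      unfolding D_def by (rule d_transition_inverse(3) [OF M c nA xo])
    have "\<exists>\<psi>. \<psi> \<in> Lambda_Theta 2 \<and> contract_pt 2 \<psi> (\<omega> c x) = \<Gamma> c x \<and> (\<forall>vs. \<psi>' (map D vs) = D (\<psi> vs))"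
      by (rule sharp_pullback [where E = "d_transition n c (transition c n x)" and h = "g c x" and h' = "g n 0"
            and \<omega>' = "\<omega> n 0" and \<Gamma>' = "\<Gamma> n 0"])
         (rule D(1) d_transition_inverse(2) [OF M c nA xo] DE pd g(1) [OF c x] g(1) [OF nA S0] \<omega>x \<Gamma>(2) 1 2)+
    then obtain \<psi> where \<psi>: "\<psi> \<in> Lambda_Theta 2" "contract_pt 2 \<psi> (\<omega> c x) = \<Gamma> c x" "\<And>vs. \<psi>' (map D vs) = D (\<psi> vs)"
      by blast
    have "sharp 2 \<omega> \<Gamma> c x = \<psi>"
      by (rule sharp_eq [where h = "g c x"]) (rule pd(1), rule g(1) [OF c x], rule \<psi>(1), rule \<psi>(2))
    moreover have "\<zeta> c x = (\<lambda>vs. form11 z (map D vs))"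
      by (rule ext) (simp only: pull [OF \<zeta>(1) xo] \<tau>x D_def \<zeta>(2))
    ultimately have "contract 2 (sharp 2 \<omega> \<Gamma>) \<zeta> c x vs = contract_pt 2 \<psi> (\<lambda>vs. form11 z (map D vs)) vs"
      by (simp only: contract_def)
    also have "\<dots> = contract_pt 2 \<psi>' (form11 z) (map D vs)"
      by (rule contract_pt_pullback [where D = D and \<eta> = "form11 z"]) (rule D(1), rule linear_form11, rule \<psi>(3))
    finally show ?thesis by (simp only: contract2_form11 [of \<psi>' C, OF \<psi>'])
  qed
  have con: "contract 1 \<theta> (del \<beta>) c x vs = form21 (\<lambda>i k l. \<Sum>j\<in>UNIV. a n 0 i j * (db j k l - db k j l)) (map D vs)" for vs
  proof -
    have e: "del \<beta> c x = (\<lambda>vs. form21 db (map D vs))" by (rule ext) (simp only: del\<beta> del\<beta>n)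
    have "contract 1 \<theta> (del \<beta>) c x vs = contract_pt 1 (\<theta> n 0) (form21 db) (map D vs)"
      unfolding contract_def e by (rule contract_pt_pullback [where D = D and \<eta> = "form21 db"])
         (rule D(1), rule linear_form21, rule D(2) [symmetric])
    then show ?thesis by (simp only: contract_form21 [of "\<theta> n 0" "t n 0", OF t(1) [OF nA S0]] t0)
  qed
  have con': "contract 1 \<phi> (del \<alpha>) c x vs = form21 (\<lambda>i k l. \<Sum>j\<in>UNIV. b n 0 i j * (da j k l - da k j l)) (map D vs)" for vs
  proof -
    have e: "del \<alpha> c x = (\<lambda>vs. form21 da (map D vs))" by (rule ext) (simp only: del\<alpha> del\<alpha>n)
    have "contract 1 \<phi> (del \<alpha>) c x vs = contract_pt 1 (\<phi> n 0) (form21 da) (map D vs)"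
      unfolding contract_def e by (rule contract_pt_pullback [where D = D and \<eta> = "form21 da"])
         (rule D(1), rule linear_form21, rule D(3) [symmetric])
    then show ?thesis by (simp only: contract_form21 [of "\<phi> n 0" "f n 0", OF f(1) [OF nA S0]] f0)
  qed
  have br: "bracket A \<omega> \<alpha> \<beta> c x vs = form21 (\<lambda>i k l. \<Sum>j\<in>UNIV. a n 0 i j * db j k l + b n 0 i j * da j k l) (map D vs)" for vs
  proof -
    have "bracket A \<omega> \<alpha> \<beta> c x vs = bracket_loc (\<alpha> n) (\<beta> n) 0 (map D vs)"
      by (simp add: bracket_def n_def [symmetric] Let_def D_def)
    also have "bracket_loc (\<alpha> n) (\<beta> n) 0 = form21 (\<lambda>i k l. \<Sum>j\<in>UNIV.
        a n 0 i j * d_dz j (\<lambda>y. b n y k l) 0 + b n 0 i j * d_dz j (\<lambda>y. a n y k l) 0)"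
      by (rule bracket_loc_form11 [where a = "a n" and b = "b n", OF S S0])
         (rule a(1) [OF nA], assumption, rule b(1) [OF nA], assumption)
    finally show ?thesis by (simp only: da_def db_def)
  qed
  have del\<eta>n: "del ?\<eta> n 0 = form21 (\<lambda>k i l. \<Sum>j\<in>UNIV. da k i j * b n 0 j l + a n 0 i j * db k j l
      + (db k i j * a n 0 j l + b n 0 i j * da k j l))"
  proof -
    have "d_dz k (\<lambda>y. m n y i l) 0 = (\<Sum>j\<in>UNIV. da k i j * b n 0 j l + a n 0 i j * db k j l
      + (db k i j * a n 0 j l + b n 0 i j * da k j l))" for k i l
    proof -
      note dif = t(2) [OF nA S0] f(2) [OF nA S0] a(2) [OF nA S0] b(2) [OF nA S0]
      have "d_dz k (\<lambda>y. m n y i l) 0 = d_dz k (\<lambda>y. (\<Sum>j\<in>UNIV. t n y i j * b n y j l) + (\<Sum>j\<in>UNIV. f n y i j * a n y j l)) 0"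
        by (simp only: m_def sum.distrib)
      also have "\<dots> = (\<Sum>j\<in>UNIV. d_dz k (\<lambda>y. t n y i j * b n y j l + f n y i j * a n y j l) 0)"
        by (subst sum.distrib [symmetric]) (intro d_dz_sum differentiable_add differentiable_mult dif)
      also have "\<dots> = (\<Sum>j\<in>UNIV. d_dz k (\<lambda>y. t n y i j * b n y j l) 0 + d_dz k (\<lambda>y. f n y i j * a n y j l) 0)"
      proof (rule sum.cong [OF refl])
        fix j
        show "d_dz k (\<lambda>y. t n y i j * b n y j l + f n y i j * a n y j l) 0 =
          d_dz k (\<lambda>y. t n y i j * b n y j l) 0 + d_dz k (\<lambda>y. f n y i j * a n y j l) 0"
          by (rule d_dz_add [OF differentiable_mult [OF dif(1,4)] differentiable_mult [OF dif(2,3)]])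
      qed
      finally show ?thesis
        unfolding d_dz_mult [OF dif(1,4)] d_dz_mult [OF dif(2,3)] t0d f0d t0 f0
          da_def [symmetric] db_def [symmetric] .
    qed
    then show ?thesis
      unfolding del_def
      by (subst del_loc_form11 [where h = "m n", OF S S0]) (simp_all only: \<eta> [OF nA] md [OF nA S0])
  qed
  show "(bracket A \<omega> \<alpha> \<beta> + del ?\<eta>) c x = (contract 2 (sharp 2 \<omega> (del \<alpha>)) \<beta> + contract 2 (sharp 2 \<omega> (del \<beta>)) \<alpha>
       + contract 1 \<theta> (del \<beta>) + contract 1 \<phi> (del \<alpha>)) c x"
  proof
    fix vs
    show "(bracket A \<omega> \<alpha> \<beta> + del ?\<eta>) c x vs = (contract 2 (sharp 2 \<omega> (del \<alpha>)) \<beta> + contract 2 (sharp 2 \<omega> (del \<beta>)) \<alpha>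
       + contract 1 \<theta> (del \<beta>) + contract 1 \<phi> (del \<alpha>)) c x vs"
      unfolding add_form_apply br del\<eta> del\<eta>n con con'
        sharp [OF del\<alpha>n del\<alpha> \<beta> b(1) [OF nA S0]] sharp [OF del\<beta>n del\<beta> \<alpha> a(1) [OF nA S0]]
      by (rule coefficient_identity)
  qed
qed

end
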